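(* Let $X\subset\mathbb{C}^3$ (coordinates $(x,y,z)$) be a weighted homogeneous algebraic surface with respect to weights $w_1\geq w_2>w_3$ (of $x$, $y$, $z$ respectively) and with an isolated singularity at $0$. If $(X\setminus\{0\})\cap\{z=0\}$ is not connected, then $X$ has a separating set at $0$.
   Context: The weights $w_1,w_2,w_3$ are positive integers, and $X$ weighted homogeneous means that $X$ is the zero set of a weighted homogeneous polynomial for these weights; in particular $X$ is invariant under the $\mathbb{C}^*$-action $\lambda\cdot(x,y,z)=(\lambda^{w_1}x,\lambda^{w_2}y,\lambda^{w_3}z)$. Identify $\mathbb{C}^3$ with $\mathbb{R}^6$, so that $X$ is a real semialgebraic set of dimension $4$. Densities: for a $k$-dimensional rectifiable subset $V\subset\mathbb{R}^n$ and $x_0\in\mathbb{R}^n$, the inferior and superior $k$-densities of $V$ at $x_0$ are $\underline\Theta^k(V,x_0)=\liminf_{\epsilon\to0^+}\frac{\mathcal{H}^k(V\cap \epsilon B(x_0))}{\eta\epsilon^k}$ and $\overline\Theta^k(V,x_0)=\limsup_{\epsilon\to0^+}\frac{\mathcal{H}^k(V\cap \epsilon B(x_0))}{\eta\epsilon^k}$, where $\epsilon B(x_0)$ is the $n$-dimensional ball of radius $\epsilon$ centered at $x_0$, $\eta$ is the volume of the $k$-dimensional unit ball, and $\mathcal{H}^k$ is $k$-dimensional Hausdorff measure. If they coincide, the common value is the $k$-density of $V$ at $x_0$ (for semialgebraic sets it always exists). Separating set: let $X\subset\mathbb{R}^n$ be a $k$-dimensional semialgebraic set and $x_0\in X$ a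 point at which the $k$-density of $X$ is positive. A $(k-1)$-dimensional rectifiable subset $Y\subset X$ with $x_0\in Y$ is a separating set of $X$ at $x_0$ if: (i) for some small $\epsilon>0$ the set $(\epsilon B(x_0)\cap X)\setminus Y$ has at least two connected components $A$ and $B$; (ii) the $(k-1)$-density of $Y$ at $x_0$ is zero; (iii) the inferior $k$-densities of $A$ and $B$ at $x_0$ are nonzero. *)

theory Defs
  imports "HOL-Analysis.Analysis" "HOL-Library.Poly_Mapping"
begin

section \<open>Weighted homogeneous polynomials and algebraic sets\<close>

text \<open>A polynomial over \<open>\<complex>\<close> in the variables indexed by \<open>'n\<close> is given by its finitely
  supported coefficient function on exponent vectors.\<close>

type_synonym 'n cpoly = "('n \<Rightarrow> nat) \<Rightarrow>\<^sub>0 complex"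

definition cpoly_eval :: "'n::finite cpoly \<Rightarrow> complex ^ 'n \<Rightarrow> complex" where
  "cpoly_eval f a =
     (\<Sum>m\<in>Poly_Mapping.keys f. Poly_Mapping.lookup f m * (\<Prod>i\<in>UNIV. (a $ i) ^ m i))"

definition weighted_homogeneous :: "('n::finite \<Rightarrow> nat) \<Rightarrow> 'n cpoly \<Rightarrow> bool" where
  "weighted_homogeneous w f \<longleftrightarrow>
     (\<exists>d. \<forall>m\<in>Poly_Mapping.keys f. (\<Sum>i\<in>UNIV. w i * m i) = d)"

definition zero_set :: "'n::finite cpoly \<Rightarrow> (complex ^ 'n) set" where
  "zero_set f = {a. cpoly_eval f a = 0}"

definition vanishing_polys :: "(complex ^ 'n::finite) set \<Rightarrow> 'n cpoly set" where
  "vanishing_polys X = {g. \<forall>a\<in>X. cpoly_eval g a = 0}"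

text \<open>Jacobian criterion for a hypersurface \<open>X\<close>: a point is singular iff all partial derivatives
  of all polynomials in the ideal of \<open>X\<close> vanish there. Using the whole ideal of the set \<open>X\<close>,
  instead of one defining polynomial, makes this independent of whether the latter is reduced.\<close>

definition singular_locus :: "(complex ^ 'n::finite) set \<Rightarrow> (complex ^ 'n) set" where
  "singular_locus X =
     {a \<in> X. \<forall>g\<in>vanishing_polys X. (cpoly_eval g has_derivative (\<lambda>_. 0)) (at a)}"


section \<open>Hausdorff measure, dimension, rectifiability and densities\<close>

text \<open>The normalisation is the usual one, for which \<open>\<H>\<^sup>k\<close> is Lebesgue measure on \<open>\<real>\<^sup>k\<close>. The case
  distinctions only matter for \<open>s = 0\<close> (counting measure), since \<open>0 powr 0 = 0\<close> in HOL.\<close>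

definition hausdorff_gauge :: "real \<Rightarrow> 'a::metric_space set \<Rightarrow> ennreal" where
  "hausdorff_gauge s C =
     (if C = {} then 0 else if s = 0 then 1
      else ennreal (unit_ball_vol s * (diameter C / 2) powr s))"

text \<open>Boundedness is required of the covering sets because \<open>diameter\<close> is unspecified on
  unbounded sets.\<close>

definition hausdorff_premeasure :: "real \<Rightarrow> real \<Rightarrow> 'a::metric_space set \<Rightarrow> ennreal" where
  "hausdorff_premeasure s \<delta> V =
     (INF C \<in> {C :: nat \<Rightarrow> 'a set. V \<subseteq> (\<Union>i. C i) \<and> (\<forall>i. bounded (C i) \<and> diameter (C i) \<le> \<delta>)}.
        suminf (\<lambda>i. hausdorff_gauge s (C i)))"

definition hausdorff_measure :: "real \<Rightarrow> 'a::metric_space set \<Rightarrow> ennreal" where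
  "hausdorff_measure s V = (SUP \<delta>\<in>{0<..}. hausdorff_premeasure s \<delta> V)"

definition hausdorff_dim :: "'a::metric_space set \<Rightarrow> ereal" where
  "hausdorff_dim V = (INF s\<in>{s. 0 \<le> s \<and> hausdorff_measure s V = 0}. ereal s)"

text \<open>A Lipschitz map \<open>\<real>\<^sup>k \<rightarrow> 'a\<close>, for a numeral \<open>k\<close> that is not a type, is encoded as a map on
  sequences that is Lipschitz for the Euclidean distance of the first \<open>k\<close> entries; in particular
  it only depends on these entries.\<close>

definition lipschitz_map :: "nat \<Rightarrow> ((nat \<Rightarrow> real) \<Rightarrow> 'a::metric_space) \<Rightarrow> bool" where
  "lipschitz_map k f \<longleftrightarrow> (\<exists>L. \<forall>u v. dist (f u) (f v) \<le> L * L2_set (\<lambda>i. u i - v i) {..<k})"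

text \<open>A \<open>k\<close>-dimensional rectifiable set: of Hausdorff dimension \<open>k\<close>, and covered up to an
  \<open>\<H>\<^sup>k\<close>-null set by countably many Lipschitz images of \<open>\<real>\<^sup>k\<close>.\<close>

definition rectifiable_set :: "nat \<Rightarrow> 'a::metric_space set \<Rightarrow> bool" where
  "rectifiable_set k V \<longleftrightarrow> hausdorff_dim V = ereal (real k) \<and>
     (\<exists>f :: nat \<Rightarrow> (nat \<Rightarrow> real) \<Rightarrow> 'a. (\<forall>j. lipschitz_map k (f j)) \<and>
        hausdorff_measure (real k) (V - (\<Union>j. range (f j))) = 0)"

definition density_ratio :: "nat \<Rightarrow> 'a::metric_space set \<Rightarrow> 'a \<Rightarrow> real \<Rightarrow> ennreal" where
  "density_ratio k V x0 \<epsilon> =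
     hausdorff_measure (real k) (V \<inter> ball x0 \<epsilon>) / ennreal (unit_ball_vol (real k) * \<epsilon> ^ k)"

definition lower_density :: "nat \<Rightarrow> 'a::metric_space set \<Rightarrow> 'a \<Rightarrow> ennreal" where
  "lower_density k V x0 = Liminf (at_right 0) (density_ratio k V x0)"

definition upper_density :: "nat \<Rightarrow> 'a::metric_space set \<Rightarrow> 'a \<Rightarrow> ennreal" where
  "upper_density k V x0 = Limsup (at_right 0) (density_ratio k V x0)"

definition has_density :: "nat \<Rightarrow> 'a::metric_space set \<Rightarrow> 'a \<Rightarrow> ennreal \<Rightarrow> bool" where
  "has_density k V x0 d \<longleftrightarrow> lower_density k V x0 = d \<and> upper_density k V x0 = d"


section \<open>Semialgebraic sets and separating sets\<close>

inductive semialgebraic :: "'a::euclidean_space set \<Rightarrow> bool" where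
  zero: "real_polynomial_function p \<Longrightarrow> semialgebraic {x. p x = 0}"
| pos: "real_polynomial_function p \<Longrightarrow> semialgebraic {x. p x > 0}"
| compl: "semialgebraic S \<Longrightarrow> semialgebraic (- S)"
| inter: "semialgebraic S \<Longrightarrow> semialgebraic T \<Longrightarrow> semialgebraic (S \<inter> T)"
| union: "semialgebraic S \<Longrightarrow> semialgebraic T \<Longrightarrow> semialgebraic (S \<union> T)"

text \<open>The first two lines are the standing requirements on \<open>(X, x0)\<close>. For semialgebraic sets the
  semialgebraic dimension is the Hausdorff dimension, and the \<open>k\<close>-density always exists, so it is
  positive iff the inferior density is. ``For some small \<open>\<epsilon>\<close>'' is read as: for arbitrarily
  small \<open>\<epsilon> > 0\<close>.\<close>

definition separating_set :: "nat \<Rightarrow> 'a::euclidean_space set \<Rightarrow> 'a \<Rightarrow> 'a set \<Rightarrow> bool" where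
  "separating_set k X x0 Y \<longleftrightarrow>
     1 \<le> k \<and> semialgebraic X \<and> hausdorff_dim X = ereal (real k) \<and>
     x0 \<in> X \<and> 0 < lower_density k X x0 \<and>
     rectifiable_set (k - 1) Y \<and> Y \<subseteq> X \<and> x0 \<in> Y \<and>
     has_density (k - 1) Y x0 0 \<and>
     (\<forall>\<delta>>0. \<exists>\<epsilon>>0. \<epsilon> < \<delta> \<and>
        (\<exists>A \<in> components ((ball x0 \<epsilon> \<inter> X) - Y). \<exists>B \<in> components ((ball x0 \<epsilon> \<inter> X) - Y).
           A \<noteq> B \<and> lower_density k A x0 \<noteq> 0 \<and> lower_density k B x0 \<noteq> 0))"

end

theory Submission
  imports Defs "HOL-Complex_Analysis.Conformal_Mappings"
begin

text \<open>The curve \<open>z = 0\<close> on \<open>X - {0}\<close> splits into two closed pieces that are invariant under the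
  weighted action, and so does a weighted conical neighbourhood \<open>\<bar>z\<bar>\<^bsup>1/w\<^sub>3\<^esup> < \<delta> max (\<bar>x\<bar>\<^bsup>1/w\<^sub>1\<^esup>, \<bar>y\<bar>\<^bsup>1/w\<^sub>2\<^esup>)\<close>.
  Its boundary is the cone over a compact subset of the smooth affine curve \<open>X \<inter> {z = 1}\<close>. That
  subset is covered by finitely many discs, each of them a Lipschitz graph over a disc in the \<open>x\<close>- or the
  \<open>y\<close>-coordinate, and \<open>Y\<close> is the cone over the circles that bound them: a connected subset of \<open>X - Y\<close> which
  meets \<open>z = 0\<close> cannot enter the cone over a disc, hence stays in one of the two pieces.

  As \<open>w\<^sub>3\<close> is the smallest weight, \<open>Y\<close> is tangent to the \<open>z\<close>-axis: inside the ball of radius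
  \<open>\<epsilon> = \<tau>\<^bsup>w\<^sub>3\<^esup>\<close> its \<open>3\<close>-dimensional measure is of order \<open>\<tau>\<^bsup>2 w\<^sub>3 + w\<^sub>2\<^esup> = o(\<epsilon>\<^sup>3)\<close>. A component
  near a point \<open>p\<close> of the curve contains the cone over a neighbourhood of \<open>p\<close> in \<open>X\<close>, and a linear
  projection to a coordinate plane maps its points of norm \<open>O(\<bar>u\<bar>)\<close> onto all \<open>(u, v)\<close> with
  \<open>\<bar>v\<bar> \<le> \<bar>u\<bar> < \<eta>\<close>, which bounds the \<open>4\<close>-density from below.\<close>

section \<open>Hausdorff measure\<close>

text \<open>The polynomial \<open>f\<close> may be non-reduced, so its own gradient can vanish on
  all of \<open>X\<close>. The graph charts therefore combine two polynomials: some \<open>g\<close>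
  in the ideal of \<open>X\<close> with non-zero gradient makes the zeros a Lipschitz graph, while
  \<open>f\<close>, whose zeros are exactly \<open>X\<close>, supplies a point over every nearby
  parameter by persistence of roots. The Euler relation along orbits constrains the gradient: on
  \<open>z = 1\<close> it forces a non-zero \<open>x\<close>- or \<open>y\<close>-component, and on
  the \<open>x\<close>-axis it kills the \<open>x\<close>-component. The delicate density estimate
  is at a point of the \<open>x\<close>-axis. A piece of the curve may consist of that axis alone,
  so such points cannot be avoided; the slice can be tangent to \<open>z = 0\<close> there, and the
  order of contact decides which projection works. Circles replace the boundary of the conical
  neighbourhood because that boundary is only a level set of continuous functions, whereas circles
  carry explicit Lipschitz coordinates. The gain in measure comes from \<open>z = 1\<close> being
  constant on the slice: going round a circle moves the scaled point only in \<open>x\<close> and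
  \<open>y\<close>, at scale \<open>\<tau> ^ w 2\<close> instead of
  \<open>\<tau> ^ w 3\<close>.\<close>

lemma hausdorff_premeasure_le_suminf:
  assumes "V \<subseteq> (\<Union>i. C i)" "\<And>i. bounded (C i)" "\<And>i. diameter (C i) \<le> \<delta>"
  shows "hausdorff_premeasure s \<delta> V \<le> suminf (\<lambda>i. hausdorff_gauge s (C i))"
  unfolding hausdorff_premeasure_def using assms by (intro INF_lower) auto

lemma hausdorff_measure_mono:
  assumes "V \<subseteq> W"
  shows "hausdorff_measure s V \<le> hausdorff_measure s W"
  unfolding hausdorff_measure_def hausdorff_premeasure_def
  using assms by (intro SUP_mono' INF_superset_mono) auto

lemma hausdorff_gauge_empty [simp]: "hausdorff_gauge s {} = 0"
  by (simp add: hausdorff_gauge_def)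

lemma hausdorff_measure_empty [simp]: "hausdorff_measure s ({} :: 'a::metric_space set) = 0"
proof -
  have "hausdorff_premeasure s \<delta> ({} :: 'a set) \<le> 0" if "\<delta> > 0" for \<delta>
    using hausdorff_premeasure_le_suminf[of "{}" "\<lambda>_. {} :: 'a set" \<delta> s] that by auto
  then show ?thesis
    unfolding hausdorff_measure_def by (auto intro!: antisym SUP_least)
qed

lemma hausdorff_premeasure_countable_subadditive:
  "hausdorff_premeasure s \<delta> (\<Union>n. V n) \<le> suminf (\<lambda>n::nat. hausdorff_premeasure s \<delta> (V n))"
proof (rule ennreal_le_epsilon)
  fix e :: real
  assume fin: "(suminf (\<lambda>n. hausdorff_premeasure s \<delta> (V n))) < top" and e: "0 < e"
  define P where "P n C \<longleftrightarrow> V n \<subseteq> (\<Union>i. C i) \<and> (\<forall>i. bounded (C i) \<and> diameter (C i) \<le> \<delta>) \<and>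
      suminf (\<lambda>i. hausdorff_gauge s (C i)) \<le> hausdorff_premeasure s \<delta> (V n) + ennreal (e * (1/2) ^ Suc n)"
    for n and C :: "nat \<Rightarrow> 'a set"
  have "\<exists>C. P n C" for n
  proof -
    have "hausdorff_premeasure s \<delta> (V n) < top"
      using fin ennreal_suminf_lessD by blast
    then have "hausdorff_premeasure s \<delta> (V n) < hausdorff_premeasure s \<delta> (V n) + ennreal (e * (1/2) ^ Suc n)"
      using e by (simp add: ennreal_add_left_cancel_less[of _ 0, simplified])
    then obtain C where "C \<in> {C :: nat \<Rightarrow> 'a set. V n \<subseteq> (\<Union>i. C i) \<and> (\<forall>i. bounded (C i) \<and> diameter (C i) \<le> \<delta>)}"
      "suminf (\<lambda>i. hausdorff_gauge s (C i)) < hausdorff_premeasure s \<delta> (V n) + ennreal (e * (1/2) ^ Suc n)"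
      by (subst (asm) (1) hausdorff_premeasure_def) (auto simp: INF_less_iff)
    then show ?thesis
      unfolding P_def by (intro exI[of _ C]) auto
  qed
  then obtain C where C: "\<And>n. P n (C n)" by metis
  define D where "D k = (case prod_decode k of (n, i) \<Rightarrow> C n i)" for k
  have "hausdorff_premeasure s \<delta> (\<Union>n. V n) \<le> suminf (\<lambda>k. hausdorff_gauge s (D k))"
  proof (rule hausdorff_premeasure_le_suminf)
    show "(\<Union>n. V n) \<subseteq> (\<Union>k. D k)"
    proof
      fix x assume "x \<in> (\<Union>n. V n)"
      then obtain n i where "x \<in> C n i"
        using C unfolding P_def by blast
      then have "x \<in> D (prod_encode (n, i))" by (simp add: D_def)
      then show "x \<in> (\<Union>k. D k)" by blast
    qed
  qed (use C in \<open>auto simp: D_def P_def split: prod.splits\<close>)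
  also have "\<dots> = suminf (\<lambda>k. (\<lambda>(n, i). hausdorff_gauge s (C n i)) (prod_decode k))"
    by (intro suminf_cong) (simp add: D_def split: prod.splits)
  also have "\<dots> = suminf (\<lambda>n. suminf (\<lambda>i. hausdorff_gauge s (C n i)))"
    by (rule suminf_ennreal_2dimen) simp
  also have "\<dots> \<le> suminf (\<lambda>n. hausdorff_premeasure s \<delta> (V n) + ennreal (e * (1/2) ^ Suc n))"
    using C by (intro suminf_le) (auto simp: P_def)
  also have "\<dots> = suminf (\<lambda>n. hausdorff_premeasure s \<delta> (V n)) + (suminf (\<lambda>n. ennreal (e * (1/2) ^ Suc n)))"
    by (rule suminf_add[symmetric]) auto
  also have "suminf (\<lambda>n. ennreal (e * (1/2) ^ Suc n)) = ennreal e"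
  proof (rule suminf_ennreal_eq)
    show "(\<lambda>n. e * (1/2) ^ Suc n) sums e"
      using sums_mult[OF power_half_series, of e] by simp
  qed (use e in simp)
  finally show "hausdorff_premeasure s \<delta> (\<Union>n. V n) \<le> suminf (\<lambda>n. hausdorff_premeasure s \<delta> (V n)) + ennreal e" .
qed

lemma hausdorff_measure_countable_subadditive:
  "hausdorff_measure s (\<Union>n. V n) \<le> suminf (\<lambda>n::nat. hausdorff_measure s (V n))"
  unfolding hausdorff_measure_def[of s "\<Union>n. V n"]
proof (rule SUP_least)
  fix \<delta> :: real assume "\<delta> \<in> {0<..}"
  have "hausdorff_premeasure s \<delta> (\<Union>n. V n) \<le> suminf (\<lambda>n. hausdorff_premeasure s \<delta> (V n))"
    by (rule hausdorff_premeasure_countable_subadditive)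
  also have "\<dots> \<le> suminf (\<lambda>n. hausdorff_measure s (V n))"
    using \<open>\<delta> \<in> {0<..}\<close> by (intro suminf_le) (auto simp: hausdorff_measure_def intro: SUP_upper)
  finally show "hausdorff_premeasure s \<delta> (\<Union>n. V n) \<le> suminf (\<lambda>n. hausdorff_measure s (V n))" .
qed

lemma hausdorff_measure_countable_Union_eq_0:
  assumes "countable F" "\<And>V. V \<in> F \<Longrightarrow> hausdorff_measure s V = 0"
  shows "hausdorff_measure s (\<Union>F) = 0"
proof (cases "F = {}")
  case False
  have "\<Union>F = (\<Union>n. from_nat_into F n)"
    using range_from_nat_into[OF False assms(1)] by simp
  moreover have "hausdorff_measure s (from_nat_into F n) = 0" for n
    using from_nat_into[OF False] assms(2) by blast
  ultimately show ?thesis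
    using hausdorff_measure_countable_subadditive[of s "from_nat_into F"] by simp
qed simp

lemma hausdorff_measure_Un_le:
  "hausdorff_measure s (V \<union> W) \<le> hausdorff_measure s V + hausdorff_measure s W"
proof -
  define C where "C n = (if n = 0 then V else if n = 1 then W else {})" for n :: nat
  have "V \<union> W = (\<Union>n. C n)"
    by (auto simp: C_def split: if_splits)
  also have "hausdorff_measure s \<dots> \<le> suminf (\<lambda>n. hausdorff_measure s (C n))"
    by (rule hausdorff_measure_countable_subadditive)
  also have "\<dots> = (\<Sum>n\<in>{0,1}. hausdorff_measure s (C n))"
    by (rule suminf_finite) (auto simp: C_def)
  also have "\<dots> = hausdorff_measure s V + hausdorff_measure s W"
    by (simp add: C_def)
  finally show ?thesis .
qed

lemma hausdorff_premeasure_finite_cover: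
  assumes "finite I" "V \<subseteq> (\<Union>i\<in>I. C i)" "0 \<le> d" "d \<le> \<delta>" "0 < s"
    and "\<And>i x y. i \<in> I \<Longrightarrow> x \<in> C i \<Longrightarrow> y \<in> C i \<Longrightarrow> dist x y \<le> d"
  shows "hausdorff_premeasure s \<delta> V \<le> ennreal (real (card I) * (unit_ball_vol s * (d / 2) powr s))"
proof -
  obtain b where b: "bij_betw b {..<card I} I"
    using ex_bij_betw_nat_finite[OF assms(1)] by (auto simp: lessThan_atLeast0)
  define D where "D n = (if n < card I then C (b n) else {})" for n
  have diamD: "dist x y \<le> d" if "x \<in> D n" "y \<in> D n" for x y n
    using that assms(6) bij_betwE[OF b] by (auto simp: D_def split: if_splits)
  have bd: "bounded (D n)" for n
    unfolding bounded_two_points using diamD by blast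
  have diam: "diameter (D n) \<le> d" for n
    using diamD \<open>0 \<le> d\<close> by (auto simp: diameter_def intro!: cSUP_least)
  have "hausdorff_premeasure s \<delta> V \<le> suminf (\<lambda>n. hausdorff_gauge s (D n))"
  proof (rule hausdorff_premeasure_le_suminf)
    show "V \<subseteq> (\<Union>n. D n)"
    proof
      fix x assume "x \<in> V"
      then obtain i where "i \<in> I" "x \<in> C i" using assms(2) by blast
      moreover from \<open>i \<in> I\<close> obtain n where "n < card I" "b n = i"
        using b unfolding bij_betw_def by force
      ultimately show "x \<in> (\<Union>n. D n)" by (auto simp: D_def intro!: exI[of _ n])
    qed
  qed (use bd diam \<open>d \<le> \<delta>\<close> in \<open>auto intro: order_trans\<close>)
  also have "\<dots> = (\<Sum>n<card I. hausdorff_gauge s (D n))"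
    by (rule suminf_finite) (auto simp: D_def)
  also have "\<dots> \<le> (\<Sum>n<card I. ennreal (unit_ball_vol s * (d / 2) powr s))"
  proof (rule sum_mono)
    fix n
    have "(diameter (D n) / 2) powr s \<le> (d / 2) powr s"
      using diam[of n] bd[of n] \<open>0 < s\<close> by (intro powr_mono2) (auto intro: diameter_ge_0)
    then show "hausdorff_gauge s (D n) \<le> ennreal (unit_ball_vol s * (d / 2) powr s)"
      using \<open>0 < s\<close> by (auto simp: hausdorff_gauge_def intro!: ennreal_leI mult_left_mono)
  qed
  also have "\<dots> = ennreal (real (card I) * (unit_ball_vol s * (d / 2) powr s))"
    using \<open>0 < s\<close> by (simp add: ennreal_mult ennreal_of_nat_eq_real_of_nat)
  finally show ?thesis .
qed

text \<open>Cutting the coordinate cube into boxes whose side in direction \<open>i\<close> is about \<open>h / L i\<close>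
  covers \<open>V\<close> by about \<open>(\<Prod>i. L i) / h ^ k\<close> sets of diameter at most \<open>k * h\<close>.\<close>

lemma hausdorff_premeasure_coordinates:
  fixes u :: "'a::metric_space \<Rightarrow> nat \<Rightarrow> real"
  assumes L: "\<And>i. i < k \<Longrightarrow> 0 < L i" and s: "0 < s"
    and u: "\<And>a i. a \<in> V \<Longrightarrow> i < k \<Longrightarrow> u a i \<in> {0..1}"
    and dist: "\<And>a b. a \<in> V \<Longrightarrow> b \<in> V \<Longrightarrow> dist a b \<le> (\<Sum>i<k. L i * \<bar>u a i - u b i\<bar>)"
    and h: "0 < h" "\<And>i. i < k \<Longrightarrow> h \<le> L i" "real k * h \<le> \<delta>"
  shows "hausdorff_premeasure s \<delta> V
      \<le> ennreal (3 ^ k * (\<Prod>i<k. L i) * unit_ball_vol s * (real k / 2) powr s * h powr (s - real k))"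
proof -
  define n where "n i = nat \<lfloor>L i / h\<rfloor> + 1" for i
  \<comment> \<open>The endpoint \<open>u a i = 1\<close> has index \<open>n i\<close>, so each
    direction has \<open>n i + 1\<close> cells.\<close>
  define I where "I = PiE {..<k} (\<lambda>i. {..n i})"
  define C where "C c = {a \<in> V. \<forall>i<k. nat \<lfloor>real (n i) * u a i\<rfloor> = c i}" for c :: "nat \<Rightarrow> nat"
  have n_pos: "0 < real (n i)" for i by (simp add: n_def)
  have n_lower: "L i / h \<le> real (n i)" if "i < k" for i
  proof -
    have "0 \<le> L i / h" using L[OF that] h by simp
    then show ?thesis unfolding n_def by linarith
  qed
  \<comment> \<open>\<open>h \<le> L i\<close> absorbs the two extra cells; this is the origin of
    the factor \<open>3 ^ k\<close>.\<close>
  have n_upper: "real (n i + 1) \<le> 3 * (L i / h)" if "i < k" for i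
  proof -
    have "1 \<le> L i / h" using h(1) h(2)[OF that] by simp
    then show ?thesis unfolding n_def by linarith
  qed
  have fin: "finite I" unfolding I_def by (intro finite_PiE) auto
  have card: "real (card I) = (\<Prod>i<k. real (n i + 1))"
    unfolding I_def by (subst card_PiE) auto
  have cover: "V \<subseteq> (\<Union>c\<in>I. C c)"
  proof
    fix a assume a: "a \<in> V"
    define c where "c = restrict (\<lambda>i. nat \<lfloor>real (n i) * u a i\<rfloor>) {..<k}"
    have "c i \<le> n i" if "i < k" for i
    proof -
      have "real (n i) * u a i \<le> real (n i) * 1"
        using u[OF a that] by (intro mult_left_mono) auto
      then show ?thesis using that unfolding c_def by simp linarith
    qed
    then have "c \<in> I" unfolding I_def c_def by auto
    moreover have "a \<in> C c" using a by (auto simp: C_def c_def)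
    ultimately show "a \<in> (\<Union>c\<in>I. C c)" by blast
  qed
  have small: "dist a b \<le> real k * h" if "a \<in> C c" "b \<in> C c" for a b c
  proof -
    have ab: "a \<in> V" "b \<in> V" using that by (auto simp: C_def)
    have "L i * \<bar>u a i - u b i\<bar> \<le> h" if i: "i < k" for i
    proof -
      have "nat \<lfloor>real (n i) * u a i\<rfloor> = nat \<lfloor>real (n i) * u b i\<rfloor>"
        using \<open>a \<in> C c\<close> \<open>b \<in> C c\<close> i by (simp add: C_def)
      moreover have "0 \<le> real (n i) * u a i" "0 \<le> real (n i) * u b i"
        using u[OF ab(1) i] u[OF ab(2) i] n_pos[of i] by auto
      ultimately have "\<bar>real (n i) * u a i - real (n i) * u b i\<bar> \<le> 1" by linarith
      then have "real (n i) * \<bar>u a i - u b i\<bar> \<le> 1"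
        using n_pos[of i] by (simp add: abs_mult flip: right_diff_distrib)
      moreover have "L i / h * \<bar>u a i - u b i\<bar> \<le> real (n i) * \<bar>u a i - u b i\<bar>"
        using n_lower[OF i] by (intro mult_right_mono) auto
      ultimately have "L i / h * \<bar>u a i - u b i\<bar> \<le> 1" by linarith
      then show ?thesis using h(1) by (simp add: field_simps)
    qed
    then have "(\<Sum>i<k. L i * \<bar>u a i - u b i\<bar>) \<le> (\<Sum>i<k. h)"
      by (intro sum_mono) auto
    with dist[OF ab] show ?thesis by simp
  qed
  have "hausdorff_premeasure s \<delta> V \<le> ennreal (real (card I) * (unit_ball_vol s * (real k * h / 2) powr s))"
    using fin cover small h s by (intro hausdorff_premeasure_finite_cover[where C = C]) auto
  also have "\<dots> \<le> ennreal (3 ^ k * (\<Prod>i<k. L i) * unit_ball_vol s * (real k / 2) powr s * h powr (s - real k))"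
  proof (rule ennreal_leI)
    have "(\<Prod>i<k. real (n i + 1)) \<le> (\<Prod>i<k. 3 * (L i / h))"
      using n_upper by (intro prod_mono) auto
    also have "\<dots> = 3 ^ k * (\<Prod>i<k. L i) / h ^ k"
      by (simp add: prod.distrib prod_dividef)
    finally have "real (card I) * (unit_ball_vol s * (real k * h / 2) powr s)
      \<le> 3 ^ k * (\<Prod>i<k. L i) / h ^ k * (unit_ball_vol s * (real k * h / 2) powr s)"
      unfolding card using s by (intro mult_right_mono) auto
    also have "3 ^ k * (\<Prod>i<k. L i) / h ^ k * (unit_ball_vol s * (real k * h / 2) powr s)
       = 3 ^ k * (\<Prod>i<k. L i) * unit_ball_vol s * (real k / 2) powr s * h powr (s - real k)"
      using h(1) by (simp add: powr_diff powr_realpow powr_mult powr_divide mult_ac)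
    finally show "real (card I) * (unit_ball_vol s * (real k * h / 2) powr s)
       \<le> 3 ^ k * (\<Prod>i<k. L i) * unit_ball_vol s * (real k / 2) powr s * h powr (s - real k)" .
  qed
  finally show ?thesis .
qed

section \<open>Upper bounds for Hausdorff measure from anisotropic coordinates\<close>

context
  fixes u :: "'a::metric_space \<Rightarrow> nat \<Rightarrow> real" and V :: "'a set" and k :: nat and L :: "nat \<Rightarrow> real"
  assumes L: "\<And>i. i < k \<Longrightarrow> 0 < L i" and k: "0 < k"
    and u: "\<And>a i. a \<in> V \<Longrightarrow> i < k \<Longrightarrow> u a i \<in> {0..1}"
    and dist: "\<And>a b. a \<in> V \<Longrightarrow> b \<in> V \<Longrightarrow> dist a b \<le> (\<Sum>i<k. L i * \<bar>u a i - u b i\<bar>)"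
begin

lemma small_mesh_exists:
  assumes "0 < \<delta>"
  obtains h0 where "0 < h0" "\<And>h i. 0 < h \<Longrightarrow> h \<le> h0 \<Longrightarrow> i < k \<Longrightarrow> h \<le> L i"
    "\<And>h. 0 < h \<Longrightarrow> h \<le> h0 \<Longrightarrow> real k * h \<le> \<delta>"
proof
  let ?h0 = "min (\<delta> / real k) (Min (L ` {..<k}))"
  have "0 < Min (L ` {..<k})"
    using k L by (subst Min_gr_iff) auto
  then show "0 < ?h0" using assms k by simp
  show "h \<le> L i" if "0 < h" "h \<le> ?h0" "i < k" for h i
  proof -
    have "Min (L ` {..<k}) \<le> L i" using that(3) by (intro Min_le) auto
    with that(2) show ?thesis by simp
  qed
  show "real k * h \<le> \<delta>" if "0 < h" "h \<le> ?h0" for h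
    using that k by (simp add: field_simps)
qed

text \<open>For exponent \<open>k\<close> the mesh \<open>h\<close> cancels from the covering bound,
  so the same bound holds for every \<open>\<delta>\<close>. Keeping the product of the
  \<open>L i\<close> separate by direction is what later yields the sharp power of
  \<open>\<tau>\<close>.\<close>

lemma hausdorff_measure_coordinates_le:
  "hausdorff_measure (real k) V
     \<le> ennreal (3 ^ k * unit_ball_vol (real k) * (real k / 2) ^ k * (\<Prod>i<k. L i))"
  unfolding hausdorff_measure_def
proof (rule SUP_least)
  fix \<delta> :: real assume "\<delta> \<in> {0<..}"
  then obtain h where h: "0 < h" "\<And>i. i < k \<Longrightarrow> h \<le> L i" "real k * h \<le> \<delta>"
    using small_mesh_exists[of \<delta>] by (metis greaterThan_iff order_refl)
  show "hausdorff_premeasure (real k) \<delta> V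
     \<le> ennreal (3 ^ k * unit_ball_vol (real k) * (real k / 2) ^ k * (\<Prod>i<k. L i))"
    using hausdorff_premeasure_coordinates[of k L "real k" V u h \<delta>] L u dist h k
    by (simp add: powr_realpow ac_simps)
qed

text \<open>The covering bound now carries the factor \<open>h powr (s - k)\<close> with positive
  exponent, and the mesh may tend to 0.\<close>

lemma hausdorff_measure_coordinates_eq_0:
  assumes "real k < s"
  shows "hausdorff_measure s V = 0"
proof -
  have "hausdorff_premeasure s \<delta> V \<le> 0" if \<delta>: "\<delta> > 0" for \<delta>
  proof -
    let ?K = "3 ^ k * (\<Prod>i<k. L i) * unit_ball_vol s * (real k / 2) powr s"
    obtain h0 where h0: "0 < h0" "\<And>h i. 0 < h \<Longrightarrow> h \<le> h0 \<Longrightarrow> i < k \<Longrightarrow> h \<le> L i"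
      "\<And>h. 0 < h \<Longrightarrow> h \<le> h0 \<Longrightarrow> real k * h \<le> \<delta>"
      using small_mesh_exists[OF \<delta>] by metis
    have "((\<lambda>h. ?K * h powr (s - real k)) \<longlongrightarrow> ?K * 0) (at_right 0)"
      using assms by (intro tendsto_mult_left tendsto_zero_powrI[where b = "s - real k"] tendsto_ident_at tendsto_const)
        (auto simp: eventually_at_right_less intro: eventually_mono[OF eventually_at_right_less])
    then have "((\<lambda>h. ennreal (?K * h powr (s - real k))) \<longlongrightarrow> ennreal (?K * 0)) (at_right 0)"
      by (rule tendsto_ennrealI)
    moreover have "eventually (\<lambda>h. hausdorff_premeasure s \<delta> V \<le> ennreal (?K * h powr (s - real k))) (at_right 0)"
      using eventually_at_right_real[OF h0(1)]
    proof eventually_elim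
      case (elim h)
      then show ?case
        using h0 assms k L u dist by (intro hausdorff_premeasure_coordinates[where u = u]) auto
    qed
    ultimately have "hausdorff_premeasure s \<delta> V \<le> ennreal (?K * 0)"
      by (intro tendsto_lowerbound) auto
    then show ?thesis by simp
  qed
  then show ?thesis
    unfolding hausdorff_measure_def by (auto intro!: antisym SUP_least)
qed

end

text \<open>On sets of diameter at most 1 the \<open>t\<close>-gauge is at most a constant times the
  \<open>s\<close>-gauge, so covers witnessing nullity for \<open>s\<close> also do so for
  \<open>t\<close>. The exponent 0 is split off because its gauge counts sets.\<close>

lemma hausdorff_measure_eq_0_mono:
  assumes "hausdorff_measure s V = 0" "0 \<le> s" "s < t"
  shows "hausdorff_measure t V = 0"
proof -
  have t: "0 < t" using assms by simp
  define K where "K = unit_ball_vol t / unit_ball_vol s"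
  have K: "0 \<le> K" "unit_ball_vol t = K * unit_ball_vol s"
    using assms t unit_ball_vol_pos[of s] by (auto simp: K_def less_imp_neq[symmetric])
  have gauge: "hausdorff_gauge t C \<le> ennreal K * hausdorff_gauge s C"
    if C: "bounded C" "diameter C \<le> 1" for C :: "'a set"
  proof (cases "C = {}")
    case False
    have d: "0 \<le> diameter C" using diameter_ge_0[OF C(1)] .
    show ?thesis
    proof (cases "s = 0")
      case True
      have "(diameter C / 2) powr t \<le> 1" using d C t
        by (intro powr_le1) auto
      then have "unit_ball_vol t * (diameter C / 2) powr t \<le> K"
        using K True t by (simp add: mult_left_le)
      then show ?thesis using False t True by (simp add: hausdorff_gauge_def ennreal_leI)
    next
      case s: False
      have "(diameter C / 2) powr t \<le> (diameter C / 2) powr s"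
        using d C assms by (intro powr_mono') auto
      then have "unit_ball_vol t * (diameter C / 2) powr t \<le> unit_ball_vol t * (diameter C / 2) powr s"
        using t by (intro mult_left_mono) auto
      then have "ennreal (unit_ball_vol t * (diameter C / 2) powr t) \<le> ennreal (K * (unit_ball_vol s * (diameter C / 2) powr s))"
        using K by (simp add: ennreal_leI mult.assoc)
      then show ?thesis using False t s K
        by (simp add: hausdorff_gauge_def flip: ennreal_mult')
    qed
  qed simp
  have "hausdorff_premeasure t \<delta> V \<le> 0" if "\<delta> > 0" for \<delta>
  proof -
    let ?\<delta> = "min \<delta> 1"
    have "hausdorff_premeasure s ?\<delta> V \<le> hausdorff_measure s V"
      unfolding hausdorff_measure_def using that by (intro SUP_upper) auto
    then have z: "hausdorff_premeasure s ?\<delta> V = 0" using assms(1) by simp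
    show ?thesis
    proof (rule ennreal_le_epsilon)
      fix e :: real assume e: "0 < e"
      define e' where "e' = e / (K + 1)"
      have e': "0 < e'" "K * e' \<le> e" using e K by (auto simp: e'_def field_simps)
      have "hausdorff_premeasure s ?\<delta> V < ennreal e'" using z e' by simp
      then obtain C where C: "V \<subseteq> (\<Union>i. C i)" "\<forall>i. bounded (C i) \<and> diameter (C i) \<le> ?\<delta>"
        and sum: "(suminf (\<lambda>i. hausdorff_gauge s (C i))) < ennreal e'"
        unfolding hausdorff_premeasure_def by (auto simp: INF_less_iff)
      have "hausdorff_premeasure t \<delta> V \<le> suminf (\<lambda>i. hausdorff_gauge t (C i))"
        using C by (intro hausdorff_premeasure_le_suminf) auto
      also have "\<dots> \<le> suminf (\<lambda>i. ennreal K * hausdorff_gauge s (C i))"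
        using C by (intro suminf_le gauge) auto
      also have "\<dots> = ennreal K * (suminf (\<lambda>i. hausdorff_gauge s (C i)))"
        by (rule ennreal_suminf_cmult)
      also have "\<dots> \<le> ennreal K * ennreal e'"
        using sum by (intro mult_left_mono) auto
      also have "\<dots> \<le> ennreal e" using e' K by (simp add: ennreal_leI flip: ennreal_mult')
      finally show "hausdorff_premeasure t \<delta> V \<le> 0 + ennreal e" by simp
    qed
  qed
  then show ?thesis
    unfolding hausdorff_measure_def by (auto intro!: antisym SUP_least)
qed

section \<open>Hausdorff dimension, and lower bounds by projection\<close>

lemma hausdorff_dim_eqI:
  assumes "0 < k" "\<And>s. k < s \<Longrightarrow> hausdorff_measure s V = 0" "hausdorff_measure k V \<noteq> 0"
  shows "hausdorff_dim V = ereal k"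
  unfolding hausdorff_dim_def
proof (rule antisym)
  show "(INF s\<in>{s. 0 \<le> s \<and> hausdorff_measure s V = 0}. ereal s) \<le> ereal k"
  proof (rule ereal_le_epsilon2)
    fix e :: real assume "0 < e"
    then have "(INF s\<in>{s. 0 \<le> s \<and> hausdorff_measure s V = 0}. ereal s) \<le> ereal (k + e)"
      using assms by (intro INF_lower) auto
    then show "(INF s\<in>{s. 0 \<le> s \<and> hausdorff_measure s V = 0}. ereal s) \<le> ereal k + ereal e" by simp
  qed
  show "ereal k \<le> (INF s\<in>{s. 0 \<le> s \<and> hausdorff_measure s V = 0}. ereal s)"
  proof (rule INF_greatest)
    fix s assume s: "s \<in> {s. 0 \<le> s \<and> hausdorff_measure s V = 0}"
    then have "\<not> s < k" using hausdorff_measure_eq_0_mono[of s V k] assms(3) by auto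
    then show "ereal k \<le> ereal s" by simp
  qed
qed

text \<open>A covering set of diameter \<open>d\<close> that meets \<open>V\<close> projects into
  the closed ball of radius \<open>d\<close> about the image of any of its points in
  \<open>V\<close>. That ball has \<open>2 ^ DIM('b)\<close> times the gauge of the set; this loss
  replaces the isodiametric inequality and is harmless where only positivity matters.\<close>

lemma lborel_le_hausdorff_measure:
  fixes p :: "'a::metric_space \<Rightarrow> 'b::euclidean_space"
  assumes p: "\<And>x y. x \<in> V \<Longrightarrow> y \<in> V \<Longrightarrow> dist (p x) (p y) \<le> dist x y"
    and S: "S \<in> sets lborel" "S \<subseteq> p ` V"
  shows "ennreal (1 / 2 ^ DIM('b)) * emeasure lborel S \<le> hausdorff_measure (real DIM('b)) V"
proof -
  let ?k = "DIM('b)"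
  \<comment> \<open>The estimate is made for each covering set separately, so any mesh would do; 1
    is one choice.\<close>
  have "ennreal (1 / 2 ^ ?k) * emeasure lborel S \<le> hausdorff_premeasure (real ?k) 1 V"
    unfolding hausdorff_premeasure_def
  proof (rule INF_greatest)
    fix C :: "nat \<Rightarrow> 'a set"
    assume "C \<in> {C. V \<subseteq> (\<Union>i. C i) \<and> (\<forall>i. bounded (C i) \<and> diameter (C i) \<le> 1)}"
    then have C: "V \<subseteq> (\<Union>i. C i)" "\<And>i. bounded (C i)" by auto
    define x where "x i = (SOME x. x \<in> C i \<inter> V)" for i
    define B where "B i = (if C i \<inter> V = {} then {} else cball (p (x i)) (diameter (C i)))" for i
    have B: "ennreal (1 / 2 ^ ?k) * emeasure lborel (B i) \<le> hausdorff_gauge (real ?k) (C i)" for i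
    proof (cases "C i \<inter> V = {}")
      case False
      have d: "0 \<le> diameter (C i)" using C by (intro diameter_ge_0)
      have "(diameter (C i) / 2) powr real ?k = (diameter (C i) / 2) ^ ?k"
        using d by (cases "diameter (C i) = 0") (auto simp: powr_realpow)
      then show ?thesis
        using False d unfolding B_def
        by (auto simp: hausdorff_gauge_def emeasure_cball power_divide field_simps simp flip: ennreal_mult')
    qed (simp add: B_def)
    have "S \<subseteq> (\<Union>i. B i)"
    proof
      fix s assume "s \<in> S"
      then obtain a where a: "a \<in> V" "s = p a" using S by blast
      then obtain i where i: "a \<in> C i" using C by blast
      have x: "x i \<in> C i \<inter> V"
        unfolding x_def by (rule someI[of "\<lambda>y. y \<in> C i \<inter> V" a]) (use a i in simp)
      have "dist (p (x i)) (p a) \<le> dist (x i) a" using p x a by simp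
      also have "\<dots> \<le> diameter (C i)" using x i C by (intro diameter_bounded_bound) auto
      finally show "s \<in> (\<Union>i. B i)" using x a by (auto simp: B_def intro!: exI[of _ i])
    qed
    then have "emeasure lborel S \<le> emeasure lborel (\<Union>i. B i)"
      by (intro emeasure_mono) (auto simp: B_def)
    also have "\<dots> \<le> suminf (\<lambda>i. emeasure lborel (B i))"
      by (intro emeasure_subadditive_countably) (auto simp: B_def)
    finally have "ennreal (1 / 2 ^ ?k) * emeasure lborel S \<le> ennreal (1 / 2 ^ ?k) * suminf (\<lambda>i. emeasure lborel (B i))"
      by (intro mult_left_mono) auto
    also have "\<dots> = suminf (\<lambda>i. ennreal (1 / 2 ^ ?k) * emeasure lborel (B i))"
      by (rule ennreal_suminf_cmult[symmetric])
    also have "\<dots> \<le> suminf (\<lambda>i. hausdorff_gauge (real ?k) (C i))"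
      using B by (intro suminf_le) auto
    finally show "ennreal (1 / 2 ^ ?k) * emeasure lborel S \<le> suminf (\<lambda>i. hausdorff_gauge (real ?k) (C i))" .
  qed
  also have "\<dots> \<le> hausdorff_measure (real ?k) V"
    unfolding hausdorff_measure_def by (intro SUP_upper) auto
  finally show ?thesis .
qed

section \<open>Polynomial functions and the weighted action\<close>

definition upd :: "complex ^ 'n \<Rightarrow> 'n \<Rightarrow> complex \<Rightarrow> complex ^ 'n" where
  "upd a i \<zeta> = (\<chi> j. if j = i then \<zeta> else a $ j)"

lemma upd_nth [simp]: "upd a i \<zeta> $ j = (if j = i then \<zeta> else a $ j)"
  by (simp add: upd_def)

lemma upd_triv [simp]: "upd a i (a $ i) = a"
  by (simp add: vec_eq_iff)

definition act :: "('n \<Rightarrow> nat) \<Rightarrow> complex \<Rightarrow> complex ^ 'n \<Rightarrow> complex ^ 'n" where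
  "act w l a = (\<chi> j. l ^ w j * a $ j)"

lemma act_nth [simp]: "act w l a $ j = l ^ w j * a $ j"
  by (simp add: act_def)

lemma act_1 [simp]: "act w 1 a = a"
  by (simp add: vec_eq_iff)

lemma act_act [simp]: "act w l (act w \<mu> a) = act w (l * \<mu>) a"
  by (simp add: vec_eq_iff power_mult_distrib mult.assoc)

lemma continuous_on_act [continuous_intros]:
  assumes "continuous_on S f" "continuous_on S g"
  shows "continuous_on S (\<lambda>x. act w (f x) (g x))"
  unfolding act_def using assms by (intro continuous_intros)

lemma norm_le_sum_components:
  fixes x :: "complex ^ 'n"
  shows "norm x \<le> (\<Sum>j\<in>UNIV. norm (x $ j))"
  unfolding norm_vec_def by (intro L2_set_le_sum) auto

lemma norm_act_le:
  assumes "\<forall>j. w j > 0" "norm l \<le> 1"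
  shows "norm (act w l a) \<le> norm l * norm a"
proof -
  have "norm (act w l a) \<le> norm (norm l *\<^sub>R a)"
  proof (rule norm_le_componentwise_cart)
    fix j
    have "norm l ^ w j \<le> norm l ^ 1"
      using assms by (intro power_decreasing) (auto simp: Suc_leI)
    then show "norm (act w l a $ j) \<le> norm ((norm l *\<^sub>R a) $ j)"
      by (simp add: norm_mult norm_power mult_right_mono)
  qed
  then show ?thesis by simp
qed

text \<open>An induction principle for polynomial maps: continuity, holomorphy in one coordinate,
  real polynomiality and differentiability each pass through sums and products, while
  \<open>cpoly_eval\<close> is a sum over monomials.\<close>

inductive poly_fun :: "(complex ^ 'n::finite \<Rightarrow> complex) \<Rightarrow> bool" where
  const: "poly_fun (\<lambda>_. c)"
| coord: "poly_fun (\<lambda>a. a $ i)"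
| add: "poly_fun g \<Longrightarrow> poly_fun h \<Longrightarrow> poly_fun (\<lambda>a. g a + h a)"
| mult: "poly_fun g \<Longrightarrow> poly_fun h \<Longrightarrow> poly_fun (\<lambda>a. g a * h a)"

lemma poly_fun_power: "poly_fun g \<Longrightarrow> poly_fun (\<lambda>a. g a ^ n)"
  by (induction n) (auto intro: poly_fun.intros)

lemma poly_fun_sum: "(\<And>i. i \<in> I \<Longrightarrow> poly_fun (g i)) \<Longrightarrow> poly_fun (\<lambda>a. \<Sum>i\<in>I. g i a)"
  by (induction I rule: infinite_finite_induct) (auto intro: poly_fun.intros)

lemma poly_fun_prod: "(\<And>i. i \<in> I \<Longrightarrow> poly_fun (g i)) \<Longrightarrow> poly_fun (\<lambda>a. \<Prod>i\<in>I. g i a)"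
  by (induction I rule: infinite_finite_induct) (auto intro: poly_fun.intros)

lemma poly_fun_cpoly_eval: "poly_fun (cpoly_eval f)"
  unfolding cpoly_eval_def[abs_def]
  by (intro poly_fun_sum poly_fun.mult poly_fun_prod poly_fun_power poly_fun.const poly_fun.coord)

lemma continuous_on_poly_fun: "poly_fun h \<Longrightarrow> continuous_on S h"
  by (induction rule: poly_fun.induct) (auto intro!: continuous_intros)

lemma poly_fun_coord_holomorphic:
  "poly_fun h \<Longrightarrow> (\<lambda>\<zeta>. h (upd a i \<zeta>)) holomorphic_on S"
proof (induction rule: poly_fun.induct)
  case (coord j)
  then show ?case by (cases "j = i") (auto intro!: holomorphic_intros)
qed (auto intro!: holomorphic_intros)

text \<open>Both parts go through one induction because the real part of a product involves the
  imaginary parts of the factors, and conversely.\<close>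

lemma poly_fun_real_polynomial:
  "poly_fun h \<Longrightarrow> real_polynomial_function (\<lambda>a. Re (h a)) \<and> real_polynomial_function (\<lambda>a. Im (h a))"
proof (induction rule: poly_fun.induct)
  case (coord i)
  have "bounded_linear (\<lambda>a::complex^'a. Re (a $ i))" "bounded_linear (\<lambda>a::complex^'a. Im (a $ i))"
    by (auto intro!: bounded_linear_compose[OF bounded_linear_Re bounded_linear_vec_nth]
        bounded_linear_compose[OF bounded_linear_Im bounded_linear_vec_nth])
  then show ?case by (auto intro: real_polynomial_function.intros(1))
qed (auto intro: real_polynomial_function.intros(2-4) real_polynomial_function_diff)

lemma semialgebraic_zero_set: "semialgebraic (zero_set f)"
proof -
  have "zero_set f = {a. Re (cpoly_eval f a) = 0} \<inter> {a. Im (cpoly_eval f a) = 0}"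
    by (auto simp: zero_set_def complex_eq_iff)
  then show ?thesis
    using poly_fun_real_polynomial[OF poly_fun_cpoly_eval[of f]]
    by (auto intro: semialgebraic.inter semialgebraic.zero)
qed

lemma poly_fun_has_derivative:
  assumes "poly_fun (h :: complex ^ 'n::finite \<Rightarrow> complex)"
  obtains D where "continuous_on UNIV D"
    "\<And>b. (h has_derivative (\<lambda>v. \<Sum>j\<in>UNIV. D b $ j * v $ j)) (at b)"
proof -
  have "\<exists>D. continuous_on UNIV D \<and> (\<forall>b. (h has_derivative (\<lambda>v. \<Sum>j\<in>UNIV. D b $ j * v $ j)) (at b))"
    using assms
  proof (induction rule: poly_fun.induct)
    case (const c)
    show ?case by (intro exI[of _ "\<lambda>_. 0"]) auto
  next
    case (coord i)
    have "((\<lambda>a::complex^'n. a $ i) has_derivative (\<lambda>v. \<Sum>j\<in>UNIV. (axis i 1 :: complex^'n) $ j * v $ j)) (at b)" for b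
      using bounded_linear_imp_has_derivative[OF bounded_linear_vec_nth[of i]]
      by (simp add: axis_def if_distrib if_distribR cong: if_cong)
    then show ?case by (intro exI[of _ "\<lambda>_. axis i 1"]) auto
  next
    case (add g h)
    from add.IH(1) obtain D where D: "continuous_on UNIV D"
      "\<And>b. (g has_derivative (\<lambda>v. \<Sum>j\<in>UNIV. D b $ j * v $ j)) (at b)" by blast
    from add.IH(2) obtain E where E: "continuous_on UNIV E"
      "\<And>b. (h has_derivative (\<lambda>v. \<Sum>j\<in>UNIV. E b $ j * v $ j)) (at b)" by blast
    note DE = D(1) E(1) D(2) E(2)
    show ?case
    proof (intro exI[of _ "\<lambda>b. D b + E b"] conjI allI)
      show "continuous_on UNIV (\<lambda>b. D b + E b)" using DE by (intro continuous_intros)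
      show "((\<lambda>a. g a + h a) has_derivative (\<lambda>v. \<Sum>j\<in>UNIV. (D b + E b) $ j * v $ j)) (at b)" for b
        using has_derivative_add[OF DE(3,4)[of b]] by (simp add: sum.distrib distrib_right)
    qed
  next
    case (mult g h)
    from mult.IH(1) obtain D where D: "continuous_on UNIV D"
      "\<And>b. (g has_derivative (\<lambda>v. \<Sum>j\<in>UNIV. D b $ j * v $ j)) (at b)" by blast
    from mult.IH(2) obtain E where E: "continuous_on UNIV E"
      "\<And>b. (h has_derivative (\<lambda>v. \<Sum>j\<in>UNIV. E b $ j * v $ j)) (at b)" by blast
    note DE = D(1) E(1) D(2) E(2)
    show ?case
    proof (intro exI[of _ "\<lambda>b. \<chi> j. g b * E b $ j + D b $ j * h b"] conjI allI)
      show "continuous_on UNIV (\<lambda>b. \<chi> j. g b * E b $ j + D b $ j * h b)"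
        using DE continuous_on_poly_fun[OF mult.hyps(1)] continuous_on_poly_fun[OF mult.hyps(2)]
        by (intro continuous_intros)
      show "((\<lambda>a. g a * h a) has_derivative
          (\<lambda>v. \<Sum>j\<in>UNIV. (\<chi> j. g b * E b $ j + D b $ j * h b) $ j * v $ j)) (at b)" for b
        using has_derivative_mult[OF DE(3,4)[of b]]
        by (simp add: sum.distrib algebra_simps sum_distrib_left)
    qed
  qed
  then show ?thesis using that by blast
qed

text \<open>Strict (strong) differentiability at \<open>a\<close> with gradient \<open>c\<close>.
  Both points vary, which allows comparing two zeros near \<open>a\<close> neither of which is
  \<open>a\<close>.\<close>

definition has_strict_gradient :: "(complex ^ 'n::finite \<Rightarrow> complex) \<Rightarrow> complex ^ 'n \<Rightarrow> complex ^ 'n \<Rightarrow> bool" where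
  "has_strict_gradient h c a \<longleftrightarrow> (\<forall>\<epsilon>>0. \<exists>\<delta>>0. \<forall>b\<in>ball a \<delta>. \<forall>b'\<in>ball a \<delta>.
     norm (h b - h b' - (\<Sum>j\<in>UNIV. c $ j * (b $ j - b' $ j))) \<le> \<epsilon> * norm (b - b'))"

text \<open>Mean value inequality for \<open>h\<close> minus its linear part at \<open>a\<close>,
  whose derivative is small near \<open>a\<close> because the gradient is continuous.\<close>

lemma poly_fun_strict_gradient:
  assumes "poly_fun (h :: complex ^ 'n::finite \<Rightarrow> complex)"
  obtains c where "(h has_derivative (\<lambda>v. \<Sum>j\<in>UNIV. c $ j * v $ j)) (at a)"
    "has_strict_gradient h c a"
proof -
  obtain D where D: "continuous_on UNIV D"
    "\<And>b. (h has_derivative (\<lambda>v. \<Sum>j\<in>UNIV. D b $ j * v $ j)) (at b)"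
    by (rule poly_fun_has_derivative[OF assms]) blast
  show ?thesis
  proof (rule that[of "D a"], rule D(2), unfold has_strict_gradient_def, intro allI impI)
    fix \<epsilon> :: real assume \<epsilon>: "0 < \<epsilon>"
    let ?n = "real CARD('n)"
    have "0 < \<epsilon> / ?n" using \<epsilon> by simp
    then obtain \<delta> where \<delta>: "\<delta> > 0" "\<And>b. dist b a < \<delta> \<Longrightarrow> dist (D b) (D a) < \<epsilon> / ?n"
      using D(1) by (fastforce simp: continuous_on_iff)
    have "norm (h b - h b' - (\<Sum>j\<in>UNIV. D a $ j * (b $ j - b' $ j))) \<le> \<epsilon> * norm (b - b')"
      if b: "b \<in> ball a \<delta>" "b' \<in> ball a \<delta>" for b b'
    proof -
      define F where "F x = h x - (\<Sum>j\<in>UNIV. D a $ j * x $ j)" for x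
      have lin: "((\<lambda>x::complex^'n. \<Sum>j\<in>UNIV. D a $ j * x $ j) has_derivative (\<lambda>v. \<Sum>j\<in>UNIV. D a $ j * v $ j)) (at x within S)" for x S
        by (intro derivative_intros has_derivative_sum has_derivative_mult_right bounded_linear_imp_has_derivative bounded_linear_vec_nth)
      have "norm (F b - F b') \<le> \<epsilon> * norm (b - b')"
      proof (rule differentiable_bound[where S = "ball a \<delta>" and f' = "\<lambda>x v. \<Sum>j\<in>UNIV. (D x - D a) $ j * v $ j"])
        fix x assume x: "x \<in> ball a \<delta>"
        show "(F has_derivative (\<lambda>v. \<Sum>j\<in>UNIV. (D x - D a) $ j * v $ j)) (at x within ball a \<delta>)"
          unfolding F_def[abs_def]
          using has_derivative_diff[OF has_derivative_at_withinI[OF D(2)] lin]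
          by (simp add: left_diff_distrib sum_subtractf)
        show "onorm (\<lambda>v. \<Sum>j\<in>UNIV. (D x - D a) $ j * v $ j) \<le> \<epsilon>"
        proof (rule onorm_le)
          fix v :: "complex ^ 'n"
          have "norm (\<Sum>j\<in>UNIV. (D x - D a) $ j * v $ j) \<le> (\<Sum>j\<in>(UNIV::'n set). \<epsilon> / ?n * norm v)"
          proof (rule sum_norm_le)
            fix j
            have "norm ((D x - D a) $ j) \<le> \<epsilon> / ?n"
              using \<delta>(2)[of x] x Finite_Cartesian_Product.norm_nth_le[of "D x - D a" j] by (simp add: dist_norm norm_minus_commute dist_commute)
            then show "norm ((D x - D a) $ j * v $ j) \<le> \<epsilon> / ?n * norm v"
              unfolding norm_mult using \<epsilon> by (intro mult_mono Finite_Cartesian_Product.norm_nth_le) auto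
          qed
          then show "norm (\<Sum>j\<in>UNIV. (D x - D a) $ j * v $ j) \<le> \<epsilon> * norm v" by simp
        qed
      qed (use b in auto)
      moreover have "F b - F b' = h b - h b' - (\<Sum>j\<in>UNIV. D a $ j * (b $ j - b' $ j))"
        by (simp add: F_def right_diff_distrib sum_subtractf)
      ultimately show ?thesis by simp
    qed
    with \<delta>(1) show "\<exists>\<delta>>0. \<forall>b\<in>ball a \<delta>. \<forall>b'\<in>ball a \<delta>.
        norm (h b - h b' - (\<Sum>j\<in>UNIV. D a $ j * (b $ j - b' $ j))) \<le> \<epsilon> * norm (b - b')" by blast
  qed
qed

section \<open>Polynomials under the weighted action, and persistence of roots\<close>

lemma cpoly_eval_act:
  assumes "\<And>m. m \<in> Poly_Mapping.keys f \<Longrightarrow> (\<Sum>i\<in>UNIV. w i * m i) = d"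
  shows "cpoly_eval f (act w l a) = l ^ d * cpoly_eval f a"
proof -
  have "(\<Prod>i\<in>UNIV. (act w l a $ i) ^ m i) = l ^ d * (\<Prod>i\<in>UNIV. (a $ i) ^ m i)"
    if "m \<in> Poly_Mapping.keys f" for m
    by (simp add: power_mult_distrib prod.distrib power_sum flip: power_mult assms[OF that])
  then show ?thesis
    unfolding cpoly_eval_def sum_distrib_left by (intro sum.cong) (auto simp: mult_ac)
qed

text \<open>Each coefficient is rescaled by a power of \<open>l\<close>, and
  \<open>l \<noteq> 0\<close> keeps the support unchanged. Elements of the ideal of \<open>X\<close>
  can thus be moved along the action within the type of polynomials, as
  \<open>singular_locus\<close> requires.\<close>

lemma cpoly_eval_act_exists:
  assumes "l \<noteq> 0"
  obtains h where "\<And>a. cpoly_eval h a = cpoly_eval g (act w l a)"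
proof -
  define F where "F m = l ^ (\<Sum>i\<in>UNIV. w i * m i) * Poly_Mapping.lookup g m" for m :: "'a \<Rightarrow> nat"
  have supp: "{m. F m \<noteq> 0} = Poly_Mapping.keys g"
    using assms by (auto simp: F_def in_keys_iff)
  then have fin: "finite {m. F m \<noteq> 0}" by simp
  have "cpoly_eval (Abs_poly_mapping F) a = cpoly_eval g (act w l a)" for a
  proof -
    have look: "Poly_Mapping.lookup (Abs_poly_mapping F) = F" using fin by (simp add: Abs_poly_mapping_inverse)
    have keys: "Poly_Mapping.keys (Abs_poly_mapping F) = Poly_Mapping.keys g"
      by (simp only: Poly_Mapping.keys.rep_eq[of "Abs_poly_mapping F"] look supp)
    show ?thesis
      unfolding cpoly_eval_def keys look
      by (intro sum.cong) (auto simp: F_def power_mult_distrib prod.distrib power_sum mult_ac simp flip: power_mult)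
  qed
  then show ?thesis using that by blast
qed

text \<open>Persistence of roots, in the spirit of Hurwitz. The slice at \<open>a\<close> is not
  identically zero, so its root is isolated and its modulus has a positive minimum
  \<open>\<mu>\<close> on a small circle. For nearby \<open>b\<close> the slice changes by less than
  \<open>\<mu> / 3\<close>; it is then smaller at the centre than anywhere on the circle, and a
  holomorphic function with this property has a zero inside.\<close>

lemma poly_fun_root_near:
  fixes h :: "complex ^ 'n::finite \<Rightarrow> complex"
  assumes h: "poly_fun h" "h a = 0" "h (upd a i \<zeta>0) \<noteq> 0" and r: "0 < r"
  obtains s where "0 < s"
    "\<And>b. (\<And>j. j \<noteq> i \<Longrightarrow> norm (b $ j - a $ j) < s) \<Longrightarrow> \<exists>\<zeta>. norm (\<zeta> - a $ i) < r \<and> h (upd b i \<zeta>) = 0"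
proof -
  obtain r0 where r0: "0 < r0" "\<And>\<zeta>. \<zeta> \<in> ball (a $ i) r0 - {a $ i} \<Longrightarrow> h (upd a i \<zeta>) \<noteq> 0"
    using isolated_zeros[OF poly_fun_coord_holomorphic[OF h(1), of a i UNIV] open_UNIV connected_UNIV, of "a $ i" \<zeta>0] h
    by auto
  define r1 where "r1 = min r r0 / 2"
  have r1: "0 < r1" "r1 < r" "r1 < r0" using r r0 by (auto simp: r1_def)
  let ?S = "sphere (a $ i) r1"
  have "continuous_on ?S (\<lambda>\<zeta>. norm (h (upd a i \<zeta>)))"
    by (intro continuous_on_norm holomorphic_on_imp_continuous_on poly_fun_coord_holomorphic h)
  then obtain \<zeta>1 where \<zeta>1: "\<zeta>1 \<in> ?S" "\<And>\<zeta>. \<zeta> \<in> ?S \<Longrightarrow> norm (h (upd a i \<zeta>1)) \<le> norm (h (upd a i \<zeta>))"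
    using continuous_attains_inf[of ?S "\<lambda>\<zeta>. norm (h (upd a i \<zeta>))"] r1 by (auto simp: sphere_empty)
  define \<mu> where "\<mu> = norm (h (upd a i \<zeta>1))"
  have \<mu>: "0 < \<mu>"
    using r0(2)[of \<zeta>1] \<zeta>1(1) r1 by (auto simp: \<mu>_def)
  let ?n = "real CARD('n)"
  \<comment> \<open>Room for all points that occur: changing coordinate \<open>i\<close> costs at
    most \<open>r1\<close>, and the other coordinates together at most
    \<open>?n * s \<le> ?n\<close>.\<close>
  let ?K = "cball a (r1 + ?n)"
  have "uniformly_continuous_on ?K h"
    by (intro compact_uniformly_continuous continuous_on_poly_fun h) auto
  then obtain d where d: "0 < d" "\<And>x y. x \<in> ?K \<Longrightarrow> y \<in> ?K \<Longrightarrow> dist x y < d \<Longrightarrow> dist (h x) (h y) < \<mu> / 3"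
    using \<mu> unfolding uniformly_continuous_on_def by (metis divide_pos_pos zero_less_numeral)
  define s where "s = min 1 (d / (2 * ?n))"
  have s: "0 < s" "s \<le> 1" "?n * s < d" using d(1) by (auto simp: s_def min_def field_simps)
  have close: "dist (h (upd b i \<zeta>)) (h (upd a i \<zeta>)) < \<mu> / 3"
    if b: "\<And>j. j \<noteq> i \<Longrightarrow> norm (b $ j - a $ j) < s" and \<zeta>: "\<zeta> \<in> cball (a $ i) r1" for b \<zeta>
  proof (rule d(2))
    have n1: "norm (upd b i \<zeta> - upd a i \<zeta>) \<le> ?n * s"
    proof -
      have "norm (upd b i \<zeta> - upd a i \<zeta>) \<le> (\<Sum>j\<in>UNIV. norm ((upd b i \<zeta> - upd a i \<zeta>) $ j))"
        by (rule norm_le_sum_components)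
      also have "\<dots> \<le> (\<Sum>j\<in>(UNIV::'n set). s)"
        using b s by (intro sum_mono) (auto intro: less_imp_le)
      finally show ?thesis by simp
    qed
    have n2: "norm (upd a i \<zeta> - a) \<le> r1"
    proof -
      have "norm (upd a i \<zeta> - a) \<le> (\<Sum>j\<in>UNIV. norm ((upd a i \<zeta> - a) $ j))"
        by (rule norm_le_sum_components)
      also have "\<dots> = (\<Sum>j\<in>UNIV. if j = i then norm (\<zeta> - a $ i) else 0)"
        by (intro sum.cong) auto
      finally show ?thesis using \<zeta> by (simp add: dist_norm norm_minus_commute)
    qed
    show "dist (upd b i \<zeta>) (upd a i \<zeta>) < d"
      using n1 s by (simp add: dist_norm)
    show "upd a i \<zeta> \<in> ?K" using n2 by (simp add: dist_norm norm_minus_commute)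
    have "?n * s \<le> ?n" using s by simp
    moreover have "norm (upd b i \<zeta> - a) \<le> norm (upd b i \<zeta> - upd a i \<zeta>) + norm (upd a i \<zeta> - a)"
      using norm_triangle_ineq[of "upd b i \<zeta> - upd a i \<zeta>" "upd a i \<zeta> - a"] by simp
    ultimately have "norm (upd b i \<zeta> - a) \<le> r1 + ?n"
      using n1 n2 by linarith
    then show "upd b i \<zeta> \<in> ?K"
      by (simp add: dist_norm norm_minus_commute)
  qed
  have "\<exists>\<zeta>. norm (\<zeta> - a $ i) < r \<and> h (upd b i \<zeta>) = 0"
    if b: "\<And>j. j \<noteq> i \<Longrightarrow> norm (b $ j - a $ j) < s" for b
  proof -
    have "norm (h (upd b i (a $ i))) < norm (h (upd b i \<zeta>))" if "norm (a $ i - \<zeta>) = r1" for \<zeta>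
    proof -
      have "norm (h (upd b i (a $ i))) < \<mu> / 3"
        using close[OF b, of "a $ i"] r1 h(2) by simp
      moreover have "\<mu> \<le> norm (h (upd a i \<zeta>))"
        using \<zeta>1(2)[of \<zeta>] that by (simp add: \<mu>_def dist_norm)
      moreover have "norm (h (upd b i \<zeta>) - h (upd a i \<zeta>)) < \<mu> / 3"
        using close[OF b, of \<zeta>] that by (simp add: dist_norm)
      then have "norm (h (upd a i \<zeta>)) - norm (h (upd b i \<zeta>)) < \<mu> / 3"
        using norm_triangle_ineq2[of "h (upd a i \<zeta>)" "h (upd b i \<zeta>)"] by (simp add: norm_minus_commute)
      ultimately show ?thesis using \<mu> by linarith
    qed
    then obtain z where "z \<in> ball (a $ i) r1" "h (upd b i z) = 0"
      using holomorphic_contract_to_zero[of "a $ i" r1 "\<lambda>\<zeta>. h (upd b i \<zeta>)"] r1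
        poly_fun_coord_holomorphic[OF h(1)] holomorphic_on_imp_continuous_on by metis
    then show ?thesis using r1 by (intro exI[of _ z]) (auto simp: dist_norm norm_minus_commute)
  qed
  then show ?thesis using that s(1) by blast
qed

text \<open>For two zeros the linear part equals the error of strict differentiability up to sign.
  With \<open>\<epsilon>\<close> half of \<open>norm (c $ i)\<close>, the share of the error coming
  from coordinate \<open>i\<close> is absorbed by the linear term in that coordinate.\<close>

lemma zeros_lipschitz_in_coordinate:
  fixes h :: "complex ^ 'n::finite \<Rightarrow> complex"
  assumes strict: "has_strict_gradient h c a"
    and c: "c $ i \<noteq> 0"
  obtains r L where "0 < r" "0 \<le> L"
    "\<forall>b\<in>ball a r. \<forall>b'\<in>ball a r. h b = 0 \<longrightarrow> h b' = 0 \<longrightarrow>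
       norm (b $ i - b' $ i) \<le> L * (\<Sum>j\<in>UNIV - {i}. norm (b $ j - b' $ j))"
proof -
  define \<epsilon> where "\<epsilon> = norm (c $ i) / 2"
  have \<epsilon>: "0 < \<epsilon>" using c by (simp add: \<epsilon>_def)
  then obtain \<delta> where \<delta>: "\<delta> > 0" "\<And>b b'. b \<in> ball a \<delta> \<Longrightarrow> b' \<in> ball a \<delta> \<Longrightarrow>
        norm (h b - h b' - (\<Sum>j\<in>UNIV. c $ j * (b $ j - b' $ j))) \<le> \<epsilon> * norm (b - b')"
    using strict unfolding has_strict_gradient_def by meson
  define L where "L = (norm c + \<epsilon>) / \<epsilon>"
  have "norm (b $ i - b' $ i) \<le> L * (\<Sum>j\<in>UNIV - {i}. norm (b $ j - b' $ j))"
    if b: "b \<in> ball a \<delta>" "b' \<in> ball a \<delta>" "h b = 0" "h b' = 0" for b b'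
  proof -
    let ?s = "\<Sum>j\<in>UNIV - {i}. norm (b $ j - b' $ j)"
    let ?t = "\<Sum>j\<in>UNIV - {i}. c $ j * (b $ j - b' $ j)"
    have split: "(\<Sum>j\<in>UNIV. F j) = F i + (\<Sum>j\<in>UNIV - {i}. F j)" for F :: "'n \<Rightarrow> 'z::comm_monoid_add"
      by (intro sum.remove) auto
    have "norm (c $ i * (b $ i - b' $ i) + ?t) \<le> \<epsilon> * norm (b - b')"
    proof -
      have "h b - h b' - (\<Sum>j\<in>UNIV. c $ j * (b $ j - b' $ j)) = - (c $ i * (b $ i - b' $ i) + ?t)"
        using b(3,4) by (simp add: split)
      then show ?thesis using \<delta>(2)[OF b(1,2)] by (simp only: norm_minus_cancel)
    qed
    moreover have "norm (b - b') \<le> norm (b $ i - b' $ i) + ?s"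
      using norm_le_sum_components[of "b - b'"] by (simp add: split)
    moreover have "norm ?t \<le> norm c * ?s"
    proof -
      have "norm ?t \<le> (\<Sum>j\<in>UNIV - {i}. norm c * norm (b $ j - b' $ j))"
        by (intro sum_norm_le) (auto simp: norm_mult intro!: mult_right_mono Finite_Cartesian_Product.norm_nth_le)
      then show ?thesis by (simp add: sum_distrib_left)
    qed
    moreover have "norm (c $ i) * norm (b $ i - b' $ i) \<le> norm (c $ i * (b $ i - b' $ i) + ?t) + norm ?t"
      using norm_triangle_ineq4[of "c $ i * (b $ i - b' $ i) + ?t" ?t] by (simp add: norm_mult)
    ultimately have "norm (c $ i) * norm (b $ i - b' $ i) \<le> \<epsilon> * (norm (b $ i - b' $ i) + ?s) + norm c * ?s"
      using \<epsilon> mult_left_mono[of "norm (b - b')" "norm (b $ i - b' $ i) + ?s" \<epsilon>] by linarith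
    moreover have "norm (c $ i) = 2 * \<epsilon>" by (simp add: \<epsilon>_def)
    ultimately have "\<epsilon> * norm (b $ i - b' $ i) \<le> (norm c + \<epsilon>) * ?s" by (simp add: algebra_simps)
    then show "norm (b $ i - b' $ i) \<le> L * ?s"
      using \<epsilon> by (simp add: L_def field_simps)
  qed
  moreover have "0 \<le> L" using \<epsilon> by (simp add: L_def)
  ultimately show ?thesis using that \<delta>(1) by blast
qed

section \<open>Graph charts of a weighted homogeneous hypersurface\<close>

definition poly_box :: "complex ^ 'n \<Rightarrow> 'n \<Rightarrow> real \<Rightarrow> real \<Rightarrow> (complex ^ 'n) set" where
  "poly_box a i r s = {b. norm (b $ i - a $ i) < r \<and> (\<forall>j. j \<noteq> i \<longrightarrow> norm (b $ j - a $ j) < s)}"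

lemma open_poly_box: "open (poly_box a i r s :: (complex ^ 'n::finite) set)"
proof -
  have "poly_box a i r s = {b. norm (b $ i - a $ i) < r} \<inter> (\<Inter>j\<in>UNIV - {i}. {b. norm (b $ j - a $ j) < s})"
    by (auto simp: poly_box_def)
  moreover have "open {b::complex^'n. norm (b $ j - a $ j) < t}" for j t
    by (intro open_Collect_less continuous_intros)
  ultimately show ?thesis by (auto intro!: open_INT)
qed

text \<open>A graph of coordinate \<open>i\<close> over the others, without naming the function: the
  first clause gives a value over every point of the polydisc, and the Lipschitz clause makes it
  unique, since equal remaining coordinates force equal \<open>i\<close>-th ones.\<close>

definition graph_chart :: "(complex ^ 'n::finite) set \<Rightarrow> complex ^ 'n \<Rightarrow> 'n \<Rightarrow> real \<Rightarrow> real \<Rightarrow> real \<Rightarrow> bool" where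
  "graph_chart X a i r s L \<longleftrightarrow> 0 < r \<and> 0 < s \<and> 0 \<le> L \<and>
     (\<forall>b. (\<forall>j. j \<noteq> i \<longrightarrow> norm (b $ j - a $ j) < s) \<longrightarrow> (\<exists>\<zeta>. norm (\<zeta> - a $ i) < r \<and> upd b i \<zeta> \<in> X)) \<and>
     (\<forall>b\<in>X \<inter> poly_box a i r s. \<forall>b'\<in>X \<inter> poly_box a i r s.
        norm (b $ i - b' $ i) \<le> L * (\<Sum>j\<in>UNIV - {i}. norm (b $ j - b' $ j)))"

text \<open>The graph function, extended to a map of the ambient space that ignores coordinate
  \<open>i\<close>. Uniqueness of the chosen value makes \<open>F\<close> a retraction onto the
  chart.\<close>

lemma graph_chart_section:
  assumes gc: "graph_chart X (a :: complex ^ 'n::finite) i r s L"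
  obtains F where "\<And>b j. j \<noteq> i \<Longrightarrow> F b $ j = b $ j"
    "\<And>b. (\<And>j. j \<noteq> i \<Longrightarrow> norm (b $ j - a $ j) < s) \<Longrightarrow> F b \<in> X \<inter> poly_box a i r s"
    "\<And>b. b \<in> X \<inter> poly_box a i r s \<Longrightarrow> F b = b"
    "\<And>b b'. (\<And>j. j \<noteq> i \<Longrightarrow> norm (b $ j - a $ j) < s) \<Longrightarrow> (\<And>j. j \<noteq> i \<Longrightarrow> norm (b' $ j - a $ j) < s) \<Longrightarrow>
       dist (F b) (F b') \<le> (1 + L) * (\<Sum>j\<in>UNIV - {i}. norm (b $ j - b' $ j))"
proof -
  define F where "F b = upd b i (SOME \<zeta>. norm (\<zeta> - a $ i) < r \<and> upd b i \<zeta> \<in> X)" for b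
  have nth: "F b $ j = b $ j" if "j \<noteq> i" for b j using that by (simp add: F_def)
  have F: "F b \<in> X \<inter> poly_box a i r s" if b: "\<And>j. j \<noteq> i \<Longrightarrow> norm (b $ j - a $ j) < s" for b
  proof -
    have "\<exists>\<zeta>. norm (\<zeta> - a $ i) < r \<and> upd b i \<zeta> \<in> X"
      using gc b unfolding graph_chart_def by blast
    from someI_ex[OF this] show ?thesis
      using b by (auto simp: F_def poly_box_def)
  qed
  have lip: "norm (b $ i - b' $ i) \<le> L * (\<Sum>j\<in>UNIV - {i}. norm (b $ j - b' $ j))"
    if "b \<in> X \<inter> poly_box a i r s" "b' \<in> X \<inter> poly_box a i r s" for b b'
    using gc that unfolding graph_chart_def by blast
  have fixF: "F b = b" if b: "b \<in> X \<inter> poly_box a i r s" for b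
  proof -
    have "F b \<in> X \<inter> poly_box a i r s" using b by (intro F) (auto simp: poly_box_def)
    from lip[OF this b] have "F b $ i = b $ i" by (simp add: nth)
    then show ?thesis unfolding vec_eq_iff by (metis nth)
  qed
  have dist: "dist (F b) (F b') \<le> (1 + L) * (\<Sum>j\<in>UNIV - {i}. norm (b $ j - b' $ j))"
    if "\<And>j. j \<noteq> i \<Longrightarrow> norm (b $ j - a $ j) < s" "\<And>j. j \<noteq> i \<Longrightarrow> norm (b' $ j - a $ j) < s" for b b'
  proof -
    have "dist (F b) (F b') \<le> (\<Sum>j\<in>UNIV. norm (F b $ j - F b' $ j))"
      using norm_le_sum_components[of "F b - F b'"] by (simp add: dist_norm)
    also have "\<dots> = norm (F b $ i - F b' $ i) + (\<Sum>j\<in>UNIV - {i}. norm (F b $ j - F b' $ j))"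
      by (intro sum.remove) auto
    also have "\<dots> \<le> L * (\<Sum>j\<in>UNIV - {i}. norm (F b $ j - F b' $ j)) + (\<Sum>j\<in>UNIV - {i}. norm (F b $ j - F b' $ j))"
      using that by (intro add_right_mono lip F)
    also have "\<dots> = (1 + L) * (\<Sum>j\<in>UNIV - {i}. norm (F b $ j - F b' $ j))"
      by (simp add: algebra_simps)
    also have "(\<Sum>j\<in>UNIV - {i}. norm (F b $ j - F b' $ j)) = (\<Sum>j\<in>UNIV - {i}. norm (b $ j - b' $ j))"
      by (intro sum.cong) (auto simp: nth)
    finally show ?thesis .
  qed
  show ?thesis using that[of F] nth F fixF dist by blast
qed

text \<open>The chart is the image of a convex set, the points constrained only in the coordinates
  other than \<open>i\<close>, under the Lipschitz map \<open>F\<close>.\<close>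

lemma graph_chart_connected:
  assumes gc: "graph_chart X (a :: complex ^ 'n::finite) i r s L"
  shows "connected (X \<inter> poly_box a i r s)"
proof -
  obtain F where F: "\<And>b j. j \<noteq> i \<Longrightarrow> F b $ j = b $ j"
    "\<And>b. (\<And>j. j \<noteq> i \<Longrightarrow> norm (b $ j - a $ j) < s) \<Longrightarrow> F b \<in> X \<inter> poly_box a i r s"
    "\<And>b. b \<in> X \<inter> poly_box a i r s \<Longrightarrow> F b = b"
    "\<And>b b'. (\<And>j. j \<noteq> i \<Longrightarrow> norm (b $ j - a $ j) < s) \<Longrightarrow> (\<And>j. j \<noteq> i \<Longrightarrow> norm (b' $ j - a $ j) < s) \<Longrightarrow>
       dist (F b) (F b') \<le> (1 + L) * (\<Sum>j\<in>UNIV - {i}. norm (b $ j - b' $ j))"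
    by (rule graph_chart_section[OF gc]) blast
  define D where "D = {b :: complex ^ 'n. \<forall>j. j \<noteq> i \<longrightarrow> norm (b $ j - a $ j) < s}"
  have L: "0 \<le> L" using gc by (simp add: graph_chart_def)
  have "D = (\<Inter>j\<in>UNIV - {i}. (\<lambda>b. b $ j) -` ball (a $ j) s)"
    by (auto simp: D_def dist_norm norm_minus_commute)
  moreover have "convex ((\<lambda>b::complex^'n. b $ j) -` ball (a $ j) s)" for j
    by (intro convex_linear_vimage convex_ball bounded_linear.linear bounded_linear_vec_nth)
  ultimately have "convex D" by (auto intro!: convex_INT)
  have "continuous_on D F"
  proof (rule continuous_on_subset[OF _ order_refl])
    have "dist (F b) (F b') \<le> ((1 + L) * real CARD('n)) * dist b b'" if "b \<in> D" "b' \<in> D" for b b'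
    proof -
      have "(\<Sum>j\<in>UNIV - {i}. norm (b $ j - b' $ j)) \<le> real (card (UNIV - {i})) * dist b b'"
        by (intro sum_bounded_above) (metis dist_norm Finite_Cartesian_Product.norm_nth_le vector_minus_component)
      also have "\<dots> \<le> real CARD('n) * dist b b'"
        by (intro mult_right_mono) (auto intro!: card_mono)
      finally have "(1 + L) * (\<Sum>j\<in>UNIV - {i}. norm (b $ j - b' $ j)) \<le> (1 + L) * (real CARD('n) * dist b b')"
        using L by (intro mult_left_mono) auto
      moreover have "dist (F b) (F b') \<le> (1 + L) * (\<Sum>j\<in>UNIV - {i}. norm (b $ j - b' $ j))"
        using that by (intro F(4)) (auto simp: D_def)
      ultimately show ?thesis by (simp add: mult.assoc)
    qed
    then have "((1 + L) * real CARD('n))-lipschitz_on D F"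
      using L by (intro lipschitz_onI) auto
    then show "continuous_on D F" by (rule lipschitz_on_continuous_on)
  qed
  moreover have "X \<inter> poly_box a i r s = F ` D"
  proof
    show "F ` D \<subseteq> X \<inter> poly_box a i r s" using F(2) by (auto simp: D_def)
    show "X \<inter> poly_box a i r s \<subseteq> F ` D"
    proof
      fix b assume b: "b \<in> X \<inter> poly_box a i r s"
      then have "b \<in> D" by (auto simp: D_def poly_box_def)
      then show "b \<in> F ` D" using F(3)[OF b] by force
    qed
  qed
  ultimately show ?thesis
    using connected_continuous_image[OF _ convex_connected[OF \<open>convex D\<close>]] by simp
qed

locale weighted_hypersurface =
  fixes w :: "'n::finite \<Rightarrow> nat" and f :: "'n cpoly" and X :: "(complex ^ 'n) set"
  assumes w_pos: "\<And>i. 0 < w i" and homogeneous: "weighted_homogeneous w f"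
    and X_eq: "X = zero_set f" and isolated: "0 isolated_in singular_locus X"
begin

lemma mem_X_iff: "a \<in> X \<longleftrightarrow> cpoly_eval f a = 0"
  by (simp add: X_eq zero_set_def)

lemma act_mem: assumes "a \<in> X" shows "act w l a \<in> X"
proof -
  obtain d where d: "\<And>m. m \<in> Poly_Mapping.keys f \<Longrightarrow> (\<Sum>i\<in>UNIV. w i * m i) = d"
    using homogeneous unfolding weighted_homogeneous_def by blast
  show ?thesis using assms cpoly_eval_act[OF d] by (simp add: mem_X_iff)
qed

lemma act_0 [simp]: "act w 0 a = 0"
  using w_pos by (simp add: vec_eq_iff)

lemma act_eq_0_iff: "act w l a = 0 \<longleftrightarrow> l = 0 \<or> a = 0"
  using w_pos by (auto simp: vec_eq_iff)

lemma zero_mem: "0 \<in> X"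
  using isolated by (auto simp: isolated_in_def singular_locus_def)

lemma closed_X: "closed X"
proof -
  have "X = cpoly_eval f -` {0}" by (auto simp: mem_X_iff)
  then show ?thesis
    using continuous_on_poly_fun[OF poly_fun_cpoly_eval, of UNIV f]
    by (simp add: closed_vimage continuous_on_eq_continuous_at)
qed

section \<open>Smoothness of the punctured surface and its graph charts\<close>

lemma has_derivative_act: "(act w l has_derivative act w l) (at a)"
proof (rule bounded_linear_imp_has_derivative)
  have "linear (act w l :: complex ^ 'n \<Rightarrow> _)"
    by (auto simp: vec_eq_iff algebra_simps intro!: linearI)
  then show "bounded_linear (act w l :: complex ^ 'n \<Rightarrow> _)"
    by (rule linear_conv_bounded_linear[THEN iffD1])
qed

text \<open>Composition with the action preserves the ideal of \<open>X\<close>, and the chain rule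
  carries vanishing derivatives from \<open>a\<close> to \<open>act w l a\<close>.\<close>

lemma singular_act:
  assumes a: "a \<in> singular_locus X" and l: "l \<noteq> 0"
  shows "act w l a \<in> singular_locus X"
proof -
  have "(cpoly_eval g has_derivative (\<lambda>_. 0)) (at (act w l a))" if g: "g \<in> vanishing_polys X" for g
  proof -
    obtain h where h: "\<And>b. cpoly_eval h b = cpoly_eval g (act w l b)"
      using cpoly_eval_act_exists[OF l] by metis
    have "h \<in> vanishing_polys X"
      using g act_mem by (auto simp: vanishing_polys_def h)
    then have d: "(cpoly_eval h has_derivative (\<lambda>_. 0)) (at a)"
      using a by (auto simp: singular_locus_def)
    then have "(cpoly_eval h has_derivative (\<lambda>_. 0)) (at (act w (1 / l) (act w l a)))"
      using l by simp
    then have "((\<lambda>b. cpoly_eval h (act w (1 / l) b)) has_derivative (\<lambda>v. 0)) (at (act w l a))"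
      by (rule has_derivative_compose[OF has_derivative_act])
    then show ?thesis using l by (simp add: h)
  qed
  then show ?thesis using a act_mem by (auto simp: singular_locus_def)
qed

text \<open>The orbit of a non-zero singular point would consist of singular points and accumulate
  at 0, against isolation. Hence the assumption at the origin makes all of \<open>X - {0}\<close>
  smooth.\<close>

lemma smooth_point:
  assumes a: "a \<in> X" "a \<noteq> 0"
  obtains g where "g \<in> vanishing_polys X" "\<not> (cpoly_eval g has_derivative (\<lambda>_. 0)) (at a)"
proof -
  have "a \<notin> singular_locus X"
  proof
    assume sing: "a \<in> singular_locus X"
    obtain T where T: "open T" "T \<inter> singular_locus X = {0}"
      using isolated by (auto simp: isolated_in_def)
    have "((\<lambda>t. act w (of_real t) a) \<longlongrightarrow> act w (of_real 0) a) (at_right 0)"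
      unfolding act_def by (intro tendsto_intros)
    then have "eventually (\<lambda>t. act w (of_real t) a \<in> T) (at_right 0)"
      using T by (intro topological_tendstoD) auto
    then have "eventually (\<lambda>t. act w (of_real t) a \<in> T \<and> t > 0) (at_right 0)"
      using eventually_at_right_less by (rule eventually_conj)
    then obtain t :: real where "act w (of_real t) a \<in> T" "t > 0"
      using eventually_happens[of _ "at_right (0::real)"] by (auto simp: trivial_limit_at_right_real)
    then have "act w (of_real t) a = 0" "t > 0"
      using singular_act[OF sing, of "of_real t"] T by auto
    then show False using a by (simp add: act_eq_0_iff)
  qed
  then show ?thesis using a that by (auto simp: singular_locus_def)
qed

text \<open>The last conclusion is the weighted Euler relation: \<open>g\<close> vanishes along the
  orbit of \<open>a\<close>, which stays in \<open>X\<close>, so its gradient annihilates the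
  velocity of the orbit.\<close>

lemma smooth_point_gradient:
  assumes a: "a \<in> X" "a \<noteq> 0"
  obtains g c where "g \<in> vanishing_polys X" "c \<noteq> 0"
    "has_strict_gradient (cpoly_eval g) c a"
    "(\<Sum>j\<in>UNIV. c $ j * (of_nat (w j) * a $ j)) = 0"
proof -
  obtain g where g: "g \<in> vanishing_polys X" "\<not> (cpoly_eval g has_derivative (\<lambda>_. 0)) (at a)"
    using smooth_point[OF a] .
  obtain c where c: "(cpoly_eval g has_derivative (\<lambda>v. \<Sum>j\<in>UNIV. c $ j * v $ j)) (at a)"
    "has_strict_gradient (cpoly_eval g) c a"
    by (rule poly_fun_strict_gradient[OF poly_fun_cpoly_eval[of g], of a]) blast
  have "c \<noteq> 0" using c(1) g(2) by auto
  define v where "v = (\<chi> j. of_nat (w j) * a $ j)"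
  have "((\<lambda>t. act w (of_real t) a) has_vector_derivative v) (at 1)"
    unfolding has_vector_derivative_def
  proof (rule has_derivative_componentwise_within[THEN iffD2], rule ballI)
    fix e :: "complex ^ 'n" assume "e \<in> Basis"
    then obtain j u where e: "e = axis j u" by (auto simp: Basis_vec_def)
    have "((\<lambda>t. of_real t ^ w j * a $ j) has_vector_derivative of_nat (w j) * a $ j) (at 1)"
    proof (rule has_vector_derivative_real_field)
      show "((\<lambda>z. z ^ w j * a $ j) has_field_derivative of_nat (w j) * a $ j) (at (of_real 1))"
        by (rule derivative_eq_intros refl)+ simp
    qed
    then have "((\<lambda>t. (of_real t ^ w j * a $ j) \<bullet> u) has_derivative (\<lambda>t. (t *\<^sub>R (of_nat (w j) * a $ j)) \<bullet> u)) (at 1)"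
      unfolding has_vector_derivative_def by (rule has_derivative_inner_left)
    then show "((\<lambda>t. act w (of_real t) a \<bullet> e) has_derivative (\<lambda>t. (t *\<^sub>R v) \<bullet> e)) (at 1)"
      by (simp add: e inner_axis v_def)
  qed
  moreover have "(cpoly_eval g has_derivative (\<lambda>v. \<Sum>j\<in>UNIV. c $ j * v $ j)) (at (act w (of_real 1) a))"
    using c(1) by simp
  ultimately have "((\<lambda>t. cpoly_eval g (act w (of_real t) a)) has_derivative (\<lambda>t. \<Sum>j\<in>UNIV. c $ j * (t *\<^sub>R v) $ j)) (at (1::real))"
    unfolding has_vector_derivative_def by (rule has_derivative_compose)
  moreover have "(\<lambda>t::real. cpoly_eval g (act w (of_real t) a)) = (\<lambda>_. 0)"
    using g(1) act_mem[OF a(1)] by (auto simp: vanishing_polys_def)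
  ultimately have "(\<lambda>t. \<Sum>j\<in>UNIV. c $ j * (t *\<^sub>R v) $ j) = (\<lambda>_::real. 0)"
    by (metis has_derivative_const has_derivative_unique)
  from fun_cong[OF this, of 1] have "(\<Sum>j\<in>UNIV. c $ j * (of_nat (w j) * a $ j)) = 0" by (simp add: v_def)
  with g(1) \<open>c \<noteq> 0\<close> c(2) show ?thesis using that by blast
qed

text \<open>The Lipschitz clause comes from \<open>g\<close>, the existence clause from
  \<open>f\<close>. They are linked by the fact that the bound from \<open>g\<close> keeps the line
  through \<open>a\<close> in direction \<open>i\<close> from meeting \<open>X\<close> again near
  \<open>a\<close>; thus \<open>f\<close> is not identically zero on that line and its root
  persists.\<close>

lemma graph_chart_exists:
  assumes a: "a \<in> X" and g: "g \<in> vanishing_polys X"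
    and strict: "has_strict_gradient (cpoly_eval g) c a"
    and c: "c $ i \<noteq> 0" and R: "0 < R"
  obtains r s L where "graph_chart X a i r s L" "poly_box a i r s \<subseteq> ball a R"
proof -
  obtain r0 L where rL: "0 < r0" "0 \<le> L" "\<forall>b\<in>ball a r0. \<forall>b'\<in>ball a r0. cpoly_eval g b = 0 \<longrightarrow> cpoly_eval g b' = 0 \<longrightarrow>
       norm (b $ i - b' $ i) \<le> L * (\<Sum>j\<in>UNIV - {i}. norm (b $ j - b' $ j))"
    by (rule zeros_lipschitz_in_coordinate[OF strict c]) blast
  have lip: "norm (b $ i - b' $ i) \<le> L * (\<Sum>j\<in>UNIV - {i}. norm (b $ j - b' $ j))"
    if "b \<in> ball a r0" "b' \<in> ball a r0" "b \<in> X" "b' \<in> X" for b b'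
    using that g rL(3) by (simp add: vanishing_polys_def)
  let ?n = "real CARD('n)"
  define r where "r = min r0 R / ?n"
  have r: "0 < r" "?n * r \<le> r0" "?n * r \<le> R" using rL R by (auto simp: r_def)
  \<comment> \<open>This point differs from \<open>a\<close> in coordinate \<open>i\<close> only, so
    the Lipschitz bound between the two would have right-hand side 0.\<close>
  have "cpoly_eval f (upd a i (a $ i + of_real (r / 2))) \<noteq> 0"
  proof
    assume "cpoly_eval f (upd a i (a $ i + of_real (r / 2))) = 0"
    then have m: "upd a i (a $ i + of_real (r / 2)) \<in> X" by (simp add: mem_X_iff)
    have "norm (upd a i (a $ i + of_real (r / 2)) - a) \<le> (\<Sum>j\<in>UNIV. norm ((upd a i (a $ i + of_real (r / 2)) - a) $ j))"
      by (rule norm_le_sum_components)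
    also have "\<dots> = (\<Sum>j\<in>UNIV. if j = i then r / 2 else 0)"
      using r(1) by (intro sum.cong) auto
    also have "\<dots> < r" using r(1) by simp
    also have "\<dots> \<le> ?n * r" using r(1) by (simp add: Suc_leI)
    finally have "upd a i (a $ i + of_real (r / 2)) \<in> ball a r0"
      using r(2) by (simp add: dist_norm norm_minus_commute)
    from lip[OF this _ m a] show False using rL(1) r(1) by simp
  qed
  then obtain s where s: "0 < s"
    "\<And>b. (\<And>j. j \<noteq> i \<Longrightarrow> norm (b $ j - a $ j) < s) \<Longrightarrow> \<exists>\<zeta>. norm (\<zeta> - a $ i) < r \<and> cpoly_eval f (upd b i \<zeta>) = 0"
    using poly_fun_root_near[OF poly_fun_cpoly_eval, of f a i "a $ i + of_real (r / 2)" r] a r(1)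
    by (auto simp: mem_X_iff)
  define s' where "s' = min s r"
  have box: "norm (b - a) < ?n * r" if "b \<in> poly_box a i r s'" for b
  proof -
    have "norm (b - a) \<le> (\<Sum>j\<in>UNIV. norm ((b - a) $ j))" by (rule norm_le_sum_components)
    also have "\<dots> < (\<Sum>j\<in>(UNIV::'n set). r)"
    proof (rule sum_strict_mono)
      show "norm ((b - a) $ j) < r" for j
        using that by (cases "j = i") (auto simp: poly_box_def s'_def)
    qed auto
    finally show ?thesis by simp
  qed
  have sub: "poly_box a i r s' \<subseteq> ball a t" if "?n * r \<le> t" for t
    using box that by (force simp: dist_norm norm_minus_commute)
  show ?thesis
  proof (rule that[of r s' L])
    show "poly_box a i r s' \<subseteq> ball a R" using sub r(3) by blast
    show "graph_chart X a i r s' L"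
      unfolding graph_chart_def
    proof (intro conjI allI impI ballI)
      show "0 < r" "0 < s'" "0 \<le> L" using r(1) s(1) rL(2) by (auto simp: s'_def)
      show "\<exists>\<zeta>. norm (\<zeta> - a $ i) < r \<and> upd b i \<zeta> \<in> X" if "\<forall>j. j \<noteq> i \<longrightarrow> norm (b $ j - a $ j) < s'" for b
        using s(2)[of b] that by (auto simp: s'_def mem_X_iff)
      show "norm (b $ i - b' $ i) \<le> L * (\<Sum>j\<in>UNIV - {i}. norm (b $ j - b' $ j))"
        if "b \<in> X \<inter> poly_box a i r s'" "b' \<in> X \<inter> poly_box a i r s'" for b b'
        using that sub[OF r(2)] by (intro lip) auto
    qed
  qed
qed

lemma smooth_point_graph_chart:
  assumes a: "a \<in> X" "a \<noteq> 0" and R: "0 < R"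
  obtains i r s L where "graph_chart X a i r s L" "poly_box a i r s \<subseteq> ball a R"
proof -
  obtain g c where gc: "g \<in> vanishing_polys X" "c \<noteq> 0"
    "has_strict_gradient (cpoly_eval g) c a"
    by (rule smooth_point_gradient[OF a]) blast
  then obtain i where i: "c $ i \<noteq> 0" by (auto simp: vec_eq_iff)
  show ?thesis by (rule graph_chart_exists[OF a(1) gc(1,3) i R]) (rule that)
qed

end

section \<open>Lower density of weighted cones\<close>

text \<open>The region over which points of \<open>E\<close> are available contains a ball of radius
  proportional to \<open>\<epsilon>\<close>. Its preimages have norm below
  \<open>\<epsilon>\<close>, and the projection does not increase distances, so the Lebesgue measure
  of the ball bounds the Hausdorff measure from below.\<close>

lemma lower_density_pos_via_projection:
  fixes E :: "'a::real_normed_vector set" and p :: "'a \<Rightarrow> complex \<times> complex"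
  assumes p: "\<And>x y. dist (p x) (p y) \<le> dist x y" and \<eta>: "0 < \<eta>" and C: "0 \<le> C"
    and E: "\<And>u v. u \<noteq> 0 \<Longrightarrow> norm u < \<eta> \<Longrightarrow> norm v \<le> norm u \<Longrightarrow> \<exists>a\<in>E. p a = (u, v) \<and> norm a \<le> C * norm u"
  shows "0 < lower_density 4 E 0"
proof -
  define D where "D = C + 1"
  have D: "1 \<le> D" using C by (simp add: D_def)
  \<comment> \<open>The 16 is the loss \<open>2 ^ 4\<close> of the projection estimate;
    \<open>4 * D\<close> is the ratio of \<open>\<epsilon>\<close> to the radius
    \<open>\<rho> / 4\<close> of the ball.\<close>
  define \<kappa> where "\<kappa> = 1 / (16 * (4 * D) ^ 4)"
  have \<kappa>: "0 < \<kappa>" using D by (simp add: \<kappa>_def)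
  have ratio: "ennreal \<kappa> \<le> density_ratio 4 E 0 \<epsilon>" if \<epsilon>: "0 < \<epsilon>" "\<epsilon> < \<eta>" for \<epsilon>
  proof -
    define \<rho> where "\<rho> = \<epsilon> / D"
    have \<rho>: "0 < \<rho>" "\<rho> \<le> \<epsilon>" "D * \<rho> = \<epsilon>" using \<epsilon> D by (auto simp: \<rho>_def field_simps)
    define B where "B = unit_ball_vol 4 * \<epsilon> ^ 4"
    \<comment> \<open>On the ball of radius \<open>\<rho> / 4\<close> about this centre,
      \<open>norm u\<close> lies between \<open>\<rho> / 2\<close> and \<open>\<rho>\<close>, while
      \<open>norm v < \<rho> / 4\<close>.\<close>
    define c :: "complex \<times> complex" where "c = (of_real (3 / 4 * \<rho>), 0)"
    have sub: "ball c (\<rho> / 4) \<subseteq> p ` (E \<inter> ball 0 \<epsilon>)"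
    proof
      fix x assume x: "x \<in> ball c (\<rho> / 4)"
      obtain u v where uv: "x = (u, v)" by (cases x)
      have "dist (of_real (3 / 4 * \<rho>)) u \<le> dist c x" "dist 0 v \<le> dist c x"
        unfolding c_def uv dist_Pair_Pair by (auto intro: real_sqrt_sum_squares_ge1 real_sqrt_sum_squares_ge2)
      then have u: "norm (of_real (3 / 4 * \<rho>) - u) < \<rho> / 4" and v: "norm v < \<rho> / 4"
        using x by (auto simp: dist_norm)
      have n: "norm (of_real (3 / 4 * \<rho>) :: complex) = 3 / 4 * \<rho>" by (subst norm_of_real) (use \<rho> in simp)
      have "norm (of_real (3 / 4 * \<rho>) :: complex) - norm u \<le> norm (of_real (3 / 4 * \<rho>) - u)"
        by (rule norm_triangle_ineq2)
      then have u1: "\<rho> / 2 < norm u" using n u by linarith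
      have "norm u - norm (of_real (3 / 4 * \<rho>) :: complex) \<le> norm (of_real (3 / 4 * \<rho>) - u)"
        by (subst norm_minus_commute) (rule norm_triangle_ineq2)
      then have u2: "norm u < \<rho>" using n u by linarith
      have "u \<noteq> 0" using u1 \<rho> by auto
      moreover have "norm u < \<eta>" using u2 \<rho> \<epsilon> by linarith
      moreover have "norm v \<le> norm u" using u1 v \<rho> by linarith
      ultimately obtain a where a: "a \<in> E" "p a = (u, v)" "norm a \<le> C * norm u"
        using E by blast
      have "C * norm u \<le> D * norm u" by (simp add: D_def algebra_simps)
      also have "\<dots> < D * \<rho>" using u2 D by simp
      finally have "norm a < \<epsilon>" using a(3) \<rho>(3) by linarith
      then show "x \<in> p ` (E \<inter> ball 0 \<epsilon>)" using a uv by force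
    qed
    have dim: "DIM(complex \<times> complex) = 4" by simp
    have "emeasure lborel (ball c (\<rho> / 4)) = ennreal (unit_ball_vol 4 * (\<rho> / 4) ^ 4)"
      using emeasure_ball[of "\<rho> / 4" c] \<rho> by (simp add: dim)
    then have "ennreal (1 / 16) * ennreal (unit_ball_vol 4 * (\<rho> / 4) ^ 4) \<le> hausdorff_measure (real 4) (E \<inter> ball 0 \<epsilon>)"
      using lborel_le_hausdorff_measure[of "E \<inter> ball 0 \<epsilon>" p "ball c (\<rho> / 4)"] p sub
      unfolding dim by simp
    moreover have "ennreal (1 / 16) * ennreal (unit_ball_vol 4 * (\<rho> / 4) ^ 4) = ennreal (\<kappa> * (unit_ball_vol 4 * \<epsilon> ^ 4))"
      unfolding \<rho>_def \<kappa>_def by (subst ennreal_mult'[symmetric]) (auto simp: power_mult_distrib power_divide)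
    ultimately have le: "ennreal (\<kappa> * B) / ennreal B \<le> density_ratio 4 E 0 \<epsilon>"
      unfolding density_ratio_def B_def by (auto intro!: divide_right_mono_ennreal)
    have "0 < B" using \<epsilon> by (simp add: B_def)
    then have "ennreal (\<kappa> * B) / ennreal B = ennreal \<kappa>"
      using \<kappa> by (subst divide_ennreal) auto
    then show ?thesis using le by simp
  qed
  have "eventually (\<lambda>\<epsilon>. ennreal \<kappa> \<le> density_ratio 4 E 0 \<epsilon>) (at_right 0)"
    using eventually_at_right_real[OF \<eta>] by eventually_elim (auto intro: ratio)
  then have "ennreal \<kappa> \<le> lower_density 4 E 0"
    unfolding lower_density_def by (rule Liminf_bounded)
  then show ?thesis using \<kappa> by (meson ennreal_less_zero_iff less_le_trans)
qed

lemma lower_density_mono: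
  assumes "A \<subseteq> B"
  shows "lower_density k A x \<le> lower_density k B x"
  unfolding lower_density_def density_ratio_def
  using assms by (intro Liminf_mono always_eventually allI divide_right_mono_ennreal hausdorff_measure_mono) auto

lemma dist_two_components_le:
  fixes a b :: "complex ^ 'n::finite"
  assumes "j \<noteq> k"
  shows "dist (a $ j, a $ k) (b $ j, b $ k) \<le> dist a b"
proof -
  have "(dist (a $ j) (b $ j))\<^sup>2 + (dist (a $ k) (b $ k))\<^sup>2 = (\<Sum>i\<in>{j, k}. (dist (a $ i) (b $ i))\<^sup>2)"
    using assms by simp
  also have "\<dots> \<le> (\<Sum>i\<in>UNIV. (dist (a $ i) (b $ i))\<^sup>2)"
    by (intro sum_mono2) auto
  finally show ?thesis
    unfolding dist_Pair_Pair dist_vec_def L2_set_def by simp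
qed

lemma norm_le_3:
  fixes a :: "complex ^ 3"
  shows "norm a \<le> norm (a $ 1) + norm (a $ 2) + norm (a $ 3)"
  using norm_le_sum_components[of a] by (simp add: sum_3)

lemma power_ratio_le:
  fixes x :: real
  assumes "0 < x" "x \<le> 1" "b < a"
  shows "x ^ a / x ^ b \<le> x"
proof -
  have "x ^ a = x ^ (a - b) * x ^ b" using assms by (simp flip: power_add)
  then have "x ^ a / x ^ b = x ^ (a - b)" using assms by simp
  also have "\<dots> \<le> x ^ 1" using assms by (intro power_decreasing) auto
  finally show ?thesis by simp
qed

lemma scaling_parameter:
  fixes c :: complex
  assumes c: "c \<noteq> 0" and n: "0 < n" and l0: "0 < l0"
  obtains \<eta> where "0 < \<eta>" "\<And>u. u \<noteq> 0 \<Longrightarrow> norm u < \<eta> \<Longrightarrow> \<exists>l. l \<noteq> 0 \<and> norm l < l0 \<and> l ^ n * c = u"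
proof
  show "0 < norm c * l0 ^ n" using c l0 by simp
  fix u :: complex assume u: "u \<noteq> 0" "norm u < norm c * l0 ^ n"
  obtain l where l: "l \<noteq> 0" "u / c = l ^ n"
    using exists_complex_root_nonzero[of "u / c" n] u c n by auto
  have "norm l ^ n = norm u / norm c" using l(2) by (metis norm_divide norm_power)
  also have "\<dots> < l0 ^ n" using u c by (simp add: field_simps)
  finally have "norm l < l0" using l0 by (simp add: power_less_imp_less_base)
  then show "\<exists>l. l \<noteq> 0 \<and> norm l < l0 \<and> l ^ n * c = u" using l c by (metis nonzero_divide_eq_eq)
qed

locale separated_surface = weighted_hypersurface w f X
  for w :: "3 \<Rightarrow> nat" and f and X +
  assumes w12: "w 2 \<le> w 1" and w23: "w 3 < w 2"
    and disconnected: "\<not> connected ((X - {0}) \<inter> {a. a $ 3 = 0})"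
begin

definition punctured_curve :: "(complex ^ 3) set" where
  "punctured_curve = (X - {0}) \<inter> {a. a $ 3 = 0}"

text \<open>Otherwise the punctured curve would be a whole complex plane minus a point, which is
  connected.\<close>

lemma plane_not_subset: "\<not> {a. a $ 3 = 0} \<subseteq> X"
proof
  assume sub: "{a. a $ 3 = 0} \<subseteq> X"
  define h :: "complex \<times> complex \<Rightarrow> complex ^ 3" where "h x = vector [fst x, snd x, 0]" for x
  have h: "h x = (\<chi> j. if j = 1 then fst x else if j = 2 then snd x else 0)" for x
    by (auto simp: h_def vec_eq_iff forall_3)
  have "continuous_on (UNIV - {0}) h"
    unfolding h[abs_def]
  proof (rule continuous_on_vec_lambda)
    show "continuous_on (UNIV - {0}) (\<lambda>x::complex \<times> complex. if j = 1 then fst x else if j = 2 then snd x else 0)" for j :: 3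
      by (cases "j = 1"; cases "j = 2") (auto intro!: continuous_intros)
  qed
  moreover have "connected (UNIV - {0 :: complex \<times> complex})"
    using connected_punctured_universe[of "0 :: complex \<times> complex"] by (simp add: Compl_eq_Diff_UNIV)
  ultimately have "connected (h ` (UNIV - {0}))" by (rule connected_continuous_image)
  moreover have "h ` (UNIV - {0}) = (X - {0}) \<inter> {a. a $ 3 = 0}"
  proof
    show "h ` (UNIV - {0}) \<subseteq> (X - {0}) \<inter> {a. a $ 3 = 0}"
    proof
      fix a assume "a \<in> h ` (UNIV - {0})"
      then obtain x where x: "x \<noteq> 0" "a = h x" by auto
      then have "a $ 3 = 0" "a \<noteq> 0"
        by (auto simp: h_def vec_eq_iff forall_3 prod_eq_iff)
      then show "a \<in> (X - {0}) \<inter> {a. a $ 3 = 0}" using sub by auto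
    qed
    show "(X - {0}) \<inter> {a. a $ 3 = 0} \<subseteq> h ` (UNIV - {0})"
    proof
      fix a assume a: "a \<in> (X - {0}) \<inter> {a. a $ 3 = 0}"
      then have "a = h (a $ 1, a $ 2)" "(a $ 1, a $ 2) \<noteq> 0"
        by (auto simp: h_def vec_eq_iff forall_3 prod_eq_iff)
      then show "a \<in> h ` (UNIV - {0})" by blast
    qed
  qed
  ultimately show False using disconnected by simp
qed

text \<open>The action moves a line contained in \<open>X\<close> over all points of the plane with
  non-zero coordinate \<open>j\<close>, and closedness of \<open>X\<close> adds the rest of the
  plane. The result provides the non-zero slices needed for persistence of roots.\<close>

lemma line_not_subset:
  assumes ij: "i \<noteq> j" "i \<noteq> 3" "j \<noteq> 3" and b: "b $ 3 = 0" "b $ j \<noteq> 0"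
  obtains \<zeta> where "upd b i \<zeta> \<notin> X"
proof (rule ccontr)
  assume "\<not> thesis"
  then have line: "upd b i \<zeta> \<in> X" for \<zeta> using that by blast
  have cases: "k = i \<or> k = j \<or> k = 3" for k
    using ij exhaust_3[of i] exhaust_3[of j] exhaust_3[of k] by auto
  have *: "a \<in> X" if a: "a $ 3 = 0" "a $ j \<noteq> 0" for a
  proof -
    obtain l where l: "l \<noteq> 0" "a $ j / b $ j = l ^ w j"
      using exists_complex_root_nonzero[of "a $ j / b $ j" "w j"] a b w_pos[of j] by auto
    \<comment> \<open>The scaling takes coordinate \<open>j\<close> of the line to
      \<open>a $ j\<close>; dividing by \<open>l ^ w i\<close> beforehand makes coordinate
      \<open>i\<close> come out as \<open>a $ i\<close>.\<close>
    define c where "c = act w l (upd b i (a $ i / l ^ w i))"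
    have "c $ k = a $ k" for k
      using cases[of k] ij a b l by (auto simp: c_def field_simps simp flip: l(2))
    then have "c = a" by (simp add: vec_eq_iff)
    moreover have "c \<in> X" unfolding c_def by (rule act_mem[OF line])
    ultimately show ?thesis by simp
  qed
  have "a \<in> X" if a: "a $ 3 = 0" for a
  proof (cases "a $ j = 0")
    case True
    have "((\<lambda>t. upd a j (of_real t)) \<longlongrightarrow> upd a j (of_real 0)) (at_right 0)"
      unfolding upd_def
    proof (rule tendsto_vec_lambda)
      show "((\<lambda>t. if k = j then of_real t else a $ k) \<longlongrightarrow> (if k = j then of_real 0 else a $ k)) (at_right 0)" for k
        using tendsto_of_real[OF tendsto_ident_at[of 0 "{0<..}"], where 'a = complex] by (cases "k = j") auto
    qed
    moreover have "eventually (\<lambda>t. upd a j (of_real t) \<in> X) (at_right 0)"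
      using eventually_at_right_less[of 0]
    proof eventually_elim
      case (elim t)
      then show ?case using a ij by (intro *) auto
    qed
    ultimately have "upd a j (of_real 0) \<in> X"
      by (intro Lim_in_closed_set[OF closed_X]) (auto simp: trivial_limit_at_right_real)
    moreover have "upd a j (of_real 0) = a" using True by (auto simp: vec_eq_iff)
    ultimately show ?thesis by simp
  qed (use * a in auto)
  then show False using plane_not_subset by blast
qed

section \<open>Density of cones over neighbourhoods of curve points\<close>

definition cone_over :: "real \<Rightarrow> (complex ^ 3) set \<Rightarrow> (complex ^ 3) set" where
  "cone_over \<tau> V = (\<lambda>(l, q). act w l q) ` ({l. l \<noteq> 0 \<and> norm l < \<tau>} \<times> V)"

lemma cone_overI: "l \<noteq> 0 \<Longrightarrow> norm l < \<tau> \<Longrightarrow> q \<in> V \<Longrightarrow> act w l q \<in> cone_over \<tau> V"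
  unfolding cone_over_def by force

text \<open>A point \<open>(u, v)\<close> of the coordinate plane is reached by scaling coordinate \<open>j\<close> to its value at \<open>p\<close>;
  \<open>w k < w j\<close> makes the scaled coordinate \<open>k\<close> small.\<close>

lemma lower_density_cone_via_slice:
  assumes ijk: "UNIV = {i, j, k}" "j \<noteq> k" "i \<noteq> j" "i \<noteq> k" and w: "w k < w j" and p: "p $ j \<noteq> 0"
    and pos: "0 < \<tau>" "0 < s" "0 \<le> C"
    and lift: "\<And>(l :: complex) (v :: complex). l \<noteq> 0 \<Longrightarrow> norm l \<le> 1 \<Longrightarrow> norm v < s \<Longrightarrow> norm v \<le> norm l ^ w j / norm l ^ w k * norm (p $ j) \<Longrightarrow>
      \<exists>q\<in>V. q $ j = p $ j \<and> q $ k = v \<and> norm l ^ w i * norm (q $ i) \<le> C * norm l ^ w j"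
  shows "0 < lower_density 4 (cone_over \<tau> V) 0"
proof -
  define N where "N = norm (p $ j)"
  have N: "0 < N" using p by (simp add: N_def)
  \<comment> \<open>The three bounds serve \<open>norm l \<le> 1\<close>, membership in the cone of
    size \<open>\<tau>\<close>, and a slice coordinate below \<open>s\<close>.\<close>
  define l0 where "l0 = min (min 1 \<tau>) (s / N)"
  have "0 < l0" using pos N by (auto simp: l0_def)
  obtain \<eta> where \<eta>: "0 < \<eta>" "\<And>u. u \<noteq> 0 \<Longrightarrow> norm u < \<eta> \<Longrightarrow> \<exists>l. l \<noteq> 0 \<and> norm l < l0 \<and> l ^ w j * p $ j = u"
    using scaling_parameter[OF p w_pos[of j] \<open>0 < l0\<close>] by blast
  show ?thesis
  proof (rule lower_density_pos_via_projection[where p = "\<lambda>a. (a $ j, a $ k)" and \<eta> = \<eta> and C = "C / N + 2"])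
    show "dist (x $ j, x $ k) (y $ j, y $ k) \<le> dist x y" for x y :: "complex ^ 3"
      using ijk(2) by (rule dist_two_components_le)
    fix u v :: complex assume uv: "u \<noteq> 0" "norm u < \<eta>" "norm v \<le> norm u"
    then obtain l where l: "l \<noteq> 0" "norm l < l0" "l ^ w j * p $ j = u" using \<eta>(2) by blast
    have l1: "0 < norm l" "norm l \<le> 1" "norm l < \<tau>" "norm l * N < s"
      using l(1,2) N by (auto simp: l0_def field_simps)
    have nu: "norm u = norm l ^ w j * N" by (simp add: norm_mult norm_power N_def flip: l(3))
    \<comment> \<open>The value of coordinate \<open>k\<close> on the slice that the action by
      \<open>l\<close> takes to \<open>v\<close>.\<close>
    define z where "z = v / l ^ w k"
    have z_le: "norm z \<le> norm l ^ w j / norm l ^ w k * N"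
      using uv(3) l1(1) by (simp add: z_def norm_divide norm_power nu divide_right_mono)
    also have "\<dots> \<le> norm l * N"
      using l1 w N by (intro mult_right_mono power_ratio_le) auto
    finally have "norm z < s" using l1(4) by linarith
    then obtain q where q: "q \<in> V" "q $ j = p $ j" "q $ k = z" "norm l ^ w i * norm (q $ i) \<le> C * norm l ^ w j"
      using lift[OF l(1) l1(2) _ z_le[unfolded N_def]] by blast
    define a where "a = act w l q"
    have a: "a $ j = u" "a $ k = v" "norm (a $ i) \<le> C * norm l ^ w j"
      using l q by (auto simp: a_def z_def norm_mult norm_power)
    have "norm a \<le> (\<Sum>n\<in>{i, j, k}. norm (a $ n))"
      using norm_le_sum_components[of a] by (simp add: ijk(1))
    also have "\<dots> = norm (a $ i) + norm (a $ j) + norm (a $ k)"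
      using ijk(2-4) by simp
    also have "\<dots> \<le> C * norm l ^ w j + 2 * norm u" using a uv(3) by simp
    also have "\<dots> = (C / N + 2) * norm u" using N by (simp add: nu distrib_right)
    finally have "norm a \<le> (C / N + 2) * norm u" .
    moreover have "a \<in> cone_over \<tau> V"
      unfolding a_def using l l1 q by (intro cone_overI)
    ultimately show "\<exists>a\<in>cone_over \<tau> V. (a $ j, a $ k) = (u, v) \<and> norm a \<le> (C / N + 2) * norm u"
      using a by auto
  qed (use \<eta> pos N in auto)
qed

text \<open>Here the \<open>(y, z)\<close>-plane is the right target: \<open>w 2 \<le> w 1\<close>
  makes the scaled \<open>x\<close> at most a constant times the scaled \<open>y\<close>. A root
  \<open>x\<close> over each small \<open>z\<close> comes from persistence, since the line in
  direction \<open>x\<close> through \<open>p\<close> is not contained in \<open>X\<close>.\<close>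

lemma lower_density_cone_generic:
  assumes p: "p \<in> punctured_curve" "p $ 2 \<noteq> 0" and R: "0 < R" and \<tau>: "0 < \<tau>"
  shows "0 < lower_density 4 (cone_over \<tau> (X \<inter> ball p R)) 0"
proof -
  have pX: "p \<in> X" "p $ 3 = 0" using p by (auto simp: punctured_curve_def)
  obtain \<zeta>0 where "upd p 1 \<zeta>0 \<notin> X"
    using line_not_subset[of 1 2 p] pX p by auto
  then have "cpoly_eval f (upd p 1 \<zeta>0) \<noteq> 0" by (simp add: mem_X_iff)
  then obtain s where s: "0 < s"
    "\<And>b. (\<And>j. j \<noteq> 1 \<Longrightarrow> norm (b $ j - p $ j) < s) \<Longrightarrow> \<exists>\<zeta>. norm (\<zeta> - p $ 1) < R / 3 \<and> cpoly_eval f (upd b 1 \<zeta>) = 0"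
    using poly_fun_root_near[OF poly_fun_cpoly_eval, of f p 1 \<zeta>0 "R / 3"] pX R by (auto simp: mem_X_iff)
  show ?thesis
  proof (rule lower_density_cone_via_slice[where i = 1 and j = 2 and k = 3 and p = p and s = "min s (R / 3)" and C = "norm (p $ 1) + R"])
    fix l z :: complex assume l: "norm l \<le> 1" and z: "norm z < min s (R / 3)"
    have "norm ((vector [0, p $ 2, z] :: complex ^ 3) $ j - p $ j) < s" if "j \<noteq> 1" for j
      using exhaust_3[of j] that z s(1) pX(2) by auto
    then obtain \<zeta> where \<zeta>: "norm (\<zeta> - p $ 1) < R / 3" "cpoly_eval f (upd (vector [0, p $ 2, z]) 1 \<zeta>) = 0"
      using s(2)[of "vector [0, p $ 2, z]"] by blast
    define q :: "complex ^ 3" where "q = vector [\<zeta>, p $ 2, z]"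
    have "upd (vector [0, p $ 2, z]) 1 \<zeta> = q" by (simp add: q_def vec_eq_iff forall_3)
    then have qX: "q \<in> X" using \<zeta> by (simp add: mem_X_iff)
    have "norm (q - p) \<le> norm (\<zeta> - p $ 1) + norm z"
      using norm_le_3[of "q - p"] pX(2) by (simp add: q_def)
    then have "norm (q - p) < R" using \<zeta>(1) z R by simp
    then have "q \<in> X \<inter> ball p R" using qX by (simp add: dist_norm norm_minus_commute)
    moreover have "norm l ^ w 1 * norm \<zeta> \<le> (norm (p $ 1) + R) * norm l ^ w 2"
    proof -
      have "norm \<zeta> \<le> norm (p $ 1) + R"
        using \<zeta>(1) R norm_triangle_ineq2[of \<zeta> "p $ 1"] by linarith
      moreover have "norm l ^ w 1 \<le> norm l ^ w 2" using l w12 by (intro power_decreasing) auto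
      ultimately show ?thesis by (subst mult.commute) (intro mult_mono; simp add: add_nonneg_nonneg R less_imp_le)
    qed
    ultimately show "\<exists>q\<in>X \<inter> ball p R. q $ 2 = p $ 2 \<and> q $ 3 = z \<and>
        norm l ^ w 1 * norm (q $ 1) \<le> (norm (p $ 1) + R) * norm l ^ w 2"
      by (intro bexI[of _ q]) (auto simp: q_def)
  qed (use s R \<tau> w23 p exhaust_3 in auto)
qed


lemma axis_point:
  assumes "p \<in> punctured_curve" "p $ 2 = 0"
  shows "p \<in> X" "p \<noteq> 0" "p $ 3 = 0" "p $ 1 \<noteq> 0"
  using assms by (auto simp: punctured_curve_def vec_eq_iff forall_3)

lemma slice_point_norm:
  fixes p :: "complex ^ 3"
  assumes "p $ 2 = 0" "p $ 3 = 0"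
  shows "norm (vector [p $ 1, y, z] - p) \<le> norm y + norm (z :: complex)"
    "norm y \<le> norm (vector [p $ 1, y, z] - p)"
  using norm_le_3[of "vector [p $ 1, y, z] - p"] assms
    Finite_Cartesian_Product.norm_nth_le[of "vector [p $ 1, y, z] - p" 2] by auto

text \<open>Near a point of the \<open>x\<close>-axis the slice \<open>x = p $ 1\<close> of \<open>X\<close> is a smooth plane curve germ in
  the coordinates \<open>(y, z)\<close>, along which \<open>z\<close> vanishes to order \<open>m\<close> in \<open>y\<close> if it is tangent to
  \<open>z = 0\<close>.\<close>

lemma axis_slice_transversal:
  assumes p: "p \<in> punctured_curve" "p $ 2 = 0" and R: "0 < R"
    and g: "g \<in> vanishing_polys X" "has_strict_gradient (cpoly_eval g) c p" and c: "c $ 2 \<noteq> 0"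
  obtains K s where "0 < K" "0 < s"
    "\<forall>v. norm v < s \<longrightarrow> (\<exists>y. vector [p $ 1, y, v] \<in> X \<inter> ball p R \<and> norm y \<le> K * norm v)"
proof -
  note pX = axis_point[OF p]
  obtain r s L where gc: "graph_chart X p 2 r s L" "poly_box p 2 r s \<subseteq> ball p R"
    by (rule graph_chart_exists[OF pX(1) g c R]) (rule that)
  have rs: "0 < r" "0 < s" "0 \<le> L" using gc by (auto simp: graph_chart_def)
  have "\<exists>y. vector [p $ 1, y, v] \<in> X \<inter> ball p R \<and> norm y \<le> (L + 1) * norm v" if v: "norm v < s" for v
  proof -
    let ?b = "vector [p $ 1, 0, v] :: complex ^ 3"
    have "norm (?b $ j - p $ j) < s" if "j \<noteq> 2" for j
      using exhaust_3[of j] that v rs pX(3) by auto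
    then obtain y where y: "norm (y - p $ 2) < r" "upd ?b 2 y \<in> X"
      using gc(1) unfolding graph_chart_def by blast
    have q: "upd ?b 2 y = vector [p $ 1, y, v]" by (simp add: vec_eq_iff forall_3)
    have qb: "vector [p $ 1, y, v] \<in> X \<inter> poly_box p 2 r s"
      using y q v rs pX(3) by (auto simp: poly_box_def forall_3)
    have pb: "p \<in> X \<inter> poly_box p 2 r s" using pX rs by (auto simp: poly_box_def)
    \<comment> \<open>Comparison with \<open>p\<close> itself, where \<open>y\<close> and
      \<open>z\<close> vanish, turns the Lipschitz clause into a bound for \<open>y\<close>.\<close>
    have "norm ((vector [p $ 1, y, v] :: complex ^ 3) $ 2 - p $ 2)
        \<le> L * (\<Sum>j\<in>UNIV - {2}. norm ((vector [p $ 1, y, v] :: complex ^ 3) $ j - p $ j))"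
      using gc(1) qb pb unfolding graph_chart_def by blast
    moreover have "UNIV - {2 :: 3} = {1, 3}" using exhaust_3 by auto
    ultimately have "norm y \<le> L * norm v" using p(2) pX(3) by simp
    also have "\<dots> \<le> (L + 1) * norm v" by (simp add: distrib_right)
    finally show ?thesis using qb gc(2) by blast
  qed
  then show ?thesis using that[of "L + 1" s] rs by simp
qed

text \<open>Let \<open>G\<close> be \<open>g\<close> restricted to the line \<open>z = 0\<close> of
  the slice, with \<open>m\<close> its order of vanishing at \<open>y = 0\<close>. The gradient of
  \<open>g\<close> at \<open>p\<close> has only a \<open>z\<close>-component, so on
  \<open>X\<close>, where \<open>g\<close> vanishes, \<open>norm (G y)\<close> is comparable to
  \<open>norm z\<close>; by definition of \<open>m\<close> it is also comparable to
  \<open>norm y ^ m\<close>.\<close>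

lemma axis_slice_tangential:
  assumes p: "p \<in> punctured_curve" "p $ 2 = 0" and R: "0 < R"
    and g: "g \<in> vanishing_polys X" "has_strict_gradient (cpoly_eval g) c p"
    and c: "c $ 1 = 0" "c $ 2 = 0" "c $ 3 \<noteq> 0"
  obtains m K s where "1 \<le> m" "0 < K" "0 < s"
    "\<forall>v. norm v < s \<longrightarrow> (\<exists>y. vector [p $ 1, y, v] \<in> X \<inter> ball p R \<and> norm y ^ m \<le> K * norm v)"
    "\<forall>y. norm y < s \<longrightarrow> (\<exists>v. vector [p $ 1, y, v] \<in> X \<inter> ball p R \<and> norm v \<le> K * norm y ^ m)"
proof -
  note pX = axis_point[OF p]
  have p0: "upd p 2 0 = p" using p(2) by (metis upd_triv)
  have slice0: "upd p 2 y = vector [p $ 1, y, 0]" for y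
    using pX(3) by (simp add: vec_eq_iff forall_3)
  define G where "G y = cpoly_eval g (upd p 2 y)" for y
  have gX: "cpoly_eval g a = 0" if "a \<in> X" for a using g(1) that by (simp add: vanishing_polys_def)
  have G0: "G 0 = 0" using gX[OF pX(1)] by (simp add: G_def p0)
  define \<epsilon> where "\<epsilon> = norm (c $ 3) / 2"
  have \<epsilon>: "0 < \<epsilon>" "norm (c $ 3) = 2 * \<epsilon>" using c by (auto simp: \<epsilon>_def)
  obtain \<delta> where \<delta>: "\<delta> > 0" "\<forall>b\<in>ball p \<delta>. \<forall>b'\<in>ball p \<delta>.
     norm (cpoly_eval g b - cpoly_eval g b' - (\<Sum>j\<in>UNIV. c $ j * (b $ j - b' $ j))) \<le> \<epsilon> * norm (b - b')"
    using g(2) \<epsilon>(1) unfolding has_strict_gradient_def by meson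
  \<comment> \<open>Strict differentiability between \<open>(y, v)\<close>, where \<open>g\<close>
    vanishes, and \<open>(y, 0)\<close>, where it equals \<open>G y\<close>: the linear term has
    size \<open>2 * \<epsilon> * norm v\<close> and the error at most half of that.\<close>
  have compare: "\<epsilon> * norm v \<le> norm (G y)" "norm (G y) \<le> 3 * \<epsilon> * norm v"
    if q: "vector [p $ 1, y, v] \<in> X" "vector [p $ 1, y, v] \<in> ball p \<delta>" for y v
  proof -
    let ?b = "vector [p $ 1, y, v] :: complex ^ 3" and ?b' = "vector [p $ 1, y, 0] :: complex ^ 3"
    have "norm (?b' - p) \<le> norm (?b - p)"
      using slice_point_norm(1)[OF p(2) pX(3), of y 0] slice_point_norm(2)[OF p(2) pX(3), of y v] by simp
    then have b': "?b' \<in> ball p \<delta>" using q(2) by (simp add: dist_norm norm_minus_commute)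
    have "norm (?b - ?b') \<le> norm v" using norm_le_3[of "?b - ?b'"] by simp
    have "norm (cpoly_eval g ?b - cpoly_eval g ?b' - (\<Sum>j\<in>UNIV. c $ j * (?b $ j - ?b' $ j))) \<le> \<epsilon> * norm (?b - ?b')"
      using \<delta>(2) b' q(2) by blast
    also have "\<dots> \<le> \<epsilon> * norm v" using \<epsilon> \<open>norm (?b - ?b') \<le> norm v\<close> by simp
    also have "cpoly_eval g ?b - cpoly_eval g ?b' - (\<Sum>j\<in>UNIV. c $ j * (?b $ j - ?b' $ j)) = - (G y + c $ 3 * v)"
      using gX[OF q(1)] by (simp add: sum_3 G_def slice0)
    finally have n: "norm (G y + c $ 3 * v) \<le> \<epsilon> * norm v" by (simp only: norm_minus_cancel)
    have "norm (c $ 3 * v) \<le> norm (G y + c $ 3 * v) + norm (G y)"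
      using norm_triangle_ineq4[of "G y + c $ 3 * v" "G y"] by simp
    then show "\<epsilon> * norm v \<le> norm (G y)" using n \<epsilon>(2) by (simp add: norm_mult)
    have "norm (G y) \<le> norm (G y + c $ 3 * v) + norm (c $ 3 * v)"
      using norm_triangle_ineq4[of "G y + c $ 3 * v" "c $ 3 * v"] by simp
    then show "norm (G y) \<le> 3 * \<epsilon> * norm v" using n \<epsilon>(2) by (simp add: norm_mult)
  qed
  define R' where "R' = min R \<delta>"
  have R': "0 < R'" "R' \<le> R" "R' \<le> \<delta>" using R \<delta>(1) by (auto simp: R'_def)
  obtain r s L where gc: "graph_chart X p 3 r s L" "poly_box p 3 r s \<subseteq> ball p R'"
    by (rule graph_chart_exists[OF pX(1) g c(3) R'(1)]) (rule that)
  have rs: "0 < r" "0 < s" using gc by (auto simp: graph_chart_def)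
  have lift: "\<exists>v. vector [p $ 1, y, v] \<in> X \<inter> ball p R'" if y: "norm y < s" for y
  proof -
    let ?b = "vector [p $ 1, y, 0] :: complex ^ 3"
    have "norm (?b $ j - p $ j) < s" if "j \<noteq> 3" for j
      using exhaust_3[of j] that y rs p(2) by auto
    then obtain v where v: "norm (v - p $ 3) < r" "upd ?b 3 v \<in> X"
      using gc(1) unfolding graph_chart_def by blast
    have q: "upd ?b 3 v = vector [p $ 1, y, v]" by (simp add: vec_eq_iff forall_3)
    have "vector [p $ 1, y, v] \<in> poly_box p 3 r s"
      using v y rs p(2) by (auto simp: poly_box_def forall_3)
    then show ?thesis using gc(2) v(2) unfolding q by blast
  qed
  obtain \<zeta>0 where "upd p 2 \<zeta>0 \<notin> X"
    using line_not_subset[of 2 1 p] pX by auto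
  then have nz: "cpoly_eval f (upd p 2 \<zeta>0) \<noteq> 0" by (simp add: mem_X_iff)
  \<comment> \<open>If \<open>G\<close> vanished, \<open>compare\<close> would give
    \<open>v = 0\<close> for every lifted point, so \<open>f\<close> would vanish on a piece of the
    line through \<open>p\<close> in direction \<open>y\<close>. Its zero there is isolated.\<close>
  have nonconst: "\<not> G constant_on UNIV"
  proof
    assume "G constant_on UNIV"
    then have Gz: "G y = 0" for y using G0 by (auto simp: constant_on_def)
    have fz: "cpoly_eval f (upd p 2 y) = 0" if y: "norm y < s" for y
    proof -
      obtain v where v: "vector [p $ 1, y, v] \<in> X \<inter> ball p R'" using lift[OF y] by blast
      then have "\<epsilon> * norm v \<le> norm (G y)" using R'(3) by (intro compare) auto
      then have "v = 0" using Gz \<epsilon>(1) by (simp add: mult_le_0_iff)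
      then show ?thesis using v by (simp add: slice0 mem_X_iff)
    qed
    obtain r0 where r0: "0 < r0" "\<And>y. y \<in> ball 0 r0 - {0} \<Longrightarrow> cpoly_eval f (upd p 2 y) \<noteq> 0"
      using isolated_zeros[OF poly_fun_coord_holomorphic[OF poly_fun_cpoly_eval[of f], of p 2 UNIV] open_UNIV connected_UNIV, of 0 \<zeta>0]
        nz pX(1) by (auto simp: p0 mem_X_iff)
    define y :: complex where "y = of_real (min r0 s / 2)"
    have "norm y = min r0 s / 2" using r0(1) rs by (simp add: y_def)
    then have "y \<in> ball 0 r0 - {0}" "norm y < s" using r0(1) rs by auto
    then show False using r0(2) fz by blast
  qed
  have holG: "G holomorphic_on UNIV"
    unfolding G_def by (intro poly_fun_coord_holomorphic poly_fun_cpoly_eval)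
  obtain u r1 m where u: "0 < m" "0 < r1" "u holomorphic_on ball 0 r1"
    "\<And>y. y \<in> ball 0 r1 \<Longrightarrow> G y = (y - 0) ^ m * u y" "\<And>y. y \<in> ball 0 r1 \<Longrightarrow> u y \<noteq> 0"
    by (rule holomorphic_factor_zero_nonconstant[OF holG open_UNIV connected_UNIV UNIV_I G0 nonconst]) blast
  define k where "k = norm (u 0) / 2"
  have k: "0 < k" using u(2) u(5)[of 0] by (simp add: k_def)
  have "continuous_on (ball 0 r1) u" using u(3) by (rule holomorphic_on_imp_continuous_on)
  then have "isCont u 0" using u(2) by (simp add: continuous_on_eq_continuous_at)
  then obtain r2 where r2: "0 < r2" "\<And>y. norm y < r2 \<Longrightarrow> norm (u y - u 0) < k"
    using k unfolding continuous_at_eps_delta by (metis dist_norm diff_zero)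
  define r3 where "r3 = min r1 r2"
  have r3: "0 < r3" using u(2) r2(1) by (simp add: r3_def)
  have order: "k * norm y ^ m \<le> norm (G y)" "norm (G y) \<le> 3 * k * norm y ^ m" if "norm y < r3" for y
  proof -
    have uy: "norm (u y - u 0) < k" using r2(2) that by (simp add: r3_def)
    have "norm (u 0) - norm (u y) \<le> norm (u y - u 0)" "norm (u y) - norm (u 0) \<le> norm (u y - u 0)"
      using norm_triangle_ineq2[of "u 0" "u y"] norm_triangle_ineq2[of "u y" "u 0"] by (auto simp: norm_minus_commute)
    then have uk: "k \<le> norm (u y)" "norm (u y) \<le> 3 * k" using uy by (auto simp: k_def)
    have "norm (G y) = norm (u y) * norm y ^ m"
      using u(4)[of y] that by (simp add: r3_def norm_mult norm_power)
    then show "k * norm y ^ m \<le> norm (G y)" "norm (G y) \<le> 3 * k * norm y ^ m"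
      using uk by (auto intro!: mult_right_mono)
  qed
  define r4 where "r4 = min r3 (R' / 2)"
  have r4: "0 < r4" using r3 R' by (simp add: r4_def)
  \<comment> \<open>For given \<open>y\<close> the chart in direction 3 yields \<open>z\<close>. In
    the other direction the slice need not be a graph over \<open>z\<close>, so \<open>y\<close> is
    found as a persistent root of \<open>f\<close>.\<close>
  obtain s1 where s1: "0 < s1"
    "\<And>b. (\<And>j. j \<noteq> 2 \<Longrightarrow> norm (b $ j - p $ j) < s1) \<Longrightarrow> \<exists>\<zeta>. norm (\<zeta> - p $ 2) < r4 \<and> cpoly_eval f (upd b 2 \<zeta>) = 0"
    using poly_fun_root_near[OF poly_fun_cpoly_eval, of f p 2 \<zeta>0 r4] nz pX(1) r4 by (auto simp: mem_X_iff)
  define K where "K = max (3 * \<epsilon> / k) (3 * k / \<epsilon>)"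
  define s' where "s' = min (min s r3) (min s1 (R' / 2))"
  show ?thesis
  proof (rule that[of m K s'])
    show "1 \<le> m" using u(1) by simp
    show "0 < K" using k \<epsilon> by (simp add: K_def less_max_iff_disj)
    show "0 < s'" using rs r3 s1 R' by (simp add: s'_def)
    show "\<forall>v. norm v < s' \<longrightarrow> (\<exists>y. vector [p $ 1, y, v] \<in> X \<inter> ball p R \<and> norm y ^ m \<le> K * norm v)"
    proof (intro allI impI)
      fix v :: complex assume v: "norm v < s'"
      let ?b = "vector [p $ 1, 0, v] :: complex ^ 3"
      have "norm (?b $ j - p $ j) < s1" if "j \<noteq> 2" for j
        using exhaust_3[of j] that v s1(1) pX(3) by (auto simp: s'_def)
      then obtain y where y: "norm (y - p $ 2) < r4" "cpoly_eval f (upd ?b 2 y) = 0"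
        using s1(2)[of ?b] by blast
      have q: "upd ?b 2 y = vector [p $ 1, y, v]" by (simp add: vec_eq_iff forall_3)
      have yr: "norm y < r3" "norm y < R' / 2" using y(1) p(2) by (auto simp: r4_def)
      have qX: "vector [p $ 1, y, v] \<in> X" using y(2) q by (simp add: mem_X_iff)
      have "norm (vector [p $ 1, y, v] - p) < R'"
        using slice_point_norm(1)[OF p(2) pX(3), of y v] yr v by (simp add: s'_def)
      then have qR: "vector [p $ 1, y, v] \<in> ball p R'" by (simp add: dist_norm norm_minus_commute)
      have "k * norm y ^ m \<le> norm (G y)" using order yr by simp
      also have "\<dots> \<le> 3 * \<epsilon> * norm v" using qX qR R' by (intro compare) auto
      finally have "norm y ^ m \<le> 3 * \<epsilon> / k * norm v" using k by (simp add: field_simps)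
      also have "\<dots> \<le> K * norm v" by (intro mult_right_mono) (auto simp: K_def)
      finally show "\<exists>y. vector [p $ 1, y, v] \<in> X \<inter> ball p R \<and> norm y ^ m \<le> K * norm v"
        using qX qR R' by (intro exI[of _ y]) auto
    qed
    show "\<forall>y. norm y < s' \<longrightarrow> (\<exists>v. vector [p $ 1, y, v] \<in> X \<inter> ball p R \<and> norm v \<le> K * norm y ^ m)"
    proof (intro allI impI)
      fix y :: complex assume y: "norm y < s'"
      then obtain v where v: "vector [p $ 1, y, v] \<in> X \<inter> ball p R'" using lift[of y] by (auto simp: s'_def)
      have "\<epsilon> * norm v \<le> norm (G y)" using v R' by (intro compare) auto
      also have "\<dots> \<le> 3 * k * norm y ^ m" using order y by (simp add: s'_def)
      finally have "norm v \<le> 3 * k / \<epsilon> * norm y ^ m" using \<epsilon>(1) by (simp add: field_simps)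
      also have "\<dots> \<le> K * norm y ^ m" by (intro mult_right_mono) (auto simp: K_def)
      finally show "\<exists>v. vector [p $ 1, y, v] \<in> X \<inter> ball p R \<and> norm v \<le> K * norm y ^ m"
        using v R' by (intro exI[of _ v]) auto
    qed
  qed
qed

text \<open>At a point of the \<open>x\<close>-axis the Euler relation reduces to its first term and
  forces \<open>c $ 1 = 0\<close>. If \<open>c $ 2 \<noteq> 0\<close> the slice is transversal and
  \<open>m = 1\<close>; otherwise only \<open>c $ 3\<close> remains and the slice is tangent to
  \<open>z = 0\<close>.\<close>

lemma axis_slice:
  assumes p: "p \<in> punctured_curve" "p $ 2 = 0" and R: "0 < R"
  obtains m K s where "1 \<le> m" "0 < K" "0 < s"
    "\<forall>v. norm v < s \<longrightarrow> (\<exists>y. vector [p $ 1, y, v] \<in> X \<inter> ball p R \<and> norm y ^ m \<le> K * norm v)"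
    "m = 1 \<or> (\<forall>y. norm y < s \<longrightarrow> (\<exists>v. vector [p $ 1, y, v] \<in> X \<inter> ball p R \<and> norm v \<le> K * norm y ^ m))"
proof -
  note pX = axis_point[OF p]
  obtain g c where g: "g \<in> vanishing_polys X" "c \<noteq> 0" "has_strict_gradient (cpoly_eval g) c p"
    "(\<Sum>j\<in>UNIV. c $ j * (of_nat (w j) * p $ j)) = 0"
    by (rule smooth_point_gradient[OF pX(1,2)]) (rule that)
  have c1: "c $ 1 = 0" using g(4) pX p(2) w_pos[of 1] by (simp add: sum_3)
  show ?thesis
  proof (cases "c $ 2 = 0")
    case True
    then have "c $ 3 \<noteq> 0" using c1 g(2) by (auto simp: vec_eq_iff forall_3)
    show ?thesis
      by (rule axis_slice_tangential[OF p R g(1,3) c1 True \<open>c $ 3 \<noteq> 0\<close>]) (rule that, assumption+, erule disjI2)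
  next
    case False
    obtain K s where "0 < K" "0 < s"
      "\<forall>v. norm v < s \<longrightarrow> (\<exists>y. vector [p $ 1, y, v] \<in> X \<inter> ball p R \<and> norm y \<le> K * norm v)"
      by (rule axis_slice_transversal[OF p R g(1,3) False]) (rule that)
    then show ?thesis using that[of 1 K s] by simp
  qed
qed

text \<open>The cone is projected to the \<open>(x, z)\<close>- or the \<open>(x, y)\<close>-plane according to which of the two
  remaining coordinates is the smaller one: on the slice \<open>y ^ m\<close> has the size of \<open>z\<close>, hence on the
  cone \<open>\<bar>y\<bar> \<le> \<bar>x\<bar>\<close> where \<open>\<bar>z\<bar> = \<bar>x\<bar>\<close> iff \<open>m * (w 1 - w 2) \<le> w 1 - w 3\<close>, up to constants.\<close>

lemma lower_density_cone_axis:
  assumes p: "p \<in> punctured_curve" "p $ 2 = 0" and R: "0 < R" and \<tau>: "0 < \<tau>"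
  shows "0 < lower_density 4 (cone_over \<tau> (X \<inter> ball p R)) 0"
proof -
  note pX = axis_point[OF p]
  obtain m K s where m: "1 \<le> m" "0 < K" "0 < s"
    and lift_z: "\<forall>v. norm v < s \<longrightarrow> (\<exists>y. vector [p $ 1, y, v] \<in> X \<inter> ball p R \<and> norm y ^ m \<le> K * norm v)"
    and lift_y: "m = 1 \<or> (\<forall>y. norm y < s \<longrightarrow> (\<exists>v. vector [p $ 1, y, v] \<in> X \<inter> ball p R \<and> norm v \<le> K * norm y ^ m))"
    by (rule axis_slice[OF p R]) (rule that)
  define N where "N = norm (p $ 1)"
  have N: "0 < N" using pX by (simp add: N_def)
  show ?thesis
  proof (cases "m * w 1 + w 3 \<le> w 1 + m * w 2")
    case True
    \<comment> \<open>Adding 1 gives \<open>K * N \<le> ?C \<le> ?C ^ m\<close>, so that the bound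
      on an \<open>m\<close>-th power can be rooted with the same constant.\<close>
    let ?C = "K * N + 1"
    have C: "1 \<le> ?C" using m N by simp
    show ?thesis
    proof (rule lower_density_cone_via_slice[where i = 2 and j = 1 and k = 3 and p = p and s = s and C = ?C])
      fix l z :: complex
      assume l: "l \<noteq> 0" "norm l \<le> 1" and z: "norm z < s" "norm z \<le> norm l ^ w 1 / norm l ^ w 3 * norm (p $ 1)"
      have l1: "0 < norm l" using l(1) by simp
      obtain y where y: "vector [p $ 1, y, z] \<in> X \<inter> ball p R" "norm y ^ m \<le> K * norm z"
        using lift_z z(1) by blast
      have "(norm l ^ w 2 * norm y) ^ m = norm l ^ (m * w 2) * norm y ^ m"
        by (simp add: power_mult_distrib mult.commute flip: power_mult)
      also have "\<dots> \<le> norm l ^ (m * w 2) * (K * norm z)" using y by (intro mult_left_mono) auto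
      also have "\<dots> \<le> norm l ^ (m * w 2) * (K * (norm l ^ w 1 / norm l ^ w 3 * N))"
        using z(2) m by (intro mult_left_mono) (auto simp: N_def)
      also have "\<dots> = K * N * (norm l ^ (w 1 + m * w 2) / norm l ^ w 3)" by (simp add: power_add)
      also have "\<dots> \<le> K * N * norm l ^ (m * w 1)"
      proof -
        have "norm l ^ (w 1 + m * w 2) \<le> norm l ^ (m * w 1 + w 3)"
          using True l by (intro power_decreasing) auto
        then have "norm l ^ (w 1 + m * w 2) / norm l ^ w 3 \<le> norm l ^ (m * w 1)"
          using l1 by (simp add: power_add divide_le_eq)
        then show ?thesis using m N by (intro mult_left_mono) auto
      qed
      also have "\<dots> \<le> ?C ^ m * norm l ^ (m * w 1)"
      proof -
        have "?C ^ 1 \<le> ?C ^ m" using C m(1) by (intro power_increasing)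
        then show ?thesis by (intro mult_right_mono) auto
      qed
      also have "\<dots> = (?C * norm l ^ w 1) ^ m"
        by (simp add: power_mult_distrib mult.commute flip: power_mult)
      finally have "norm l ^ w 2 * norm y \<le> ?C * norm l ^ w 1"
        using C m(1) by (subst (asm) power_mono_iff) auto
      then show "\<exists>q\<in>X \<inter> ball p R. q $ 1 = p $ 1 \<and> q $ 3 = z \<and> norm l ^ w 2 * norm (q $ 2) \<le> ?C * norm l ^ w 1"
        using y(1) by (intro bexI[of _ "vector [p $ 1, y, z]"]) auto
    qed (use m \<tau> C w12 w23 pX exhaust_3 in auto)
  next
    case False
    \<comment> \<open>For \<open>m = 1\<close> the case condition reads
      \<open>w 3 \<le> w 2\<close>, and for \<open>w 1 = w 2\<close> it reads
      \<open>w 3 \<le> w 1\<close>. Both hold, so here the lift over \<open>y\<close> is available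
      and \<open>w 2 < w 1\<close>, as the projection to \<open>(x, y)\<close> requires.\<close>
    then have "m \<noteq> 1" using w23 w12 by auto
    then have lift_y: "\<forall>y. norm y < s \<longrightarrow> (\<exists>v. vector [p $ 1, y, v] \<in> X \<inter> ball p R \<and> norm v \<le> K * norm y ^ m)"
      using lift_y by blast
    have w: "w 2 < w 1"
      using False w12 w23 by (cases "w 1 = w 2") auto
    let ?C = "K * N ^ m"
    have C: "0 < ?C" using m N by simp
    show ?thesis
    proof (rule lower_density_cone_via_slice[where i = 3 and j = 1 and k = 2 and p = p and s = s and C = ?C])
      fix l y :: complex
      assume l: "l \<noteq> 0" "norm l \<le> 1" and y: "norm y < s" "norm y \<le> norm l ^ w 1 / norm l ^ w 2 * norm (p $ 1)"
      have l1: "0 < norm l" using l(1) by simp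
      obtain z where z: "vector [p $ 1, y, z] \<in> X \<inter> ball p R" "norm z \<le> K * norm y ^ m"
        using lift_y y(1) by blast
      have "norm y ^ m \<le> (norm l ^ w 1 / norm l ^ w 2 * N) ^ m" using y(2) by (intro power_mono) (auto simp: N_def)
      then have "K * norm y ^ m \<le> K * (norm l ^ w 1 / norm l ^ w 2 * N) ^ m"
        using m by (intro mult_left_mono) auto
      then have "norm l ^ w 3 * norm z \<le> norm l ^ w 3 * (K * (norm l ^ w 1 / norm l ^ w 2 * N) ^ m)"
        using z(2) by (intro mult_left_mono) auto
      also have "\<dots> = ?C * (norm l ^ (m * w 1 + w 3) / norm l ^ (m * w 2))"
        by (simp add: power_add power_mult_distrib power_divide mult.commute flip: power_mult)
      also have "\<dots> \<le> ?C * norm l ^ w 1"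
      proof -
        have "norm l ^ (m * w 1 + w 3) \<le> norm l ^ (w 1 + m * w 2)"
          using False l by (intro power_decreasing) auto
        then have "norm l ^ (m * w 1 + w 3) / norm l ^ (m * w 2) \<le> norm l ^ w 1"
          using l1 by (simp add: power_add divide_le_eq)
        then show ?thesis using C by (intro mult_left_mono) auto
      qed
      finally show "\<exists>q\<in>X \<inter> ball p R. q $ 1 = p $ 1 \<and> q $ 2 = y \<and> norm l ^ w 3 * norm (q $ 3) \<le> ?C * norm l ^ w 1"
        using z(1) by (intro bexI[of _ "vector [p $ 1, y, z]"]) auto
    qed (use m \<tau> C w pX exhaust_3 in auto)
  qed
qed

lemma lower_density_cone:
  assumes "p \<in> punctured_curve" "0 < R" "0 < \<tau>"
  shows "0 < lower_density 4 (cone_over \<tau> (X \<inter> ball p R)) 0"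
  using lower_density_cone_generic[of p R \<tau>] lower_density_cone_axis[of p R \<tau>] assms by blast

end

section \<open>Dimension of the surface\<close>

lemma hausdorff_measure_singleton:
  assumes "0 < s"
  shows "hausdorff_measure s {x} = 0"
proof -
  have "hausdorff_premeasure s \<delta> {x} \<le> 0" if "\<delta> > 0" for \<delta>
    using hausdorff_premeasure_finite_cover[of "{()}" "{x}" "\<lambda>_. {x}" 0 \<delta> s] that assms by simp
  then show ?thesis
    unfolding hausdorff_measure_def by (auto intro!: antisym SUP_least)
qed

lemma complement_singleton_3:
  fixes i :: 3
  obtains j k where "j \<noteq> k" "i \<noteq> j" "i \<noteq> k" "UNIV - {i} = {j, k}"
proof -
  consider "i = 1" | "i = 2" | "i = 3" using exhaust_3[of i] by blast
  then show ?thesis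
  proof cases
    case 1
    then have "UNIV - {i} = {2, 3}" using exhaust_3 by auto
    then show ?thesis using that[of 2 3] 1 by simp
  next
    case 2
    then have "UNIV - {i} = {1, 3}" using exhaust_3 by auto
    then show ?thesis using that[of 1 3] 2 by simp
  next
    case 3
    then have "UNIV - {i} = {1, 2}" using exhaust_3 by auto
    then show ?thesis using that[of 1 2] 3 by simp
  qed
qed

text \<open>The real and imaginary parts of the two free coordinates are four coordinates that
  control distances on the chart.\<close>

lemma graph_chart_null:
  fixes X :: "(complex ^ 3) set"
  assumes gc: "graph_chart X a i r s L" and t: "4 < t"
  shows "hausdorff_measure t (X \<inter> poly_box a i r s) = 0"
proof -
  obtain j k where jk: "j \<noteq> k" "i \<noteq> j" "i \<noteq> k" "UNIV - {i} = {j, k}" by (rule complement_singleton_3)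
  have s: "0 < s" and L: "0 \<le> L" using gc by (auto simp: graph_chart_def)
  define q where "q b n = (if n = 0 then Re (b $ j - a $ j) else if n = 1 then Im (b $ j - a $ j)
      else if n = 2 then Re (b $ k - a $ k) else Im (b $ k - a $ k))" for b :: "complex ^ 3" and n :: nat
  \<comment> \<open>Maps the range between \<open>-s\<close> and \<open>s\<close> onto the unit
    interval; the factor \<open>2 * s\<close> in the side lengths undoes the rescaling.\<close>
  define u where "u b n = (q b n / s + 1) / 2" for b n
  show ?thesis
  proof (rule hausdorff_measure_coordinates_eq_0[where k = 4 and L = "\<lambda>_. 2 * s * (1 + L)" and u = u])
    show "real 4 < t" using t by simp
    show "0 < 2 * s * (1 + L)" using s L by simp
    show "u b n \<in> {0..1}" if b: "b \<in> X \<inter> poly_box a i r s" for b n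
    proof -
      have "norm (b $ j - a $ j) < s" "norm (b $ k - a $ k) < s"
        using b jk by (auto simp: poly_box_def)
      then have "\<bar>q b n\<bar> \<le> s"
        using abs_Re_le_cmod[of "b $ j - a $ j"] abs_Im_le_cmod[of "b $ j - a $ j"]
          abs_Re_le_cmod[of "b $ k - a $ k"] abs_Im_le_cmod[of "b $ k - a $ k"]
        unfolding q_def by (auto split: if_splits)
      then have "-1 \<le> q b n / s" "q b n / s \<le> 1" using s by (auto simp: field_simps)
      then show ?thesis by (simp add: u_def)
    qed
    show "dist b b' \<le> (\<Sum>n<4. 2 * s * (1 + L) * \<bar>u b n - u b' n\<bar>)"
      if b: "b \<in> X \<inter> poly_box a i r s" "b' \<in> X \<inter> poly_box a i r s" for b b'
    proof -
      let ?S = "norm (b $ j - b' $ j) + norm (b $ k - b' $ k)"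
      have sum: "(\<Sum>n\<in>UNIV. F n) = F i + F j + F k" for F :: "3 \<Rightarrow> real"
        using sum.remove[of UNIV i F] jk by simp
      have "norm (b $ i - b' $ i) \<le> L * ?S"
        using gc b jk(1,4) unfolding graph_chart_def by fastforce
      then have "dist b b' \<le> (1 + L) * ?S"
        using norm_le_sum_components[of "b - b'"] by (simp add: sum dist_norm algebra_simps)
      also have "\<dots> \<le> (1 + L) * (\<Sum>n<4. \<bar>q b n - q b' n\<bar>)"
      proof (rule mult_left_mono)
        have "(\<Sum>n<4. \<bar>q b n - q b' n\<bar>) = \<bar>Re (b $ j - b' $ j)\<bar> + \<bar>Im (b $ j - b' $ j)\<bar>
            + \<bar>Re (b $ k - b' $ k)\<bar> + \<bar>Im (b $ k - b' $ k)\<bar>"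
          by (simp add: q_def eval_nat_numeral)
        then show "?S \<le> (\<Sum>n<4. \<bar>q b n - q b' n\<bar>)"
          using cmod_le[of "b $ j - b' $ j"] cmod_le[of "b $ k - b' $ k"] by linarith
      qed (use L in simp)
      also have "\<dots> = (\<Sum>n<4. 2 * s * (1 + L) * \<bar>u b n - u b' n\<bar>)"
      proof -
        have "2 * s * (1 + L) * \<bar>u b n - u b' n\<bar> = (1 + L) * \<bar>q b n - q b' n\<bar>" for n
        proof -
          have "u b n - u b' n = (q b n - q b' n) / (2 * s)" by (simp add: u_def diff_divide_distrib add_divide_distrib)
          then show ?thesis using s by (simp add: abs_divide)
        qed
        then show ?thesis by (simp only: sum_distrib_left)
      qed
      finally show ?thesis .
    qed
  qed simp_all
qed

text \<open>By the Lindelof property countably many graph charts cover \<open>X - {0}\<close>, and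
  the origin is a null set.\<close>

lemma (in separated_surface) hausdorff_measure_null:
  assumes t: "4 < t"
  shows "hausdorff_measure t X = 0"
proof -
  define F where "F = {U. open U \<and> hausdorff_measure t (X \<inter> U) = 0}"
  obtain F' where F': "F' \<subseteq> F" "countable F'" "\<Union>F' = \<Union>F"
    by (rule Lindelof[of F]) (auto simp: F_def)
  have cover: "X \<subseteq> {0} \<union> \<Union>((\<lambda>U. X \<inter> U) ` F')"
  proof
    fix a assume a: "a \<in> X"
    show "a \<in> {0} \<union> \<Union>((\<lambda>U. X \<inter> U) ` F')"
    proof (cases "a = 0")
      case False
      obtain i r s L where gc: "graph_chart X a i r s L"
        by (rule smooth_point_graph_chart[OF a False zero_less_one])
      then have "a \<in> poly_box a i r s" by (auto simp: graph_chart_def poly_box_def)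
      moreover have "poly_box a i r s \<in> F"
        using graph_chart_null[OF gc t] by (simp add: F_def open_poly_box)
      ultimately have "a \<in> \<Union>F'" using F'(3) by blast
      then show ?thesis using a by blast
    qed simp
  qed
  have "hausdorff_measure t (\<Union>((\<lambda>U. X \<inter> U) ` F')) = 0"
    using F' by (intro hausdorff_measure_countable_Union_eq_0) (auto simp: F_def)
  then have "hausdorff_measure t ({0} \<union> \<Union>((\<lambda>U. X \<inter> U) ` F')) \<le> 0"
    using hausdorff_measure_Un_le[of t "{0 :: complex ^ 3}" "\<Union>((\<lambda>U. X \<inter> U) ` F')"]
      hausdorff_measure_singleton[of t "0 :: complex ^ 3"] t by simp
  then show ?thesis
    using hausdorff_measure_mono[OF cover, of t] by simp
qed

lemma lower_density_pos_imp_measure_nonzero: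
  assumes "0 < lower_density k V x"
  shows "hausdorff_measure (real k) V \<noteq> 0"
proof
  assume "hausdorff_measure (real k) V = 0"
  then have "hausdorff_measure (real k) (V \<inter> ball x \<epsilon>) = 0" for \<epsilon>
    using hausdorff_measure_mono[of "V \<inter> ball x \<epsilon>" V "real k"] by simp
  then have "density_ratio k V x = (\<lambda>_. 0)"
    by (simp add: density_ratio_def[abs_def])
  then show False using assms by (simp add: lower_density_def Liminf_const trivial_limit_at_right_real)
qed


section \<open>Cones over circles in the slice \<open>z = 1\<close>\<close>

lemma norm_cis_diff_le: "norm (cis a - cis b) \<le> \<bar>a - b\<bar>"
proof -
  have "cis a - cis b = cis b * (cis (a - b) - 1)"
    by (simp add: right_diff_distrib cis_mult)
  then have "norm (cis a - cis b) = norm (exp (\<i> * of_real (a - b)) - 1)"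
    by (simp add: norm_mult cis_conv_exp)
  also have "\<dots> = 2 * \<bar>sin ((a - b) / 2)\<bar>" by (rule dist_exp_i_1)
  also have "\<dots> \<le> 2 * \<bar>(a - b) / 2\<bar>" by (intro mult_left_mono abs_sin_x_le_abs_x) auto
  finally show ?thesis by simp
qed

lemma norm_power_diff_le:
  fixes l l' :: complex
  assumes "norm l \<le> \<tau>" "norm l' \<le> \<tau>" "0 < n"
  shows "norm (l ^ n - l' ^ n) \<le> real n * \<tau> ^ (n - 1) * norm (l - l')"
proof -
  have \<tau>: "0 \<le> \<tau>" using assms(1) norm_ge_zero order_trans by blast
  have "norm (l ^ Suc n - l' ^ Suc n) \<le> real (Suc n) * \<tau> ^ n * norm (l - l')" for n
  proof (induction n)
    case (Suc n)
    have "l ^ Suc (Suc n) - l' ^ Suc (Suc n) = l * (l ^ Suc n - l' ^ Suc n) + (l - l') * l' ^ Suc n"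
      by (simp add: algebra_simps)
    then have "norm (l ^ Suc (Suc n) - l' ^ Suc (Suc n))
        \<le> norm l * norm (l ^ Suc n - l' ^ Suc n) + norm (l - l') * norm l' ^ Suc n"
      using norm_triangle_ineq[of "l * (l ^ Suc n - l' ^ Suc n)" "(l - l') * l' ^ Suc n"]
      by (simp only: norm_mult norm_power)
    also have "\<dots> \<le> \<tau> * (real (Suc n) * \<tau> ^ n * norm (l - l')) + norm (l - l') * \<tau> ^ Suc n"
      using assms Suc.IH \<tau> by (intro add_mono mult_mono power_mono) auto
    finally show ?case by (simp add: algebra_simps)
  qed simp
  from this[of "n - 1"] show ?thesis using assms(3) by simp
qed

lemma closed_if_bounded_parts_closed:
  fixes S :: "'a::real_normed_vector set"
  assumes "\<And>r. 0 < r \<Longrightarrow> closed (S \<inter> cball 0 r)"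
  shows "closed S"
  unfolding closed_sequential_limits
proof (intro allI impI)
  fix x :: "nat \<Rightarrow> 'a" and l assume x: "(\<forall>n. x n \<in> S) \<and> x \<longlonglongrightarrow> l"
  then obtain r where r: "0 < r" "\<And>n. norm (x n) \<le> r"
    using convergent_imp_bounded[of x l] unfolding bounded_pos by auto
  have "l \<in> S \<inter> cball 0 r"
  proof (rule closed_sequentially[OF assms[OF r(1)]])
    show "x n \<in> S \<inter> cball 0 r" for n using x r(2) by (simp add: dist_norm)
    show "x \<longlonglongrightarrow> l" using x by blast
  qed
  then show "l \<in> S" by simp
qed

text \<open>A disc in the curve \<open>X \<inter> {z = 1}\<close>, parametrised by its coordinate
  \<open>j\<close>. The map is controlled up to the boundary circle, over which the separating set
  is built; \<open>\<gamma>_open\<close> makes the image of the open disc relatively open in the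
  curve.\<close>

locale slice_chart = separated_surface w f X for w f X +
  fixes j :: 3 and c :: complex and \<rho> :: real and \<gamma> :: "complex \<Rightarrow> complex ^ 3" and L :: real
  assumes j: "j \<noteq> 3" and \<rho>: "0 < \<rho>" and L: "0 \<le> L"
    and \<gamma>_mem: "\<And>\<zeta>. \<zeta> \<in> cball c \<rho> \<Longrightarrow> \<gamma> \<zeta> \<in> X"
    and \<gamma>_3: "\<And>\<zeta>. \<zeta> \<in> cball c \<rho> \<Longrightarrow> \<gamma> \<zeta> $ 3 = 1"
    and \<gamma>_j: "\<And>\<zeta>. \<zeta> \<in> cball c \<rho> \<Longrightarrow> \<gamma> \<zeta> $ j = \<zeta>"
    and \<gamma>_lipschitz: "\<And>\<zeta> \<zeta>'. \<zeta> \<in> cball c \<rho> \<Longrightarrow> \<zeta>' \<in> cball c \<rho> \<Longrightarrow> dist (\<gamma> \<zeta>) (\<gamma> \<zeta>') \<le> L * dist \<zeta> \<zeta>'"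
    and \<gamma>_open: "\<exists>O'. open O' \<and> X \<inter> {a. a $ 3 = 1} \<inter> O' = \<gamma> ` ball c \<rho>"

text \<open>If \<open>c $ 1\<close> and \<open>c $ 2\<close> both vanished, the Euler relation at
  \<open>q $ 3 = 1\<close> would give \<open>c $ 3 = 0\<close> too. Hence \<open>x\<close> or
  \<open>y\<close> can be solved for, leaving \<open>z\<close> among the free coordinates, where it
  is frozen at 1.\<close>

lemma (in separated_surface) slice_chart_exists:
  assumes q: "q \<in> X" "q $ 3 = 1"
  obtains j \<rho> \<gamma> L where "slice_chart w f X j (q $ j) \<rho> \<gamma> L" "q \<in> \<gamma> ` ball (q $ j) \<rho>"
proof -
  have "q \<noteq> 0" using q by auto
  obtain g c where g: "g \<in> vanishing_polys X" "c \<noteq> 0" "has_strict_gradient (cpoly_eval g) c q"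
    "(\<Sum>j\<in>UNIV. c $ j * (of_nat (w j) * q $ j)) = 0"
    by (rule smooth_point_gradient[OF q(1) \<open>q \<noteq> 0\<close>]) (rule that)
  have "c $ 1 \<noteq> 0 \<or> c $ 2 \<noteq> 0"
    using g(2,4) q(2) w_pos[of 3] by (auto simp: sum_3 vec_eq_iff forall_3)
  then obtain i j :: 3 where ij: "c $ i \<noteq> 0" "i \<noteq> 3" "j \<noteq> 3" "i \<noteq> j" "UNIV - {i} = {j, 3}"
  proof
    assume c: "c $ 1 \<noteq> 0"
    have "UNIV - {1 :: 3} = {2, 3}" using exhaust_3 by auto
    then show ?thesis using c that[of 1 2] by simp
  next
    assume c: "c $ 2 \<noteq> 0"
    have "UNIV - {2 :: 3} = {1, 3}" using exhaust_3 by auto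
    then show ?thesis using c that[of 2 1] by simp
  qed
  obtain r s L where gc: "graph_chart X q i r s L"
    by (rule graph_chart_exists[OF q(1) g(1,3) ij(1) zero_less_one])
  have rs: "0 < r" "0 < s" "0 \<le> L" using gc by (auto simp: graph_chart_def)
  obtain F where F: "\<And>b j. j \<noteq> i \<Longrightarrow> F b $ j = b $ j"
    "\<And>b. (\<And>j. j \<noteq> i \<Longrightarrow> norm (b $ j - q $ j) < s) \<Longrightarrow> F b \<in> X \<inter> poly_box q i r s"
    "\<And>b. b \<in> X \<inter> poly_box q i r s \<Longrightarrow> F b = b"
    "\<And>b b'. (\<And>j. j \<noteq> i \<Longrightarrow> norm (b $ j - q $ j) < s) \<Longrightarrow> (\<And>j. j \<noteq> i \<Longrightarrow> norm (b' $ j - q $ j) < s) \<Longrightarrow>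
       dist (F b) (F b') \<le> (1 + L) * (\<Sum>j\<in>UNIV - {i}. norm (b $ j - b' $ j))"
    by (rule graph_chart_section[OF gc]) blast
  \<comment> \<open>Half the chart radius, so that the closed disc stays inside the chart.\<close>
  define \<rho> where "\<rho> = s / 2"
  have \<rho>: "0 < \<rho>" "\<rho> < s" using rs by (auto simp: \<rho>_def)
  define \<gamma> where "\<gamma> \<zeta> = F (upd q j \<zeta>)" for \<zeta>
  have near: "norm (upd q j \<zeta> $ k - q $ k) < s" if "\<zeta> \<in> cball (q $ j) \<rho>" for \<zeta> k
    using that \<rho> rs by (auto simp: dist_norm norm_minus_commute)
  have dF: "dist (F b) (F b') \<le> (1 + L) * (norm (b $ j - b' $ j) + norm (b $ 3 - b' $ 3))"
    if "\<And>k. k \<noteq> i \<Longrightarrow> norm (b $ k - q $ k) < s" "\<And>k. k \<noteq> i \<Longrightarrow> norm (b' $ k - q $ k) < s" for b b'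
    using F(4)[OF that] ij by simp
  have \<gamma>: "\<gamma> \<zeta> \<in> X \<inter> poly_box q i r s" "\<gamma> \<zeta> $ 3 = 1" "\<gamma> \<zeta> $ j = \<zeta>" if "\<zeta> \<in> cball (q $ j) \<rho>" for \<zeta>
    using near[OF that] F(1,2) ij q(2) by (auto simp: \<gamma>_def)
  have retr: "\<gamma> (b $ j) = b" if b: "b \<in> X \<inter> poly_box q i r s" "b $ 3 = 1" "b $ j \<in> cball (q $ j) \<rho>" for b
  proof -
    have "dist (F (upd q j (b $ j))) (F b) \<le> (1 + L) * (norm (upd q j (b $ j) $ j - b $ j) + norm (upd q j (b $ j) $ 3 - b $ 3))"
      using near[OF b(3)] b(1) by (intro dF) (auto simp: poly_box_def)
    also have "\<dots> = 0" using ij b(2) q(2) by simp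
    finally show ?thesis using F(3)[OF b(1)] by (simp add: \<gamma>_def)
  qed
  show ?thesis
  proof (rule that[of j \<rho> \<gamma> "1 + L"])
    show "slice_chart w f X j (q $ j) \<rho> \<gamma> (1 + L)"
    proof unfold_locales
      show "dist (\<gamma> \<zeta>) (\<gamma> \<zeta>') \<le> (1 + L) * dist \<zeta> \<zeta>'"
        if z: "\<zeta> \<in> cball (q $ j) \<rho>" "\<zeta>' \<in> cball (q $ j) \<rho>" for \<zeta> \<zeta>'
        using dF[of "upd q j \<zeta>" "upd q j \<zeta>'"] near[OF z(1)] near[OF z(2)] ij by (simp add: \<gamma>_def dist_norm)
      let ?O = "poly_box q i r s \<inter> (\<lambda>b. b $ j) -` ball (q $ j) \<rho>"
      have "open ?O"
        by (intro open_Int open_poly_box open_vimage) (auto intro: continuous_intros)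
      moreover have "X \<inter> {a. a $ 3 = 1} \<inter> ?O = \<gamma> ` ball (q $ j) \<rho>"
      proof
        show "X \<inter> {a. a $ 3 = 1} \<inter> ?O \<subseteq> \<gamma> ` ball (q $ j) \<rho>"
        proof
          fix b assume b: "b \<in> X \<inter> {a. a $ 3 = 1} \<inter> ?O"
          then have "\<gamma> (b $ j) = b" by (intro retr) auto
          then show "b \<in> \<gamma> ` ball (q $ j) \<rho>" using b by (metis IntE image_eqI vimageE)
        qed
        show "\<gamma> ` ball (q $ j) \<rho> \<subseteq> X \<inter> {a. a $ 3 = 1} \<inter> ?O"
          using \<gamma> by force
      qed
      ultimately show "\<exists>O'. open O' \<and> X \<inter> {a. a $ 3 = 1} \<inter> O' = \<gamma> ` ball (q $ j) \<rho>" by blast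
    qed (use \<gamma> ij \<rho> rs in auto)
    have "q \<in> X \<inter> poly_box q i r s" using q rs by (auto simp: poly_box_def)
    then have "\<gamma> (q $ j) = q" using q(2) \<rho> by (intro retr) auto
    then show "q \<in> \<gamma> ` ball (q $ j) \<rho>" using \<rho> by (metis centre_in_ball image_eqI)
  qed
qed

text \<open>Moving \<open>q\<close> to \<open>q'\<close> leaves \<open>z = 1\<close> unchanged, so
  that displacement is scaled only by the powers for \<open>w 1\<close> and \<open>w 2\<close>; the
  larger factor for \<open>w 3\<close> meets only the change of \<open>l\<close>.\<close>

lemma (in separated_surface) dist_act_le:
  assumes l: "norm l \<le> \<tau>" "norm l' \<le> \<tau>"
    and q: "q $ 3 = 1" "q' $ 3 = 1" "norm q' \<le> M" "1 \<le> M"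
    and A: "\<tau> ^ w 1 \<le> A" "\<tau> ^ w 2 \<le> A" and B: "\<And>k. real (w k) * \<tau> ^ (w k - 1) \<le> B"
  shows "dist (act w l q) (act w l' q') \<le> 2 * A * dist q q' + 3 * B * M * norm (l - l')"
proof -
  have \<tau>: "0 \<le> \<tau>" using l(1) norm_ge_zero order_trans by blast
  have B0: "0 \<le> B" using B[of 1] \<tau> by (meson mult_nonneg_nonneg of_nat_0_le_iff order_trans zero_le_power)
  have pow: "norm (l ^ w k - l' ^ w k) \<le> B * norm (l - l')" for k
  proof -
    have "norm (l ^ w k - l' ^ w k) \<le> real (w k) * \<tau> ^ (w k - 1) * norm (l - l')"
      by (rule norm_power_diff_le[OF l w_pos])
    also have "\<dots> \<le> B * norm (l - l')" using B by (intro mult_right_mono) auto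
    finally show ?thesis .
  qed
  have comp: "norm (act w l q $ k - act w l' q' $ k) \<le> A * dist q q' + B * M * norm (l - l')"
    if A: "\<tau> ^ w k \<le> A" for k
  proof -
    have "act w l q $ k - act w l' q' $ k = l ^ w k * (q $ k - q' $ k) + (l ^ w k - l' ^ w k) * q' $ k"
      by (simp add: algebra_simps)
    then have "norm (act w l q $ k - act w l' q' $ k) \<le> norm l ^ w k * norm (q $ k - q' $ k) + norm (l ^ w k - l' ^ w k) * norm (q' $ k)"
      using norm_triangle_ineq[of "l ^ w k * (q $ k - q' $ k)" "(l ^ w k - l' ^ w k) * q' $ k"]
      by (simp only: norm_mult norm_power)
    also have "\<dots> \<le> A * dist q q' + (B * norm (l - l')) * M"
    proof (intro add_mono mult_mono)
      show "norm l ^ w k \<le> A" using power_mono[OF l(1), of "w k"] A by simp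
      show "0 \<le> A" using A \<tau> by (meson order_trans zero_le_power)
      show "norm (q $ k - q' $ k) \<le> dist q q'"
        using Finite_Cartesian_Product.norm_nth_le[of "q - q'" k] by (simp add: dist_norm)
      show "norm (q' $ k) \<le> M" using Finite_Cartesian_Product.norm_nth_le[of q' k] q(3) by linarith
    qed (use pow B0 in auto)
    finally show ?thesis by (simp add: mult_ac)
  qed
  have "norm (act w l q $ 3 - act w l' q' $ 3) \<le> B * M * norm (l - l')"
  proof -
    have "norm (act w l q $ 3 - act w l' q' $ 3) \<le> B * norm (l - l')" using pow[of 3] q by simp
    also have "\<dots> \<le> B * M * norm (l - l')" using B0 q(4) by (intro mult_right_mono) (auto simp: mult_le_cancel_left1)
    finally show ?thesis .
  qed
  moreover have "dist (act w l q) (act w l' q') \<le> norm (act w l q $ 1 - act w l' q' $ 1)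
      + norm (act w l q $ 2 - act w l' q' $ 2) + norm (act w l q $ 3 - act w l' q' $ 3)"
    using norm_le_3[of "act w l q - act w l' q'"] by (simp add: dist_norm)
  ultimately show ?thesis using comp[OF A(1)] comp[OF A(2)] by linarith
qed

section \<open>Cones over a disc in the slice and over its boundary circle\<close>

context slice_chart
begin

text \<open>The apex \<open>l = 0\<close> is kept here so that the set is closed and contains 0;
  \<open>disc_cone\<close> omits it in order to be relatively open in \<open>X\<close>.\<close>

definition circle_cone :: "(complex ^ 3) set" where
  "circle_cone = (\<lambda>(l, \<zeta>). act w l (\<gamma> \<zeta>)) ` (UNIV \<times> sphere c \<rho>)"

definition disc_cone :: "(complex ^ 3) set" where
  "disc_cone = (\<lambda>(l, \<zeta>). act w l (\<gamma> \<zeta>)) ` ({l. l \<noteq> 0} \<times> ball c \<rho>)"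

lemma circle_coneE:
  assumes "a \<in> circle_cone"
  obtains l \<zeta> where "\<zeta> \<in> sphere c \<rho>" "a = act w l (\<gamma> \<zeta>)"
  using assms unfolding circle_cone_def by auto

lemma circle_coneI: "\<zeta> \<in> sphere c \<rho> \<Longrightarrow> act w l (\<gamma> \<zeta>) \<in> circle_cone"
  unfolding circle_cone_def by (rule image_eqI[of _ _ "(l, \<zeta>)"]) auto

lemma disc_coneI: "l \<noteq> 0 \<Longrightarrow> \<zeta> \<in> ball c \<rho> \<Longrightarrow> act w l (\<gamma> \<zeta>) \<in> disc_cone"
  unfolding disc_cone_def by (rule image_eqI[of _ _ "(l, \<zeta>)"]) auto

lemma sphere_subset: "\<zeta> \<in> sphere c \<rho> \<Longrightarrow> \<zeta> \<in> cball c \<rho>"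
  by auto

lemma circle_cone_subset: "circle_cone \<subseteq> X"
  by (auto elim!: circle_coneE intro!: act_mem \<gamma>_mem)

lemma sphere_point: "c + of_real \<rho> * cis \<theta> \<in> sphere c \<rho>"
  using \<rho> by (simp add: dist_norm norm_mult)

lemma circle_cone_zero: "0 \<in> circle_cone"
proof -
  have "act w 0 (\<gamma> (c + of_real \<rho> * cis 0)) \<in> circle_cone"
    by (rule circle_coneI[OF sphere_point])
  then show ?thesis by simp
qed

lemma circle_cone_act: "a \<in> circle_cone \<Longrightarrow> act w m a \<in> circle_cone"
  by (erule circle_coneE) (simp add: circle_coneI)

lemma circle_cone_z_eq_0: "a \<in> circle_cone \<Longrightarrow> a $ 3 = 0 \<Longrightarrow> a = 0"
  by (erule circle_coneE) (auto simp: \<gamma>_3)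

lemma continuous_on_\<gamma>: "continuous_on (cball c \<rho>) \<gamma>"
  using L \<gamma>_lipschitz by (intro lipschitz_on_continuous_on lipschitz_onI) auto

text \<open>Since \<open>z = 1\<close> on the slice, a bound on the \<open>z\<close>-coordinate of a
  cone point bounds \<open>norm l\<close>; bounded parts are then parts of images of compact
  parameter sets.\<close>

lemma closed_cone_over_compact:
  assumes K: "compact K" "K \<subseteq> cball c \<rho>"
  shows "closed ((\<lambda>(l, \<zeta>). act w l (\<gamma> \<zeta>)) ` (UNIV \<times> K))" (is "closed ?S")
proof (rule closed_if_bounded_parts_closed)
  fix r :: real assume r: "0 < r"
  \<comment> \<open>From \<open>norm l ^ w 3 \<le> r\<close> follows \<open>norm l \<le> r\<close>
    once \<open>norm l > 1\<close>, hence the radius \<open>max 1 r\<close>.\<close>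
  let ?T = "(\<lambda>(l, \<zeta>). act w l (\<gamma> \<zeta>)) ` (cball 0 (max 1 r) \<times> K)"
  have "continuous_on (cball 0 (max 1 r) \<times> K) (\<lambda>x. act w (fst x) (\<gamma> (snd x)))"
    using K by (intro continuous_on_act continuous_on_fst continuous_on_snd continuous_on_id
        continuous_on_compose2[OF continuous_on_\<gamma>]) auto
  then have "compact ?T"
    using K(1) by (intro compact_continuous_image compact_Times compact_cball) (auto simp: case_prod_beta)
  moreover have "?S \<inter> cball 0 r = ?T \<inter> cball 0 r"
  proof
    show "?S \<inter> cball 0 r \<subseteq> ?T \<inter> cball 0 r"
    proof
      fix a assume a: "a \<in> ?S \<inter> cball 0 r"
      then obtain l \<zeta> where l: "\<zeta> \<in> K" "a = act w l (\<gamma> \<zeta>)" by auto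
      have "norm l ^ w 3 = norm (a $ 3)" using l K \<gamma>_3[of \<zeta>] by (auto simp: norm_power)
      then have le: "norm l ^ w 3 \<le> r"
        using a Finite_Cartesian_Product.norm_nth_le[of a 3] by simp
      have "norm l \<le> max 1 r"
      proof (cases "norm l \<le> 1")
        case False
        then have "norm l ^ 1 \<le> norm l ^ w 3" using w_pos[of 3] by (intro power_increasing) auto
        then show ?thesis using le by simp
      qed simp
      then have "a \<in> ?T" using l by (intro image_eqI[of _ _ "(l, \<zeta>)"]) auto
      then show "a \<in> ?T \<inter> cball 0 r" using a by blast
    qed
  qed auto
  ultimately show "closed (?S \<inter> cball 0 r)"
    by (simp add: compact_imp_closed closed_Int)
qed

lemma closed_circle_cone: "closed circle_cone"
  unfolding circle_cone_def by (intro closed_cone_over_compact) auto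

text \<open>Near \<open>a\<close> a continuous branch of the \<open>w 3\<close>-th root of
  \<open>z\<close> normalises points of \<open>X\<close> to \<open>z = 1\<close>, where
  \<open>\<gamma>_open\<close> applies.\<close>

lemma disc_cone_open:
  assumes a: "a \<in> disc_cone"
  obtains O' where "open O'" "a \<in> O'" "X \<inter> O' \<subseteq> disc_cone"
proof -
  obtain l \<zeta> where l: "l \<noteq> 0" "\<zeta> \<in> ball c \<rho>" "a = act w l (\<gamma> \<zeta>)"
    using a unfolding disc_cone_def by auto
  have \<gamma>3: "\<gamma> \<zeta> $ 3 = 1" using l(2) by (intro \<gamma>_3) auto
  obtain O1 where O1: "open O1" "X \<inter> {a. a $ 3 = 1} \<inter> O1 = \<gamma> ` ball c \<rho>"
    using \<gamma>_open by blast
  define U where "U = (\<lambda>b::complex^3. b $ 3 / l ^ w 3) -` (- \<real>\<^sub>\<le>\<^sub>0)"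
  \<comment> \<open>The branch with value \<open>l\<close> at \<open>a\<close>; on \<open>U\<close>
    the argument of \<open>Ln\<close> avoids the cut.\<close>
  define \<psi> where "\<psi> b = l * exp (Ln (b $ 3 / l ^ w 3) / of_nat (w 3))" for b :: "complex ^ 3"
  define \<Phi> where "\<Phi> b = act w (1 / \<psi> b) b" for b :: "complex ^ 3"
  have U: "open U"
    unfolding U_def using l(1)
    by (intro open_vimage) (auto intro!: continuous_intros simp: closed_nonpos_Reals_complex open_Compl)
  have \<psi>0: "\<psi> b \<noteq> 0" for b using l(1) by (simp add: \<psi>_def)
  have "continuous_on U (\<lambda>b. b $ 3 / l ^ w 3)"
    using l(1) by (intro continuous_intros) auto
  then have "continuous_on U \<psi>"
    unfolding \<psi>_def using l(1) w_pos[of 3]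
    by (intro continuous_intros) (auto simp: U_def)
  then have "continuous_on U \<Phi>"
    unfolding \<Phi>_def using \<psi>0 by (intro continuous_intros) auto
  then have "open (U \<inter> \<Phi> -` O1)"
    using U O1(1) by (rule continuous_open_preimage)
  moreover have "a \<in> U \<inter> \<Phi> -` O1"
  proof -
    have r1: "a $ 3 / l ^ w 3 = 1" using l \<gamma>3 by simp
    then have "\<psi> a = l" by (simp add: \<psi>_def)
    then have "\<Phi> a = \<gamma> \<zeta>" using l by (simp add: \<Phi>_def)
    moreover have "\<gamma> \<zeta> \<in> O1" using O1(2) l(2) by blast
    ultimately show ?thesis using r1 by (simp add: U_def)
  qed
  moreover have "X \<inter> (U \<inter> \<Phi> -` O1) \<subseteq> disc_cone"
  proof
    fix b assume b: "b \<in> X \<inter> (U \<inter> \<Phi> -` O1)"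
    then have nz: "b $ 3 / l ^ w 3 \<noteq> 0" using l(1) by (auto simp: U_def)
    have "\<psi> b ^ w 3 = b $ 3"
      using nz l(1) w_pos[of 3] by (simp add: \<psi>_def power_mult_distrib exp_of_nat_mult[symmetric])
    then have "\<Phi> b $ 3 = 1" using nz by (auto simp: \<Phi>_def power_divide)
    moreover have "\<Phi> b \<in> X" using b by (auto simp: \<Phi>_def intro: act_mem)
    ultimately have "\<Phi> b \<in> \<gamma> ` ball c \<rho>" using b O1(2) by blast
    then obtain \<xi> where \<xi>: "\<xi> \<in> ball c \<rho>" "\<Phi> b = \<gamma> \<xi>" by blast
    have "b = act w (\<psi> b) (\<gamma> \<xi>)" using \<psi>0[of b] by (simp add: \<Phi>_def flip: \<xi>(2))
    then show "b \<in> disc_cone" using disc_coneI[OF \<psi>0[of b] \<xi>(1)] by simp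
  qed
  ultimately show ?thesis using that by blast
qed

text \<open>\<open>disc_cone\<close> is relatively open in \<open>X\<close>, and \<open>disc_cone \<union> circle_cone\<close> is closed.\<close>

lemma connected_avoids_disc_cone:
  assumes E: "connected E" "E \<subseteq> X" "E \<inter> circle_cone = {}" and a: "a \<in> E" "a $ 3 = 0"
  shows "E \<inter> disc_cone = {}"
proof -
  let ?C = "(\<lambda>(l, \<zeta>). act w l (\<gamma> \<zeta>)) ` (UNIV \<times> cball c \<rho>)"
  have sub: "?C \<subseteq> disc_cone \<union> circle_cone"
  proof
    fix b assume "b \<in> ?C"
    then obtain l \<zeta> where b: "\<zeta> \<in> cball c \<rho>" "b = act w l (\<gamma> \<zeta>)" by auto
    show "b \<in> disc_cone \<union> circle_cone"
    proof (cases "l = 0 \<or> \<zeta> \<in> sphere c \<rho>")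
      case True
      then show ?thesis
        using b circle_cone_zero circle_coneI[of \<zeta> l] by auto
    next
      case False
      then have "l \<noteq> 0" "\<zeta> \<in> ball c \<rho>" using b by auto
      then show ?thesis using b(2) disc_coneI by blast
    qed
  qed
  have "disc_cone \<subseteq> ?C" unfolding disc_cone_def by (intro image_mono) auto
  \<comment> \<open>As \<open>E\<close> misses the circle cone, its trace on the relatively open
    disc cone equals its trace on a closed set, hence is clopen in \<open>E\<close>.\<close>
  then have eq: "E \<inter> disc_cone = E \<inter> ?C" using sub E(3) by blast
  have "closed ?C" by (rule closed_cone_over_compact) auto
  then have "closedin (top_of_set E) (E \<inter> disc_cone)"
    unfolding eq by (rule closedin_closed_Int)
  moreover have "openin (top_of_set E) (E \<inter> disc_cone)"
    unfolding openin_subopen[of _ "E \<inter> disc_cone"]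
  proof
    fix b assume b: "b \<in> E \<inter> disc_cone"
    then obtain O' where "open O'" "b \<in> O'" "X \<inter> O' \<subseteq> disc_cone"
      using disc_cone_open by blast
    then show "\<exists>T. openin (top_of_set E) T \<and> b \<in> T \<and> T \<subseteq> E \<inter> disc_cone"
      using b E(2) by (intro exI[of _ "E \<inter> O'"]) (auto intro: openin_open_Int)
  qed
  ultimately have "E \<inter> disc_cone = {} \<or> E \<inter> disc_cone = E"
    using E(1) unfolding connected_clopen by blast
  moreover have "a \<notin> disc_cone"
    using a(2) by (auto simp: disc_cone_def \<gamma>_3)
  ultimately show ?thesis using a(1) by blast
qed

lemma norm_\<gamma>_bound:
  obtains M where "1 \<le> M" "\<And>\<zeta>. \<zeta> \<in> cball c \<rho> \<Longrightarrow> norm (\<gamma> \<zeta>) \<le> M"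
proof -
  have "bounded (\<gamma> ` cball c \<rho>)"
    by (intro compact_imp_bounded compact_continuous_image continuous_on_\<gamma> compact_cball)
  then obtain M where "\<And>x. x \<in> \<gamma> ` cball c \<rho> \<Longrightarrow> norm x \<le> M" by (auto simp: bounded_iff)
  then show ?thesis by (intro that[of "max 1 M"]) (auto simp: le_max_iff_disj)
qed

lemma dist_circle_point_le:
  assumes l: "norm l \<le> \<tau>" "norm l' \<le> \<tau>"
    and M: "1 \<le> M" "\<And>\<zeta>. \<zeta> \<in> cball c \<rho> \<Longrightarrow> norm (\<gamma> \<zeta>) \<le> M"
    and A: "\<tau> ^ w 1 \<le> A" "\<tau> ^ w 2 \<le> A" and B: "\<And>k. real (w k) * \<tau> ^ (w k - 1) \<le> B"
  shows "dist (act w l (\<gamma> (c + of_real \<rho> * cis \<theta>))) (act w l' (\<gamma> (c + of_real \<rho> * cis \<theta>')))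
    \<le> 2 * A * (L + 1) * \<rho> * \<bar>\<theta> - \<theta>'\<bar> + 3 * B * M * norm (l - l')"
proof -
  let ?p = "\<lambda>\<theta>. c + of_real \<rho> * cis \<theta>"
  have p: "?p \<theta> \<in> cball c \<rho>" for \<theta> using sphere_point by (rule sphere_subset)
  have "0 \<le> \<tau>" using l(1) norm_ge_zero order_trans by blast
  then have A0: "0 \<le> A" using A(1) by (meson order_trans zero_le_power)
  have "dist (\<gamma> (?p \<theta>)) (\<gamma> (?p \<theta>')) \<le> L * dist (?p \<theta>) (?p \<theta>')"
    by (intro \<gamma>_lipschitz p)
  also have "dist (?p \<theta>) (?p \<theta>') = \<rho> * norm (cis \<theta> - cis \<theta>')"
    using \<rho> by (simp add: dist_norm norm_mult flip: right_diff_distrib)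
  \<comment> \<open>\<open>L + 1\<close> instead of \<open>L\<close>, because the side lengths in
    the covering estimates must be positive.\<close>
  also have "L * (\<rho> * norm (cis \<theta> - cis \<theta>')) \<le> (L + 1) * (\<rho> * \<bar>\<theta> - \<theta>'\<bar>)"
    using \<rho> L norm_cis_diff_le[of \<theta> \<theta>'] by (intro mult_mono) auto
  finally have "2 * A * dist (\<gamma> (?p \<theta>)) (\<gamma> (?p \<theta>')) \<le> 2 * A * ((L + 1) * (\<rho> * \<bar>\<theta> - \<theta>'\<bar>))"
    using A0 by (intro mult_left_mono) auto
  moreover have "dist (act w l (\<gamma> (?p \<theta>))) (act w l' (\<gamma> (?p \<theta>')))
      \<le> 2 * A * dist (\<gamma> (?p \<theta>)) (\<gamma> (?p \<theta>')) + 3 * B * M * norm (l - l')"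
    using M p by (intro dist_act_le[OF l _ _ _ _ A B] \<gamma>_3) auto
  ultimately show ?thesis by (simp add: mult.assoc)
qed

text \<open>The coordinates are \<open>Re l\<close>, \<open>Im l\<close> and the angle, rescaled to
  the unit interval. They are chosen pointwise, and the jump of the angle is harmless: the distance
  bound holds for every choice of parameters.\<close>

lemma circle_cone_coordinates:
  assumes \<tau>: "0 < \<tau>"
    and M: "1 \<le> M" "\<And>\<zeta>. \<zeta> \<in> cball c \<rho> \<Longrightarrow> norm (\<gamma> \<zeta>) \<le> M"
    and A: "\<tau> ^ w 1 \<le> A" "\<tau> ^ w 2 \<le> A" and B: "\<And>k. real (w k) * \<tau> ^ (w k - 1) \<le> B"
  obtains u :: "complex ^ 3 \<Rightarrow> nat \<Rightarrow> real" where
    "\<And>a i. a \<in> circle_cone \<inter> {a. norm (a $ 3) \<le> \<tau> ^ w 3} \<Longrightarrow> u a i \<in> {0..1}"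
    "\<And>a b. a \<in> circle_cone \<inter> {a. norm (a $ 3) \<le> \<tau> ^ w 3} \<Longrightarrow>
       b \<in> circle_cone \<inter> {a. norm (a $ 3) \<le> \<tau> ^ w 3} \<Longrightarrow>
       dist a b \<le> (\<Sum>i<3. (if i < 2 then 6 * B * M * \<tau> else 4 * pi * A * (L + 1) * \<rho>) * \<bar>u a i - u b i\<bar>)"
proof -
  let ?V = "circle_cone \<inter> {a. norm (a $ 3) \<le> \<tau> ^ w 3}"
  have ex: "\<exists>l \<theta>. a = act w l (\<gamma> (c + of_real \<rho> * cis \<theta>)) \<and> norm l \<le> \<tau> \<and> 0 \<le> \<theta> \<and> \<theta> \<le> 2 * pi"
    if a: "a \<in> ?V" for a
  proof -
    obtain l \<zeta> where l: "\<zeta> \<in> sphere c \<rho>" "a = act w l (\<gamma> \<zeta>)" using a by (auto elim: circle_coneE)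
    obtain r \<theta> :: real where r: "\<zeta> - c = of_real r * (of_real (cos \<theta>) + \<i> * of_real (sin \<theta>))"
      "0 \<le> r" "0 \<le> \<theta>" "\<theta> < 2 * pi"
      by (rule complex_split_polar)
    have "\<zeta> - c = of_real r * cis \<theta>" using r(1) by (simp add: complex_eq_iff)
    moreover from this have "norm (\<zeta> - c) = r" using r(2) by (simp add: norm_mult)
    ultimately have \<zeta>: "\<zeta> = c + of_real \<rho> * cis \<theta>"
      using l(1) by (simp add: dist_norm norm_minus_commute algebra_simps)
    have "norm l ^ w 3 \<le> \<tau> ^ w 3" using a l \<gamma>_3[OF sphere_subset[OF l(1)]] by (simp add: norm_power)
    then have "norm l \<le> \<tau>" using \<tau> w_pos[of 3] by (simp add: power_mono_iff)
    then show ?thesis using l(2) \<zeta> r by (intro exI[of _ l] exI[of _ \<theta>]) auto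
  qed
  then obtain l \<theta> where l\<theta>: "\<And>a. a \<in> ?V \<Longrightarrow> a = act w (l a) (\<gamma> (c + of_real \<rho> * cis (\<theta> a)))"
    "\<And>a. a \<in> ?V \<Longrightarrow> norm (l a) \<le> \<tau>" "\<And>a. a \<in> ?V \<Longrightarrow> 0 \<le> \<theta> a \<and> \<theta> a \<le> 2 * pi"
    by metis
  define u where "u a i = (if i = 0 then (Re (l a) / \<tau> + 1) / 2 else if i = 1 then (Im (l a) / \<tau> + 1) / 2
      else \<theta> a / (2 * pi))" for a and i :: nat
  show ?thesis
  proof (rule that[of u])
    show "u a i \<in> {0..1}" if a: "a \<in> ?V" for a i
    proof -
      have "\<bar>Re (l a)\<bar> \<le> \<tau>" "\<bar>Im (l a)\<bar> \<le> \<tau>"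
        using l\<theta>(2)[OF a] abs_Re_le_cmod[of "l a"] abs_Im_le_cmod[of "l a"] by linarith+
      then have "-1 \<le> Re (l a) / \<tau>" "Re (l a) / \<tau> \<le> 1" "-1 \<le> Im (l a) / \<tau>" "Im (l a) / \<tau> \<le> 1"
        using \<tau> by (auto simp: field_simps)
      moreover have "0 \<le> \<theta> a / (2 * pi)" "\<theta> a / (2 * pi) \<le> 1"
        using l\<theta>(3)[OF a] by (auto simp: field_simps)
      ultimately show ?thesis by (simp add: u_def)
    qed
    show "dist a b \<le> (\<Sum>i<3. (if i < 2 then 6 * B * M * \<tau> else 4 * pi * A * (L + 1) * \<rho>) * \<bar>u a i - u b i\<bar>)"
      if ab: "a \<in> ?V" "b \<in> ?V" for a b
    proof -
      have B0: "0 \<le> B" using B[of 1] \<tau> by (meson less_imp_le mult_nonneg_nonneg of_nat_0_le_iff order_trans zero_le_power)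
      have d0: "\<bar>Re (l a - l b)\<bar> = 2 * \<tau> * \<bar>u a 0 - u b 0\<bar>"
      proof -
        have "u a 0 - u b 0 = Re (l a - l b) / (2 * \<tau>)" by (simp add: u_def diff_divide_distrib add_divide_distrib)
        then show ?thesis using \<tau> by (simp add: abs_divide)
      qed
      have d1: "\<bar>Im (l a - l b)\<bar> = 2 * \<tau> * \<bar>u a 1 - u b 1\<bar>"
      proof -
        have "u a 1 - u b 1 = Im (l a - l b) / (2 * \<tau>)" by (simp add: u_def diff_divide_distrib add_divide_distrib)
        then show ?thesis using \<tau> by (simp add: abs_divide)
      qed
      have d2: "\<bar>\<theta> a - \<theta> b\<bar> = 2 * pi * \<bar>u a 2 - u b 2\<bar>"
      proof -
        have "u a 2 - u b 2 = (\<theta> a - \<theta> b) / (2 * pi)" by (simp add: u_def diff_divide_distrib)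
        then show ?thesis by (simp add: abs_divide)
      qed
      have "dist a b \<le> 2 * A * (L + 1) * \<rho> * \<bar>\<theta> a - \<theta> b\<bar> + 3 * B * M * norm (l a - l b)"
        using dist_circle_point_le[OF l\<theta>(2)[OF ab(1)] l\<theta>(2)[OF ab(2)] M A B, of "\<theta> a" "\<theta> b"]
          l\<theta>(1)[OF ab(1)] l\<theta>(1)[OF ab(2)] by simp
      also have "\<dots> \<le> 2 * A * (L + 1) * \<rho> * \<bar>\<theta> a - \<theta> b\<bar> + 3 * B * M * (\<bar>Re (l a - l b)\<bar> + \<bar>Im (l a - l b)\<bar>)"
        using B0 M(1) cmod_le[of "l a - l b"] by (intro add_left_mono mult_left_mono) auto
      also have "\<dots> = (\<Sum>i<3. (if i < 2 then 6 * B * M * \<tau> else 4 * pi * A * (L + 1) * \<rho>) * \<bar>u a i - u b i\<bar>)"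
      proof -
        have "(\<Sum>i<3. F i) = F 0 + F 1 + F 2" for F :: "nat \<Rightarrow> real" by (simp add: eval_nat_numeral)
        then show ?thesis unfolding d0 d1 d2 by (simp add: algebra_simps)
      qed
      finally show ?thesis .
    qed
  qed
qed


section \<open>Measure and rectifiability of the cone over a circle\<close>

definition weight_sum :: real where "weight_sum = real (w 1 + w 2 + w 3)"

lemma weight_sum_pos: "0 < weight_sum"
  using w_pos[of 1] by (simp add: weight_sum_def)

lemma w_le_weight_sum: "real (w k) \<le> weight_sum"
  using exhaust_3[of k] by (auto simp: weight_sum_def)

lemma w_bounds: "w 3 \<le> w k" "w k \<le> w 1"
  using exhaust_3[of k] w12 w23 by auto

text \<open>The two directions of \<open>l\<close> have extent of order \<open>\<tau> ^ w 3\<close>,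
  and the circle has extent of order \<open>\<tau> ^ w 2\<close>; the product of the three is the
  bound.\<close>

lemma circle_cone_measure_le:
  obtains K where "0 \<le> K" "\<And>\<tau>. 0 < \<tau> \<Longrightarrow> \<tau> \<le> 1 \<Longrightarrow>
    hausdorff_measure 3 (circle_cone \<inter> {a. norm (a $ 3) \<le> \<tau> ^ w 3}) \<le> ennreal (K * \<tau> ^ (2 * w 3 + w 2))"
proof -
  obtain M where M: "1 \<le> M" "\<And>\<zeta>. \<zeta> \<in> cball c \<rho> \<Longrightarrow> norm (\<gamma> \<zeta>) \<le> M"
    by (rule norm_\<gamma>_bound) blast
  define K0 where "K0 = 3 ^ 3 * unit_ball_vol 3 * (3 / 2) ^ 3"
  define K where "K = K0 * ((6 * weight_sum * M)\<^sup>2 * (4 * pi * (L + 1) * \<rho>))"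
  have "0 \<le> K0" by (simp add: K0_def)
  then have K: "0 \<le> K" using \<rho> L by (simp add: K_def)
  have "hausdorff_measure 3 (circle_cone \<inter> {a. norm (a $ 3) \<le> \<tau> ^ w 3}) \<le> ennreal (K * \<tau> ^ (2 * w 3 + w 2))"
    if \<tau>: "0 < \<tau>" "\<tau> \<le> 1" for \<tau>
  proof -
    define A where "A = \<tau> ^ w 2"
    \<comment> \<open>For \<open>\<tau> \<le> 1\<close> the smallest exponent dominates:
      \<open>w 3\<close> among all weights here, and \<open>w 2\<close> among the first two in
      \<open>A\<close>.\<close>
    define B where "B = weight_sum * \<tau> ^ (w 3 - 1)"
    define V where "V = circle_cone \<inter> {a. norm (a $ 3) \<le> \<tau> ^ w 3}"
    have A: "\<tau> ^ w 1 \<le> A" "\<tau> ^ w 2 \<le> A" using \<tau> w12 by (auto simp: A_def intro: power_decreasing)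
    have B: "real (w k) * \<tau> ^ (w k - 1) \<le> B" for k
      unfolding B_def using \<tau> w_le_weight_sum w_bounds(1)[of k] weight_sum_pos
      by (intro mult_mono power_decreasing diff_le_mono) auto
    have pos: "0 < A" "0 < B" using \<tau> weight_sum_pos by (auto simp: A_def B_def)
    obtain u :: "complex ^ 3 \<Rightarrow> nat \<Rightarrow> real" where u: "\<And>a i. a \<in> V \<Longrightarrow> u a i \<in> {0..1}"
      "\<And>a b. a \<in> V \<Longrightarrow> b \<in> V \<Longrightarrow>
       dist a b \<le> (\<Sum>i<3. (if i < 2 then 6 * B * M * \<tau> else 4 * pi * A * (L + 1) * \<rho>) * \<bar>u a i - u b i\<bar>)"
      using circle_cone_coordinates[OF \<tau>(1) M A B] unfolding V_def by blast
    have "hausdorff_measure (real 3) V \<le> ennreal (3 ^ 3 * unit_ball_vol (real 3) * (real 3 / 2) ^ 3 *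
        (\<Prod>i<(3::nat). if i < 2 then 6 * B * M * \<tau> else 4 * pi * A * (L + 1) * \<rho>))"
      by (rule hausdorff_measure_coordinates_le[where u = u]) (use u pos M \<tau> L \<rho> in auto)
    also have "(\<Prod>i<(3::nat). if i < 2 then 6 * B * M * \<tau> else 4 * pi * A * (L + 1) * \<rho>)
        = (6 * B * M * \<tau>)\<^sup>2 * (4 * pi * A * (L + 1) * \<rho>)"
      by (simp add: eval_nat_numeral)
    also have "6 * B * M * \<tau> = 6 * weight_sum * M * \<tau> ^ w 3"
    proof -
      have "\<tau> ^ w 3 = \<tau> ^ (w 3 - 1) * \<tau>" using w_pos[of 3] by (simp add: power_eq_if)
      then show ?thesis by (simp add: B_def)
    qed
    also have "3 ^ 3 * unit_ball_vol (real 3) * (real 3 / 2) ^ 3 * ((6 * weight_sum * M * \<tau> ^ w 3)\<^sup>2 * (4 * pi * A * (L + 1) * \<rho>))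
        = K * \<tau> ^ (2 * w 3 + w 2)"
    proof -
      have "(6 * weight_sum * M * \<tau> ^ w 3)\<^sup>2 = (6 * weight_sum * M)\<^sup>2 * \<tau> ^ (2 * w 3)"
        by (simp add: power_mult_distrib mult.commute flip: power_mult)
      then show ?thesis by (simp add: K_def K0_def A_def power_add)
    qed
    finally show ?thesis by (simp add: V_def)
  qed
  then show ?thesis using that K by blast
qed

text \<open>The cone is exhausted by its parts of bounded height. Now \<open>\<tau> \<ge> 1\<close>,
  so the bounds \<open>A\<close> and \<open>B\<close> use the largest weight
  \<open>w 1\<close>.\<close>

lemma circle_cone_null:
  assumes t: "3 < t"
  shows "hausdorff_measure t circle_cone = 0"
proof -
  obtain M where M: "1 \<le> M" "\<And>\<zeta>. \<zeta> \<in> cball c \<rho> \<Longrightarrow> norm (\<gamma> \<zeta>) \<le> M"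
    by (rule norm_\<gamma>_bound) blast
  define V where "V n = circle_cone \<inter> {a. norm (a $ 3) \<le> real (Suc n) ^ w 3}" for n
  have null: "hausdorff_measure t (V n) = 0" for n
  proof -
    define \<tau> where "\<tau> = real (Suc n)"
    have \<tau>: "1 \<le> \<tau>" by (simp add: \<tau>_def)
    define A where "A = \<tau> ^ w 1"
    define B where "B = weight_sum * \<tau> ^ (w 1 - 1)"
    have A: "\<tau> ^ w 1 \<le> A" "\<tau> ^ w 2 \<le> A" using \<tau> w12 by (auto simp: A_def intro: power_increasing)
    have B: "real (w k) * \<tau> ^ (w k - 1) \<le> B" for k
      unfolding B_def using \<tau> w_le_weight_sum w_bounds(2)[of k] weight_sum_pos
      by (intro mult_mono power_increasing diff_le_mono) auto
    have pos: "0 < A" "0 < B" "0 < \<tau>" using \<tau> weight_sum_pos by (auto simp: A_def B_def)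
    obtain u :: "complex ^ 3 \<Rightarrow> nat \<Rightarrow> real" where u: "\<And>a i. a \<in> V n \<Longrightarrow> u a i \<in> {0..1}"
      "\<And>a b. a \<in> V n \<Longrightarrow> b \<in> V n \<Longrightarrow>
       dist a b \<le> (\<Sum>i<3. (if i < 2 then 6 * B * M * \<tau> else 4 * pi * A * (L + 1) * \<rho>) * \<bar>u a i - u b i\<bar>)"
      using circle_cone_coordinates[OF pos(3) M A B] unfolding V_def \<tau>_def by blast
    show ?thesis
      by (rule hausdorff_measure_coordinates_eq_0[where k = 3 and u = u and L = "\<lambda>i. if i < 2 then 6 * B * M * \<tau> else 4 * pi * A * (L + 1) * \<rho>"])
        (use u pos M L \<rho> t in auto)
  qed
  have "circle_cone \<subseteq> (\<Union>n. V n)"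
  proof
    fix a assume a: "a \<in> circle_cone"
    obtain n where n: "norm (a $ 3) \<le> real n" using real_arch_simple by blast
    have "real n \<le> real (Suc n) ^ 1" by simp
    also have "\<dots> \<le> real (Suc n) ^ w 3" using w_pos[of 3] by (intro power_increasing) auto
    finally have "a \<in> V n" using a n by (simp add: V_def)
    then show "a \<in> (\<Union>n. V n)" by blast
  qed
  then have "hausdorff_measure t circle_cone \<le> hausdorff_measure t (\<Union>n. V n)"
    by (rule hausdorff_measure_mono)
  also have "hausdorff_measure t (\<Union>(range V)) = 0"
    using null by (intro hausdorff_measure_countable_Union_eq_0) auto
  finally show ?thesis by simp
qed

text \<open>The action is Lipschitz in \<open>l\<close> only on bounded sets, so \<open>Re l\<close>
  and \<open>Im l\<close> are clamped at \<open>n\<close>; the angle may range over all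
  reals.\<close>

lemma circle_cone_lipschitz_cover:
  obtains F :: "nat \<Rightarrow> (nat \<Rightarrow> real) \<Rightarrow> complex ^ 3"
    where "\<And>n. lipschitz_map 3 (F n)" "circle_cone \<subseteq> (\<Union>n. range (F n))"
proof -
  obtain M where M: "1 \<le> M" "\<And>\<zeta>. \<zeta> \<in> cball c \<rho> \<Longrightarrow> norm (\<gamma> \<zeta>) \<le> M"
    by (rule norm_\<gamma>_bound) blast
  define cl where "cl n x = max (- real n) (min (real n) x)" for n :: nat and x :: real
  define l where "l n u = Complex (cl n (u 0)) (cl n (u 1))" for n and u :: "nat \<Rightarrow> real"
  define F where "F n u = act w (l n u) (\<gamma> (c + of_real \<rho> * cis (u 2)))" for n and u :: "nat \<Rightarrow> real"
  show ?thesis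
  proof (rule that[of F])
    show "lipschitz_map 3 (F n)" for n
    proof -
      \<comment> \<open>The clamped \<open>l\<close> has norm at most \<open>2 * n\<close>; the
        extra 1 gives \<open>\<tau> \<ge> 1\<close> also for \<open>n = 0\<close>.\<close>
      define \<tau> where "\<tau> = 2 * real n + 1"
      have \<tau>: "1 \<le> \<tau>" by (simp add: \<tau>_def)
      define A where "A = \<tau> ^ w 1"
      define B where "B = weight_sum * \<tau> ^ (w 1 - 1)"
      have A: "\<tau> ^ w 1 \<le> A" "\<tau> ^ w 2 \<le> A" using \<tau> w12 by (auto simp: A_def intro: power_increasing)
      have B: "real (w k) * \<tau> ^ (w k - 1) \<le> B" for k
        unfolding B_def using \<tau> w_le_weight_sum w_bounds(2)[of k] weight_sum_pos
        by (intro mult_mono power_increasing diff_le_mono) auto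
      have pos: "0 < A" "0 < B" using \<tau> weight_sum_pos by (auto simp: A_def B_def)
      have l: "norm (l n u) \<le> \<tau>" for u
      proof -
        have "\<bar>cl n x\<bar> \<le> real n" for x by (auto simp: cl_def)
        then show ?thesis
          using cmod_le[of "l n u"] by (simp add: l_def \<tau>_def) (smt (verit))
      qed
      have ld: "norm (l n u - l n v) \<le> \<bar>u 0 - v 0\<bar> + \<bar>u 1 - v 1\<bar>" for u v
      proof -
        have "\<bar>cl n x - cl n y\<bar> \<le> \<bar>x - y\<bar>" for x y by (auto simp: cl_def)
        from add_mono[OF this this, of "u 0" "v 0" "u 1" "v 1"] show ?thesis
          using cmod_le[of "l n u - l n v"] by (simp add: l_def)
      qed
      define C1 where "C1 = 2 * A * (L + 1) * \<rho>"
      define C2 where "C2 = 3 * B * M"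
      have C: "0 \<le> C1" "0 \<le> C2" using pos L \<rho> M by (auto simp: C1_def C2_def)
      have "dist (F n u) (F n v) \<le> (C1 + 2 * C2) * L2_set (\<lambda>i. u i - v i) {..<3}" for u v
      proof -
        let ?N = "L2_set (\<lambda>i. u i - v i) {..<3}"
        have comp: "\<bar>u i - v i\<bar> \<le> ?N" if "i < 3" for i
          using member_le_L2_set[of "{..<3}" i "\<lambda>i. \<bar>u i - v i\<bar>"] that by (simp add: L2_set_def)
        have "dist (F n u) (F n v) \<le> C1 * \<bar>u 2 - v 2\<bar> + C2 * norm (l n u - l n v)"
          unfolding F_def C1_def C2_def by (rule dist_circle_point_le[OF l l M A B])
        also have "\<dots> \<le> C1 * ?N + C2 * (2 * ?N)"
        proof (intro add_mono mult_left_mono)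
          show "\<bar>u 2 - v 2\<bar> \<le> ?N" by (rule comp) simp
          show "norm (l n u - l n v) \<le> 2 * ?N"
            using ld[of u v] comp[of 0] comp[of 1] by simp
        qed (use C in auto)
        finally show ?thesis by (simp add: algebra_simps)
      qed
      then show ?thesis unfolding lipschitz_map_def by blast
    qed
    show "circle_cone \<subseteq> (\<Union>n. range (F n))"
    proof
      fix a assume "a \<in> circle_cone"
      then obtain m \<zeta> where a: "\<zeta> \<in> sphere c \<rho>" "a = act w m (\<gamma> \<zeta>)" by (rule circle_coneE)
      obtain n where n: "norm m \<le> real n" using real_arch_simple by blast
      define u where "u i = (if i = 0 then Re m else if i = 1 then Im m else Arg (\<zeta> - c))" for i :: nat
      have "cl n (Re m) = Re m" "cl n (Im m) = Im m"
        using n abs_Re_le_cmod[of m] abs_Im_le_cmod[of m] by (auto simp: cl_def)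
      then have "l n u = m" by (simp add: l_def u_def)
      moreover have "c + of_real \<rho> * cis (u 2) = \<zeta>"
      proof -
        have "norm (\<zeta> - c) = \<rho>" using a(1) by (simp add: dist_norm norm_minus_commute)
        then have "of_real \<rho> * cis (Arg (\<zeta> - c)) = \<zeta> - c"
          using rcis_cmod_Arg[of "\<zeta> - c"] by (simp add: rcis_def)
        then show ?thesis by (simp add: u_def)
      qed
      ultimately have "F n u = a" by (simp add: F_def a(2))
      then show "a \<in> (\<Union>n. range (F n))" by blast
    qed
  qed
qed

text \<open>For \<open>z\<close> near \<open>1\<close> the real parts of the \<open>j\<close>-th coordinates fill an interval, so the cone
  projects onto a set with interior in \<open>\<real> \<times> \<complex>\<close>.\<close>

lemma circle_cone_measure_pos: "hausdorff_measure 3 circle_cone \<noteq> 0"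
proof -
  define m where "m z = exp (Ln z / of_nat (w 3))" for z :: complex
  \<comment> \<open>With \<open>m z\<close> a branch of the \<open>w 3\<close>-th root, this is the
    factor by which coordinate \<open>j\<close> is scaled at height \<open>z\<close>.\<close>
  define \<mu> where "\<mu> z = m z ^ w j" for z
  have cont: "isCont \<mu> 1"
    unfolding \<mu>_def m_def using w_pos[of 3] by (intro continuous_intros) auto
  have \<mu>1: "\<mu> 1 = 1" by (simp add: \<mu>_def m_def)
  \<comment> \<open>Keeps \<open>norm (\<mu> z) > 1 / 2\<close> and moves \<open>\<mu> z * c\<close>
    from \<open>c\<close> by at most \<open>\<rho> / 4\<close>.\<close>
  define e where "e = min (1 / 2) (\<rho> / (4 * (norm c + 1)))"
  have e: "0 < e" "e \<le> 1 / 2" "e * norm c \<le> \<rho> / 4"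
  proof -
    define d where "d = norm c + 1"
    have d: "0 < d" "norm c \<le> d" by (simp_all add: d_def add_nonneg_pos)
    have e_d: "e = min (1 / 2) (\<rho> / (4 * d))" by (simp only: e_def d_def)
    show "0 < e" using \<rho> d by (simp add: e_d)
    show "e \<le> 1 / 2" unfolding e_d by (rule min.cobounded1)
    have "e * norm c \<le> \<rho> / (4 * d) * d"
      using \<rho> d by (intro mult_mono) (auto simp: e_d)
    also have "\<dots> = \<rho> / 4" using d(1) by simp
    finally show "e * norm c \<le> \<rho> / 4" .
  qed
  obtain \<delta> where \<delta>: "0 < \<delta>" "\<And>z. dist z 1 < \<delta> \<Longrightarrow> dist (\<mu> z) 1 < e"
    using cont e(1) unfolding continuous_at_eps_delta \<mu>1 by blast
  define \<delta>' where "\<delta>' = min (min \<delta> 1) (\<rho> / 4)"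
  have \<delta>': "0 < \<delta>'" using \<delta> \<rho> by (simp add: \<delta>'_def)
  define p where "p a = (Re (a $ j), a $ 3)" for a :: "complex ^ 3"
  have p: "dist (p x) (p y) \<le> dist x y" for x y
  proof -
    have "dist (p x) (p y) \<le> dist (x $ j, x $ 3) (y $ j, y $ 3)"
      unfolding p_def dist_Pair_Pair
      using abs_Re_le_cmod[of "x $ j - y $ j"]
      by (intro real_sqrt_le_mono add_right_mono power_mono) (auto simp: dist_norm)
    also have "\<dots> \<le> dist x y" using j by (rule dist_two_components_le)
    finally show ?thesis .
  qed
  have sub: "ball (Re c, 1) \<delta>' \<subseteq> p ` circle_cone"
  proof
    fix b assume b: "b \<in> ball (Re c, 1 :: complex) \<delta>'"
    obtain x z where xz: "b = (x, z)" by (cases b)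
    have "dist (Re c) x \<le> dist (Re c, 1) b" "dist 1 z \<le> dist (Re c, 1) b"
      unfolding xz dist_Pair_Pair by (auto intro: real_sqrt_sum_squares_ge1 real_sqrt_sum_squares_ge2)
    then have x: "\<bar>x - Re c\<bar> < \<rho> / 4" and z: "dist z 1 < \<delta>" "dist z 1 < 1"
      using b by (auto simp: \<delta>'_def dist_commute dist_real_def)
    have "z \<noteq> 0" using z(2) by auto
    then have mz: "m z ^ w 3 = z" using w_pos[of 3] by (simp add: m_def exp_of_nat_mult[symmetric])
    define N where "N = norm (\<mu> z)"
    have \<mu>z: "norm (\<mu> z - 1) < e" using \<delta>(2)[OF z(1)] by (simp add: dist_norm)
    have "norm (1 :: complex) - norm (\<mu> z) \<le> norm (1 - \<mu> z)" by (rule norm_triangle_ineq2)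
    then have N: "1 / 2 < N" using \<mu>z e(2) by (simp add: N_def norm_minus_commute)
    \<comment> \<open>The cosine that a point of the circle of radius \<open>\<rho> * N\<close>
      about \<open>\<mu> z * c\<close> needs in order to have real part \<open>x\<close>.\<close>
    define s where "s = (x - Re (\<mu> z * c)) / (\<rho> * N)"
    have "\<bar>Re (\<mu> z * c) - Re c\<bar> \<le> norm ((\<mu> z - 1) * c)"
      using abs_Re_le_cmod[of "(\<mu> z - 1) * c"] by (simp add: left_diff_distrib)
    also have "\<dots> \<le> e * norm c" unfolding norm_mult using \<mu>z by (intro mult_right_mono) auto
    finally have "\<bar>x - Re (\<mu> z * c)\<bar> \<le> \<rho> / 2" using x e(3) by linarith
    also have "\<rho> / 2 \<le> \<rho> * N" using N \<rho> by simp
    finally have s: "\<bar>s\<bar> \<le> 1" using N \<rho> by (simp add: s_def abs_divide abs_mult)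
    define \<eta> where "\<eta> = Complex s (sqrt (1 - s\<^sup>2))"
    have "s\<^sup>2 \<le> 1" using s by (simp add: abs_square_le_1)
    then have \<eta>: "norm \<eta> = 1" "Re \<eta> = s" by (auto simp: \<eta>_def cmod_def)
    \<comment> \<open>Undoes the rotation by \<open>\<mu> z\<close>, so that
      \<open>\<mu> z * \<xi> = N * \<eta>\<close>.\<close>
    define \<xi> where "\<xi> = cnj (\<mu> z) / of_real N * \<eta>"
    have "\<mu> z \<noteq> 0" using N by (auto simp: N_def)
    then have "norm \<xi> = 1" using \<eta>(1) by (simp add: \<xi>_def norm_mult norm_divide N_def)
    then have sph: "c + of_real \<rho> * \<xi> \<in> sphere c \<rho>" using \<rho> by (simp add: dist_norm norm_mult)
    have "\<mu> z * cnj (\<mu> z) = of_real N * of_real N"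
      by (simp add: N_def complex_norm_square[symmetric] power2_eq_square[symmetric])
    then have "\<mu> z * \<xi> = of_real N * \<eta>" using N by (simp add: \<xi>_def field_simps)
    then have "Re (\<mu> z * (c + of_real \<rho> * \<xi>)) = Re (\<mu> z * c) + \<rho> * N * s"
      by (simp add: distrib_left \<eta>(2) mult.left_commute[of "\<mu> z"])
    also have "\<dots> = x" using N \<rho> by (simp add: s_def)
    finally have "p (act w (m z) (\<gamma> (c + of_real \<rho> * \<xi>))) = b"
      using \<gamma>_3[OF sphere_subset[OF sph]] \<gamma>_j[OF sphere_subset[OF sph]] mz by (simp add: p_def xz \<mu>_def)
    then show "b \<in> p ` circle_cone" using circle_coneI[OF sph, of "m z"] by blast
  qed
  have dim: "DIM(real \<times> complex) = 3" by simp
  have "emeasure lborel (ball (Re c, 1 :: complex) \<delta>') = ennreal (unit_ball_vol 3 * \<delta>' ^ 3)"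
    using emeasure_ball[of \<delta>' "(Re c, 1 :: complex)"] \<delta>' by (simp only: dim less_imp_le of_nat_numeral)
  then have "ennreal (1 / 2 ^ 3) * ennreal (unit_ball_vol 3 * \<delta>' ^ 3) \<le> hausdorff_measure 3 circle_cone"
    using lborel_le_hausdorff_measure[of circle_cone p "ball (Re c, 1) \<delta>'"] p sub unfolding dim by simp
  moreover have "0 < ennreal (1 / 2 ^ 3) * ennreal (unit_ball_vol 3 * \<delta>' ^ 3)"
    using \<delta>' by (simp add: ennreal_zero_less_mult_iff)
  ultimately show ?thesis by auto
qed

end

section \<open>Construction of the separating set\<close>

lemma has_density_0I:
  assumes "((density_ratio k V x) \<longlongrightarrow> 0) (at_right 0)"
  shows "has_density k V x 0"
  unfolding has_density_def lower_density_def upper_density_def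
  using lim_imp_Liminf[OF _ assms] lim_imp_Limsup[OF _ assms] by (simp add: trivial_limit_at_right_real)

context separated_surface
begin

text \<open>\<open>wall Y T\<close>: the \<open>3\<close>-dimensional cone \<open>Y\<close> shields the open part \<open>T\<close> of the surface from the
  curve \<open>z = 0\<close>.\<close>

definition wall :: "(complex ^ 3) set \<Rightarrow> (complex ^ 3) set \<Rightarrow> bool" where
  "wall Y T \<longleftrightarrow> closed Y \<and> Y \<subseteq> X \<and> 0 \<in> Y \<and> (\<forall>a\<in>Y. \<forall>l. act w l a \<in> Y) \<and> (\<forall>a\<in>Y. a $ 3 = 0 \<longrightarrow> a = 0) \<and>
     (\<forall>a\<in>T. \<forall>l. l \<noteq> 0 \<longrightarrow> act w l a \<in> T) \<and>
     (\<forall>E a. connected E \<longrightarrow> E \<subseteq> X \<longrightarrow> E \<inter> Y = {} \<longrightarrow> a \<in> E \<longrightarrow> a $ 3 = 0 \<longrightarrow> E \<inter> T = {}) \<and>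
     (\<exists>K\<ge>0. \<forall>\<tau>. 0 < \<tau> \<longrightarrow> \<tau> \<le> 1 \<longrightarrow>
        hausdorff_measure 3 (Y \<inter> {a. norm (a $ 3) \<le> \<tau> ^ w 3}) \<le> ennreal (K * \<tau> ^ (2 * w 3 + w 2))) \<and>
     (\<forall>t>3. hausdorff_measure t Y = 0) \<and>
     (\<exists>F. (\<forall>n::nat. lipschitz_map 3 (F n)) \<and> Y \<subseteq> (\<Union>n. range (F n))) \<and>
     hausdorff_measure 3 Y \<noteq> 0"

lemma wallD:
  assumes "wall Y T"
  shows "closed Y" "Y \<subseteq> X" "0 \<in> Y" "\<forall>a\<in>Y. \<forall>l. act w l a \<in> Y" "\<forall>a\<in>Y. a $ 3 = 0 \<longrightarrow> a = 0"
    "\<forall>a\<in>T. \<forall>l. l \<noteq> 0 \<longrightarrow> act w l a \<in> T"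
    "\<forall>E a. connected E \<longrightarrow> E \<subseteq> X \<longrightarrow> E \<inter> Y = {} \<longrightarrow> a \<in> E \<longrightarrow> a $ 3 = 0 \<longrightarrow> E \<inter> T = {}"
    "\<exists>K\<ge>0. \<forall>\<tau>. 0 < \<tau> \<longrightarrow> \<tau> \<le> 1 \<longrightarrow>
        hausdorff_measure 3 (Y \<inter> {a. norm (a $ 3) \<le> \<tau> ^ w 3}) \<le> ennreal (K * \<tau> ^ (2 * w 3 + w 2))"
    "\<forall>t>3. hausdorff_measure t Y = 0"
    "\<exists>F. (\<forall>n::nat. lipschitz_map 3 (F n)) \<and> Y \<subseteq> (\<Union>n. range (F n))"
    "hausdorff_measure 3 Y \<noteq> 0"
  using assms unfolding wall_def by - (elim conjE, assumption)+

lemma slice_chart_wall: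
  assumes "slice_chart w f X j c \<rho> \<gamma> L"
  shows "\<exists>Y T. wall Y T \<and> \<gamma> ` ball c \<rho> \<subseteq> T"
proof -
  interpret sc: slice_chart w f X j c \<rho> \<gamma> L by fact
  have "wall sc.circle_cone sc.disc_cone"
    unfolding wall_def
  proof (intro conjI allI impI ballI)
    show "act w l a \<in> sc.disc_cone" if a: "a \<in> sc.disc_cone" and l: "l \<noteq> 0" for a l
    proof -
      obtain m \<zeta> where "m \<noteq> 0" "\<zeta> \<in> ball c \<rho>" "a = act w m (\<gamma> \<zeta>)"
        using a unfolding sc.disc_cone_def by auto
      then show ?thesis using l sc.disc_coneI[of "l * m" \<zeta>] by simp
    qed
    show "E \<inter> sc.disc_cone = {}" if "connected E" "E \<subseteq> X" "E \<inter> sc.circle_cone = {}" "a \<in> E" "a $ 3 = 0" for E a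
      using that by (rule sc.connected_avoids_disc_cone)
    show "\<exists>K\<ge>0. \<forall>\<tau>. 0 < \<tau> \<longrightarrow> \<tau> \<le> 1 \<longrightarrow>
        hausdorff_measure 3 (sc.circle_cone \<inter> {a. norm (a $ 3) \<le> \<tau> ^ w 3}) \<le> ennreal (K * \<tau> ^ (2 * w 3 + w 2))"
      by (rule sc.circle_cone_measure_le) blast
    show "\<exists>F. (\<forall>n::nat. lipschitz_map 3 (F n)) \<and> sc.circle_cone \<subseteq> (\<Union>n. range (F n))"
      by (rule sc.circle_cone_lipschitz_cover) blast
  qed (auto simp: sc.closed_circle_cone sc.circle_cone_zero sc.circle_cone_act sc.circle_cone_null sc.circle_cone_measure_pos
      intro: sc.circle_cone_z_eq_0 subsetD[OF sc.circle_cone_subset])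
  moreover have "\<gamma> ` ball c \<rho> \<subseteq> sc.disc_cone"
    using sc.disc_coneI[of 1] by auto
  ultimately show ?thesis by blast
qed

lemma wall_Un:
  assumes "wall Y1 T1" "wall Y2 T2"
  shows "wall (Y1 \<union> Y2) (T1 \<union> T2)"
proof -
  obtain K1 where K1: "0 \<le> K1" "\<forall>\<tau>. 0 < \<tau> \<longrightarrow> \<tau> \<le> 1 \<longrightarrow>
      hausdorff_measure 3 (Y1 \<inter> {a. norm (a $ 3) \<le> \<tau> ^ w 3}) \<le> ennreal (K1 * \<tau> ^ (2 * w 3 + w 2))"
    using wallD(8)[OF assms(1)] by blast
  obtain K2 where K2: "0 \<le> K2" "\<forall>\<tau>. 0 < \<tau> \<longrightarrow> \<tau> \<le> 1 \<longrightarrow>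
      hausdorff_measure 3 (Y2 \<inter> {a. norm (a $ 3) \<le> \<tau> ^ w 3}) \<le> ennreal (K2 * \<tau> ^ (2 * w 3 + w 2))"
    using wallD(8)[OF assms(2)] by blast
  obtain F1 :: "nat \<Rightarrow> (nat \<Rightarrow> real) \<Rightarrow> complex ^ 3" where F1: "\<forall>n. lipschitz_map 3 (F1 n)" "Y1 \<subseteq> (\<Union>n. range (F1 n))"
    using wallD(10)[OF assms(1)] by blast
  obtain F2 :: "nat \<Rightarrow> (nat \<Rightarrow> real) \<Rightarrow> complex ^ 3" where F2: "\<forall>n. lipschitz_map 3 (F2 n)" "Y2 \<subseteq> (\<Union>n. range (F2 n))"
    using wallD(10)[OF assms(2)] by blast
  note w1 = wallD[OF assms(1)] and w2 = wallD[OF assms(2)]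
  show ?thesis
    unfolding wall_def
  proof (intro conjI)
    show "closed (Y1 \<union> Y2)" using w1(1) w2(1) by (rule closed_Un)
    show "Y1 \<union> Y2 \<subseteq> X" using w1(2) w2(2) by blast
    show "0 \<in> Y1 \<union> Y2" using w1(3) by blast
    show "\<forall>a\<in>Y1 \<union> Y2. \<forall>l. act w l a \<in> Y1 \<union> Y2" using w1(4) w2(4) by blast
    show "\<forall>a\<in>Y1 \<union> Y2. a $ 3 = 0 \<longrightarrow> a = 0" using w1(5) w2(5) by blast
    show "\<forall>a\<in>T1 \<union> T2. \<forall>l. l \<noteq> 0 \<longrightarrow> act w l a \<in> T1 \<union> T2" using w1(6) w2(6) by blast
    show "\<forall>E a. connected E \<longrightarrow> E \<subseteq> X \<longrightarrow> E \<inter> (Y1 \<union> Y2) = {} \<longrightarrow> a \<in> E \<longrightarrow> a $ 3 = 0 \<longrightarrow> E \<inter> (T1 \<union> T2) = {}"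
    proof (intro allI impI)
      fix E a assume E: "connected E" "E \<subseteq> X" "E \<inter> (Y1 \<union> Y2) = {}" "a \<in> E" "a $ 3 = 0"
      then have n: "E \<inter> Y1 = {}" "E \<inter> Y2 = {}" by auto
      have "E \<inter> T1 = {}" by (rule w1(7)[rule_format, OF E(1,2) n(1) E(4,5)])
      moreover have "E \<inter> T2 = {}" by (rule w2(7)[rule_format, OF E(1,2) n(2) E(4,5)])
      ultimately show "E \<inter> (T1 \<union> T2) = {}" by blast
    qed
    show "\<exists>K\<ge>0. \<forall>\<tau>. 0 < \<tau> \<longrightarrow> \<tau> \<le> 1 \<longrightarrow>
        hausdorff_measure 3 ((Y1 \<union> Y2) \<inter> {a. norm (a $ 3) \<le> \<tau> ^ w 3}) \<le> ennreal (K * \<tau> ^ (2 * w 3 + w 2))"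
    proof (intro exI[of _ "K1 + K2"] conjI allI impI)
      fix \<tau> :: real assume \<tau>: "0 < \<tau>" "\<tau> \<le> 1"
      let ?H = "{a :: complex ^ 3. norm (a $ 3) \<le> \<tau> ^ w 3}"
      have "hausdorff_measure 3 ((Y1 \<union> Y2) \<inter> ?H) \<le> hausdorff_measure 3 (Y1 \<inter> ?H) + hausdorff_measure 3 (Y2 \<inter> ?H)"
        using hausdorff_measure_Un_le[of 3 "Y1 \<inter> ?H" "Y2 \<inter> ?H"] by (simp add: Int_Un_distrib2)
      also have "\<dots> \<le> ennreal (K1 * \<tau> ^ (2 * w 3 + w 2)) + ennreal (K2 * \<tau> ^ (2 * w 3 + w 2))"
        using K1(2) K2(2) \<tau> by (intro add_mono) auto
      also have "\<dots> = ennreal ((K1 + K2) * \<tau> ^ (2 * w 3 + w 2))"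
        using K1(1) K2(1) \<tau> by (simp add: distrib_right flip: ennreal_plus)
      finally show "hausdorff_measure 3 ((Y1 \<union> Y2) \<inter> ?H) \<le> ennreal ((K1 + K2) * \<tau> ^ (2 * w 3 + w 2))" .
    qed (use K1 K2 in auto)
    show "\<forall>t>3. hausdorff_measure t (Y1 \<union> Y2) = 0"
    proof (intro allI impI)
      fix t :: real assume "3 < t"
      then show "hausdorff_measure t (Y1 \<union> Y2) = 0"
        using hausdorff_measure_Un_le[of t Y1 Y2] w1(9) w2(9) by simp
    qed
    show "\<exists>F. (\<forall>n::nat. lipschitz_map 3 (F n)) \<and> Y1 \<union> Y2 \<subseteq> (\<Union>n. range (F n))"
    proof (intro exI conjI allI)
      let ?F = "\<lambda>n::nat. if even n then F1 (n div 2) else F2 (n div 2)"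
      show "lipschitz_map 3 (?F n)" for n using F1(1) F2(1) by simp
      have r1: "range (F1 n) \<subseteq> (\<Union>n. range (?F n))" for n
        using UN_upper[of "2 * n" UNIV "\<lambda>n. range (?F n)"] by simp
      have r2: "range (F2 n) \<subseteq> (\<Union>n. range (?F n))" for n
        using UN_upper[of "2 * n + 1" UNIV "\<lambda>n. range (?F n)"] by simp
      show "Y1 \<union> Y2 \<subseteq> (\<Union>n. range (?F n))"
        by (rule Un_least[OF order_trans[OF F1(2) UN_least[OF r1]] order_trans[OF F2(2) UN_least[OF r2]]])
    qed
    show "hausdorff_measure 3 (Y1 \<union> Y2) \<noteq> 0"
      using hausdorff_measure_mono[of Y1 "Y1 \<union> Y2" 3] w1(11) by auto
  qed
qed

lemma wall_density:
  assumes "wall Y T"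
  shows "has_density 3 Y 0 0"
proof (rule has_density_0I)
  obtain K where K: "0 \<le> K" "\<forall>\<tau>. 0 < \<tau> \<longrightarrow> \<tau> \<le> 1 \<longrightarrow>
      hausdorff_measure 3 (Y \<inter> {a. norm (a $ 3) \<le> \<tau> ^ w 3}) \<le> ennreal (K * \<tau> ^ (2 * w 3 + w 2))"
    using wallD(8)[OF assms] by blast
  define D where "D = K / unit_ball_vol 3"
  have D: "0 \<le> D" using K(1) by (simp add: D_def)
  have bound: "density_ratio 3 Y 0 \<epsilon> \<le> ennreal (D * root (w 3) \<epsilon>)" if \<epsilon>: "0 < \<epsilon>" "\<epsilon> < 1" for \<epsilon>
  proof -
    define \<tau> where "\<tau> = root (w 3) \<epsilon>"
    have \<tau>: "0 < \<tau>" "\<tau> \<le> 1" "\<tau> ^ w 3 = \<epsilon>"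
      using \<epsilon> w_pos[of 3] by (auto simp: \<tau>_def)
    have "Y \<inter> ball 0 \<epsilon> \<subseteq> Y \<inter> {a. norm (a $ 3) \<le> \<tau> ^ w 3}"
    proof
      fix a assume a: "a \<in> Y \<inter> ball 0 \<epsilon>"
      then show "a \<in> Y \<inter> {a. norm (a $ 3) \<le> \<tau> ^ w 3}"
        using Finite_Cartesian_Product.norm_nth_le[of a 3] \<tau>(3) by simp
    qed
    then have "hausdorff_measure 3 (Y \<inter> ball 0 \<epsilon>) \<le> hausdorff_measure 3 (Y \<inter> {a. norm (a $ 3) \<le> \<tau> ^ w 3})"
      by (rule hausdorff_measure_mono)
    also have "\<dots> \<le> ennreal (K * \<tau> ^ (2 * w 3 + w 2))" using K(2) \<tau>(1,2) by blast
    finally have "density_ratio 3 Y 0 \<epsilon> \<le> ennreal (K * \<tau> ^ (2 * w 3 + w 2)) / ennreal (unit_ball_vol 3 * \<epsilon> ^ 3)"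
      unfolding density_ratio_def by (auto intro: divide_right_mono_ennreal)
    also have "\<dots> = ennreal (K * \<tau> ^ (2 * w 3 + w 2) / (unit_ball_vol 3 * \<epsilon> ^ 3))"
      using K(1) \<tau>(1) \<epsilon>(1) by (intro divide_ennreal) auto
    also have "K * \<tau> ^ (2 * w 3 + w 2) / (unit_ball_vol 3 * \<epsilon> ^ 3) = D * (\<tau> ^ w 2 / \<tau> ^ w 3)"
    proof -
      have "\<epsilon> ^ 3 = \<tau> ^ w 3 * \<tau> ^ (2 * w 3)" by (simp add: \<tau>(3)[symmetric] mult.commute flip: power_mult power_add)
      then show ?thesis using \<tau>(1) by (simp add: D_def power_add)
    qed
    also have "ennreal (D * (\<tau> ^ w 2 / \<tau> ^ w 3)) \<le> ennreal (D * \<tau>)"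
      using D \<tau> w23 by (intro ennreal_leI mult_left_mono power_ratio_le) auto
    finally show ?thesis by (simp add: \<tau>_def)
  qed
  have "((\<lambda>\<epsilon>. D * root (w 3) \<epsilon>) \<longlongrightarrow> D * root (w 3) 0) (at_right 0)"
    by (intro tendsto_intros)
  then have lim: "((\<lambda>\<epsilon>. ennreal (D * root (w 3) \<epsilon>)) \<longlongrightarrow> 0) (at_right 0)"
    using tendsto_ennrealI by fastforce
  have "eventually (\<lambda>\<epsilon>. density_ratio 3 Y 0 \<epsilon> \<le> ennreal (D * root (w 3) \<epsilon>)) (at_right 0)"
    using eventually_at_right_real[of 0 1] by (auto elim!: eventually_mono intro: bound)
  then show "((density_ratio 3 Y 0) \<longlongrightarrow> 0) (at_right 0)"
    by (intro tendsto_sandwich[OF _ _ tendsto_const lim]) auto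
qed

lemma wall_rectifiable:
  assumes "wall Y T"
  shows "rectifiable_set 3 Y"
proof -
  note d = wallD(9,11)[OF assms]
  obtain F :: "nat \<Rightarrow> (nat \<Rightarrow> real) \<Rightarrow> complex ^ 3" where F: "\<forall>n. lipschitz_map 3 (F n)" "Y \<subseteq> (\<Union>n. range (F n))"
    using wallD(10)[OF assms] by blast
  have "hausdorff_dim Y = ereal (real 3)"
    using d by (intro hausdorff_dim_eqI) auto
  moreover have "Y - (\<Union>n. range (F n)) = {}" using F(2) by blast
  ultimately show ?thesis
    unfolding rectifiable_set_def using F(1) by (metis hausdorff_measure_empty)
qed

lemma normalize_z:
  assumes "a \<in> X" "a $ 3 \<noteq> 0"
  obtains l q where "l \<noteq> 0" "q \<in> X" "q $ 3 = 1" "a = act w l q"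
proof -
  obtain l where l: "l \<noteq> 0" "a $ 3 = l ^ w 3"
    using exists_complex_root_nonzero[of "a $ 3" "w 3"] assms(2) w_pos[of 3] by auto
  show ?thesis
    by (rule that[of l "act w (1 / l) a"]) (use l assms act_mem in \<open>auto simp: power_divide\<close>)
qed

text \<open>Through a point of the curve runs a line in \<open>z = 0\<close> not contained in
  \<open>X\<close>, so the root persists when \<open>z\<close> is moved off 0; the action then
  brings \<open>z\<close> to 1.\<close>

lemma slice_nonempty: "\<exists>q\<in>X. q $ 3 = 1"
proof -
  have "punctured_curve \<noteq> {}" using disconnected by (auto simp: punctured_curve_def)
  then obtain p where p: "p \<in> X" "p \<noteq> 0" "p $ 3 = 0" by (auto simp: punctured_curve_def)
  then have "p $ 1 \<noteq> 0 \<or> p $ 2 \<noteq> 0" by (auto simp: vec_eq_iff forall_3)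
  then obtain i j :: 3 where ij: "i \<noteq> j" "i \<noteq> 3" "j \<noteq> 3" "p $ j \<noteq> 0"
  proof
    assume "p $ 1 \<noteq> 0"
    then show ?thesis using that[of 2 1] by simp
  next
    assume "p $ 2 \<noteq> 0"
    then show ?thesis using that[of 1 2] by simp
  qed
  obtain \<zeta>0 where "upd p i \<zeta>0 \<notin> X" using line_not_subset[OF ij(1,2,3) p(3) ij(4)] by blast
  then obtain s where s: "0 < s"
    "\<And>b. (\<And>j. j \<noteq> i \<Longrightarrow> norm (b $ j - p $ j) < s) \<Longrightarrow> \<exists>\<zeta>. norm (\<zeta> - p $ i) < 1 \<and> cpoly_eval f (upd b i \<zeta>) = 0"
    using poly_fun_root_near[OF poly_fun_cpoly_eval, of f p i \<zeta>0 1] p(1) by (auto simp: mem_X_iff)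
  have "norm (upd p 3 (of_real (s / 2)) $ k - p $ k) < s" for k
    using s(1) p(3) by auto
  then obtain \<zeta> where "cpoly_eval f (upd (upd p 3 (of_real (s / 2))) i \<zeta>) = 0"
    using s(2) by blast
  then have "upd (upd p 3 (of_real (s / 2))) i \<zeta> \<in> X" by (simp add: mem_X_iff)
  moreover have "upd (upd p 3 (of_real (s / 2))) i \<zeta> $ 3 \<noteq> 0" using ij s(1) by simp
  ultimately show ?thesis by (metis normalize_z)
qed

section \<open>Finitely many walls over a compact part of the slice\<close>

lemma wall_through_point:
  assumes q: "q \<in> X" "q $ 3 = 1"
  shows "\<exists>Y T O'. wall Y T \<and> open O' \<and> q \<in> O' \<and> X \<inter> {a. a $ 3 = 1} \<inter> O' \<subseteq> T"
proof -
  obtain j \<rho> \<gamma> L where sc: "slice_chart w f X j (q $ j) \<rho> \<gamma> L" "q \<in> \<gamma> ` ball (q $ j) \<rho>"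
    by (rule slice_chart_exists[OF q])
  obtain Y T where YT: "wall Y T" "\<gamma> ` ball (q $ j) \<rho> \<subseteq> T" using slice_chart_wall[OF sc(1)] by blast
  obtain O' where "open O'" "X \<inter> {a. a $ 3 = 1} \<inter> O' = \<gamma> ` ball (q $ j) \<rho>"
    using slice_chart.\<gamma>_open[OF sc(1)] by blast
  then show ?thesis using YT sc(2) by blast
qed

lemma wall_covers_compact:
  assumes K: "compact K" "K \<subseteq> X \<inter> {a. a $ 3 = 1}"
  shows "\<exists>Y T. wall Y T \<and> K \<subseteq> T"
proof -
  define C where "C = {O'. open O' \<and> (\<exists>Y T. wall Y T \<and> X \<inter> {a. a $ 3 = 1} \<inter> O' \<subseteq> T)}"
  have "K \<subseteq> \<Union>C"
  proof
    fix q assume "q \<in> K"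
    then show "q \<in> \<Union>C" using wall_through_point[of q] K(2) unfolding C_def by blast
  qed
  then obtain C' where C': "C' \<subseteq> C" "finite C'" "K \<subseteq> \<Union>C'"
    using compactE[OF K(1), of C] unfolding C_def by blast
  have "\<exists>Y T. wall Y T \<and> X \<inter> {a. a $ 3 = 1} \<inter> \<Union>C' \<subseteq> T"
    using C'(2,1)
  proof (induction C' rule: finite_induct)
    \<comment> \<open>A wall has non-zero measure, so even the empty cover needs an actual
      one.\<close>
    case empty
    obtain q where "q \<in> X" "q $ 3 = 1" using slice_nonempty by blast
    then show ?case using wall_through_point[of q] by blast
  next
    case (insert O' C'')
    obtain Y1 T1 where "wall Y1 T1" "X \<inter> {a. a $ 3 = 1} \<inter> \<Union>C'' \<subseteq> T1" using insert by blast
    moreover obtain Y2 T2 where "wall Y2 T2" "X \<inter> {a. a $ 3 = 1} \<inter> O' \<subseteq> T2"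
      using insert.prems unfolding C_def by blast
    ultimately have "wall (Y1 \<union> Y2) (T1 \<union> T2)" "X \<inter> {a. a $ 3 = 1} \<inter> \<Union>(insert O' C'') \<subseteq> T1 \<union> T2"
      using wall_Un by blast+
    then show ?case by blast
  qed
  then show ?thesis using C'(3) K(2) by blast
qed


text \<open>The roots make this function and \<open>z_norm\<close> homogeneous of degree one under
  \<open>act\<close>, so comparing them is invariant along orbits.\<close>

definition xy_norm :: "complex ^ 3 \<Rightarrow> real" where
  "xy_norm a = max (root (w 1) (norm (a $ 1))) (root (w 2) (norm (a $ 2)))"

definition z_norm :: "complex ^ 3 \<Rightarrow> real" where
  "z_norm a = root (w 3) (norm (a $ 3))"

lemma root_act: "root (w k) (norm (act w l a $ k)) = norm l * root (w k) (norm (a $ k))"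
  using w_pos[of k] by (simp add: norm_mult norm_power real_root_mult real_root_power_cancel)

lemma xy_norm_act: "xy_norm (act w l a) = norm l * xy_norm a"
  unfolding xy_norm_def root_act by (simp add: max_mult_distrib_left)

lemma z_norm_act: "z_norm (act w l a) = norm l * z_norm a"
  unfolding z_norm_def root_act ..

lemma continuous_on_xy_norm: "continuous_on S xy_norm"
  unfolding xy_norm_def by (intro continuous_intros)

lemma continuous_on_z_norm: "continuous_on S z_norm"
  unfolding z_norm_def by (intro continuous_intros)

lemma root_norm_nonneg: "0 \<le> root n (norm x)"
  by (simp add: real_root_ge_zero)

lemma xy_norm_nonneg: "0 \<le> xy_norm a" and z_norm_nonneg: "0 \<le> z_norm a"
  by (simp_all add: xy_norm_def z_norm_def le_max_iff_disj root_norm_nonneg)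

lemma z_norm_eq_0_iff: "z_norm a = 0 \<longleftrightarrow> a $ 3 = 0"
  using w_pos[of 3] by (simp add: z_norm_def)

lemma z_norm_le_0_iff: "z_norm a \<le> 0 \<longleftrightarrow> a $ 3 = 0"
  using z_norm_nonneg[of a] z_norm_eq_0_iff[of a] by auto

lemma xy_norm_eq_0: "xy_norm a = 0 \<Longrightarrow> a $ 1 = 0 \<and> a $ 2 = 0"
proof -
  assume "xy_norm a = 0"
  moreover have "0 \<le> root (w 1) (norm (a $ 1))" "0 \<le> root (w 2) (norm (a $ 2))" by (rule root_norm_nonneg)+
  ultimately have "root (w 1) (norm (a $ 1)) = 0" "root (w 2) (norm (a $ 2)) = 0"
    unfolding xy_norm_def by linarith+
  then show ?thesis using w_pos[of 1] w_pos[of 2] by simp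
qed

lemma compact_weighted_ball: "compact (X \<inter> {a. xy_norm a \<le> r \<and> z_norm a \<le> s})"
proof (rule compact_eq_bounded_closed[THEN iffD2], rule conjI)
  have "closed {a. xy_norm a \<le> r}" "closed {a. z_norm a \<le> s}"
    by (intro closed_Collect_le continuous_on_xy_norm continuous_on_z_norm continuous_on_const)+
  then show "closed (X \<inter> {a. xy_norm a \<le> r \<and> z_norm a \<le> s})"
    using closed_X by (simp add: Collect_conj_eq closed_Int)
  have le: "norm (a $ k) \<le> t ^ w k" if "root (w k) (norm (a $ k)) \<le> t" for a :: "complex ^ 3" and k t
  proof -
    have "norm (a $ k) = root (w k) (norm (a $ k)) ^ w k" using w_pos[of k] by simp
    also have "\<dots> \<le> t ^ w k" using that root_norm_nonneg by (intro power_mono)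
    finally show ?thesis .
  qed
  show "bounded (X \<inter> {a. xy_norm a \<le> r \<and> z_norm a \<le> s})"
  proof (rule boundedI)
    fix a assume "a \<in> X \<inter> {a. xy_norm a \<le> r \<and> z_norm a \<le> s}"
    then have "root (w 1) (norm (a $ 1)) \<le> r" "root (w 2) (norm (a $ 2)) \<le> r" "root (w 3) (norm (a $ 3)) \<le> s"
      by (auto simp: xy_norm_def z_norm_def)
    from this[THEN le] show "norm a \<le> r ^ w 1 + r ^ w 2 + s ^ w 3"
      using norm_le_3[of a] by linarith
  qed
qed

text \<open>The weighted action retracts a neighbourhood of the curve \<open>z = 0\<close> to the points of weighted norm
  \<open>1\<close>, where compactness turns the separation of the curve into a separation of a neighbourhood.\<close>

lemma separate_near_curve:
  obtains O1 O2 \<delta> p q where "open O1" "open O2" "O1 \<inter> O2 = {}" "0 < \<delta>"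
    "\<forall>a\<in>X. xy_norm a = 1 \<longrightarrow> z_norm a < \<delta> \<longrightarrow> a \<in> O1 \<union> O2"
    "p \<in> punctured_curve" "xy_norm p = 1" "p \<in> O1" "q \<in> punctured_curve" "xy_norm q = 1" "q \<in> O2"
proof -
  obtain A B where AB: "open A" "open B" "punctured_curve \<subseteq> A \<union> B" "A \<inter> B \<inter> punctured_curve = {}"
    "A \<inter> punctured_curve \<noteq> {}" "B \<inter> punctured_curve \<noteq> {}"
    using disconnected unfolding connected_def punctured_curve_def[symmetric] by auto
  define S where "S = X \<inter> {a. a $ 3 = 0 \<and> xy_norm a = 1}"
  have S_curve: "S \<subseteq> punctured_curve"
  proof
    fix a assume a: "a \<in> S"
    have "xy_norm 0 = 0" by (simp add: xy_norm_def)
    then have "a \<noteq> 0" using a by (auto simp: S_def)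
    then show "a \<in> punctured_curve" using a by (auto simp: S_def punctured_curve_def)
  qed
  have "S = (X \<inter> {a. xy_norm a \<le> 1 \<and> z_norm a \<le> 0}) \<inter> {a. 1 \<le> xy_norm a}"
    by (auto simp: S_def z_norm_le_0_iff intro: antisym)
  moreover have "closed {a. 1 \<le> xy_norm a}"
    by (intro closed_Collect_le continuous_on_xy_norm continuous_on_const)
  ultimately have "compact S"
    using compact_weighted_ball[of 1 0] by (simp add: compact_Int_closed)
  then have cS: "compact (S - B)" "compact (S - A)" using AB by (simp_all add: compact_diff)
  then have "closed (S - B)" "closed (S - A)" by (simp_all add: compact_imp_closed)
  moreover have "(S - B) \<inter> (S - A) = {}" using AB(3) S_curve by blast
  ultimately obtain O1 O2 where O: "open O1" "open O2" "S - B \<subseteq> O1" "S - A \<subseteq> O2" "O1 \<inter> O2 = {}"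
    using separation_normal by meson
  have S_O: "S \<subseteq> O1 \<union> O2" using O(3,4) AB(4) S_curve by blast
  \<comment> \<open>The part of the compact shell left uncovered. The zeros of \<open>z_norm\<close>
    on the shell form \<open>S\<close>, which is covered, so \<open>z_norm\<close> has a positive
    lower bound on \<open>T\<close>.\<close>
  define T where "T = (X \<inter> {a. xy_norm a \<le> 1 \<and> z_norm a \<le> 1}) \<inter> {a. 1 \<le> xy_norm a} - (O1 \<union> O2)"
  have cT: "compact T"
    unfolding T_def using O(1,2)
    by (intro compact_diff compact_Int_closed compact_weighted_ball closed_Collect_le continuous_on_xy_norm
        continuous_on_const open_Un)
  have "\<exists>\<delta>>0. \<forall>a\<in>T. \<delta> \<le> z_norm a"
  proof (cases "T = {}")
    case False
    then obtain b where b: "b \<in> T" "\<forall>a\<in>T. z_norm b \<le> z_norm a"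
      using continuous_attains_inf[OF cT False continuous_on_z_norm] by blast
    have "z_norm b \<noteq> 0"
    proof
      assume "z_norm b = 0"
      then have "b \<in> S" using b(1) unfolding S_def T_def z_norm_eq_0_iff by (auto intro: antisym)
      then show False using S_O b(1) by (auto simp: T_def)
    qed
    then have "0 < z_norm b" using z_norm_nonneg[of b] by simp
    then show ?thesis using b(2) by blast
  qed (auto intro: exI[of _ 1])
  then obtain \<delta>0 where \<delta>0: "0 < \<delta>0" "\<forall>a\<in>T. \<delta>0 \<le> z_norm a" by blast
  have near: "\<forall>a\<in>X. xy_norm a = 1 \<longrightarrow> z_norm a < min \<delta>0 1 \<longrightarrow> a \<in> O1 \<union> O2"
  proof (intro ballI impI)
    fix a assume a: "a \<in> X" "xy_norm a = 1" "z_norm a < min \<delta>0 1"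
    show "a \<in> O1 \<union> O2"
    proof (rule ccontr)
      assume "a \<notin> O1 \<union> O2"
      then have "a \<in> T" using a by (simp add: T_def)
      then show False using \<delta>0(2) a(3) by fastforce
    qed
  qed
  \<comment> \<open>An orbit under non-zero scalars is connected and cannot leave the piece it
    starts in, so each piece reaches weighted norm 1.\<close>
  have normalized: "\<exists>q\<in>C. q \<in> punctured_curve \<and> xy_norm q = 1"
    if C: "C \<inter> punctured_curve \<noteq> {}" "open C" "open D" "punctured_curve \<subseteq> C \<union> D" "C \<inter> D \<inter> punctured_curve = {}" for C D
  proof -
    obtain p where p: "p \<in> C" "p \<in> punctured_curve" using C(1) by blast
    then have p3: "p $ 3 = 0" "p \<in> X" "p \<noteq> 0" by (auto simp: punctured_curve_def)
    have n: "0 < xy_norm p"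
    proof (rule ccontr)
      assume "\<not> 0 < xy_norm p"
      then have "xy_norm p = 0" using xy_norm_nonneg[of p] by simp
      then show False using xy_norm_eq_0[of p] p3 by (auto simp: vec_eq_iff forall_3)
    qed
    let ?O = "(\<lambda>l. act w l p) ` (- {0})"
    have "connected ?O"
      by (intro connected_continuous_image continuous_on_act continuous_on_id continuous_on_const
          connected_punctured_universe) simp
    moreover have sub: "?O \<subseteq> punctured_curve"
      using p3 by (auto simp: punctured_curve_def act_mem act_eq_0_iff)
    moreover have "p \<in> C \<inter> ?O" using p(1) by (auto intro!: image_eqI[of _ _ 1])
    ultimately have "D \<inter> ?O = {}"
      using connectedD[of ?O C D] C by blast
    then have "?O \<subseteq> C" using sub C(4) by blast
    moreover have "act w (1 / of_real (xy_norm p)) p \<in> ?O" using n by (intro imageI) auto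
    moreover have "xy_norm (act w (1 / of_real (xy_norm p)) p) = 1"
      using n by (simp add: xy_norm_act norm_divide)
    ultimately show ?thesis using sub by blast
  qed
  obtain p where p: "p \<in> A" "p \<in> punctured_curve" "xy_norm p = 1"
    using normalized[of A B] AB by blast
  obtain q where q: "q \<in> B" "q \<in> punctured_curve" "xy_norm q = 1"
    using normalized[of B A] AB by blast
  have "p \<in> S" "q \<in> S" using p q by (auto simp: S_def punctured_curve_def)
  then have "p \<in> O1" "q \<in> O2" using O(3,4) AB(4) p q by blast+
  show ?thesis
    by (rule that[of O1 O2 "min \<delta>0 1" p q]) (fact | simp add: \<delta>0(1))+
qed

section \<open>Two components of the complement of a wall\<close>

definition cone_nbhd :: "real \<Rightarrow> (complex ^ 3) set \<Rightarrow> (complex ^ 3) set" where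
  "cone_nbhd \<delta> U = {a. 0 < xy_norm a \<and> z_norm a < \<delta> * xy_norm a \<and> act w (1 / of_real (xy_norm a)) a \<in> U}"

lemma open_cone_nbhd:
  assumes "open U"
  shows "open (cone_nbhd \<delta> U)"
proof -
  let ?P = "{a. 0 < xy_norm a}"
  have P: "open ?P" "open {a. z_norm a < \<delta> * xy_norm a}"
    by (intro open_Collect_less continuous_on_const continuous_on_mult continuous_on_xy_norm continuous_on_z_norm)+
  have "continuous_on ?P (\<lambda>a. act w (1 / of_real (xy_norm a)) a)"
    by (intro continuous_intros continuous_on_xy_norm) auto
  then have "open (?P \<inter> (\<lambda>a. act w (1 / of_real (xy_norm a)) a) -` U)"
    using P(1) assms by (rule continuous_open_preimage)
  moreover have "cone_nbhd \<delta> U = (?P \<inter> (\<lambda>a. act w (1 / of_real (xy_norm a)) a) -` U) \<inter> {a. z_norm a < \<delta> * xy_norm a}"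
    by (auto simp: cone_nbhd_def)
  ultimately show ?thesis using P(2) by (simp add: open_Int)
qed

lemma cone_nbhd_act:
  assumes "a \<in> cone_nbhd \<delta> U" "0 < t"
  shows "act w (of_real t) a \<in> cone_nbhd \<delta> U"
  using assms by (auto simp: cone_nbhd_def xy_norm_act z_norm_act)

text \<open>The cone over a graph chart at \<open>p\<close> is connected, being the image of a
  punctured disc times the chart, and it avoids the invariant set \<open>Y\<close>. The component
  containing it inherits its density; the point \<open>act w (of_real t) p\<close> records which
  piece of the curve this component meets.\<close>

lemma component_with_positive_density:
  assumes Y: "wall Y T" and \<epsilon>: "0 < \<epsilon>" and p: "p \<in> punctured_curve"
  obtains A t where "A \<in> components ((ball 0 \<epsilon> \<inter> X) - Y)" "0 < t" "act w (of_real t) p \<in> A"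
    "0 < lower_density 4 A 0"
proof -
  have pX: "p \<in> X" "p \<noteq> 0" "p $ 3 = 0" using p by (auto simp: punctured_curve_def)
  note Yw = wallD[OF Y]
  have "p \<notin> Y" using Yw(5) pX by blast
  then obtain R where R: "0 < R" "ball p R \<subseteq> - Y"
    using Yw(1) open_contains_ball[of "- Y"] by (auto simp: open_Compl)
  obtain i r s L where gc: "graph_chart X p i r s L" "poly_box p i r s \<subseteq> ball p R"
    by (rule smooth_point_graph_chart[OF pX(1,2) R(1)])
  let ?V = "X \<inter> poly_box p i r s"
  have pV: "p \<in> poly_box p i r s" using gc(1) by (auto simp: graph_chart_def poly_box_def)
  then obtain R1 where R1: "0 < R1" "ball p R1 \<subseteq> poly_box p i r s"
    using open_poly_box[of p i r s] open_contains_ball by blast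
  have bound: "norm q < norm p + R" if "q \<in> ?V" for q
  proof -
    have "norm (q - p) < R" using that gc(2) by (auto simp: dist_norm norm_minus_commute)
    then show ?thesis using norm_triangle_ineq2[of q p] by linarith
  qed
  have b0: "0 < norm p + R" using R(1) by (simp add: add_nonneg_pos)
  \<comment> \<open>Chart points have norm below \<open>norm p + R\<close>, and scaling by
    \<open>norm l \<le> 1\<close> contracts at least linearly, so the cone lies in the ball.\<close>
  define \<tau> where "\<tau> = min 1 (\<epsilon> / (norm p + R))"
  have "\<tau> \<le> \<epsilon> / (norm p + R)" unfolding \<tau>_def by (rule min.cobounded2)
  then have "\<tau> * (norm p + R) \<le> \<epsilon>" using b0 by (simp add: pos_le_divide_eq)
  moreover have "0 < \<tau>" "\<tau> \<le> 1" using \<epsilon> b0 by (auto simp: \<tau>_def)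
  ultimately have \<tau>: "0 < \<tau>" "\<tau> \<le> 1" "\<tau> * (norm p + R) \<le> \<epsilon>" by auto
  let ?D = "(ball 0 \<epsilon> \<inter> X) - Y"
  have sub: "cone_over \<tau> ?V \<subseteq> ?D"
  proof
    fix a assume "a \<in> cone_over \<tau> ?V"
    then obtain l q where a: "a = act w l q" "l \<noteq> 0" "norm l < \<tau>" "q \<in> ?V"
      unfolding cone_over_def by auto
    have "norm a \<le> norm l * norm q" unfolding a(1) using a(3) \<tau>(2) w_pos by (intro norm_act_le) auto
    also have "\<dots> \<le> norm l * (norm p + R)" using bound[OF a(4)] by (intro mult_left_mono) auto
    also have "\<dots> < \<tau> * (norm p + R)" using a(3) b0 by (intro mult_strict_right_mono)
    finally have "norm a < \<epsilon>" using \<tau>(3) by linarith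
    moreover have "a \<in> X" using a by (auto intro: act_mem)
    moreover have "a \<notin> Y"
    proof
      assume "a \<in> Y"
      then have "act w (1 / l) a \<in> Y" using Yw(4) by blast
      then have "q \<in> Y" using a by simp
      then show False using a(4) gc(2) R(2) by blast
    qed
    ultimately show "a \<in> ?D" by simp
  qed
  have "connected (ball 0 \<tau> - {0 :: complex})"
    by (intro path_connected_imp_connected path_connected_punctured_ball) simp
  then have "connected ((ball 0 \<tau> - {0 :: complex}) \<times> ?V)"
    using graph_chart_connected[OF gc(1)] by (simp add: connected_Times)
  moreover have "continuous_on ((ball 0 \<tau> - {0 :: complex}) \<times> ?V) (\<lambda>x. act w (fst x) (snd x))"
    by (intro continuous_intros)
  ultimately have "connected ((\<lambda>x. act w (fst x) (snd x)) ` ((ball 0 \<tau> - {0 :: complex}) \<times> ?V))"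
    by (intro connected_continuous_image)
  moreover have "(\<lambda>x. act w (fst x) (snd x)) ` ((ball 0 \<tau> - {0 :: complex}) \<times> ?V) = cone_over \<tau> ?V"
  proof -
    have "{l :: complex. l \<noteq> 0 \<and> norm l < \<tau>} = ball 0 \<tau> - {0}" by auto
    then show ?thesis unfolding cone_over_def by (simp add: case_prod_beta)
  qed
  ultimately have conn: "connected (cone_over \<tau> ?V)" by simp
  have mem: "act w (of_real (\<tau> / 2)) p \<in> cone_over \<tau> ?V"
    using \<tau>(1) pV pX(1) by (intro cone_overI) auto
  then have "?D \<noteq> {}" using sub by blast
  then obtain A where A: "A \<in> components ?D" "cone_over \<tau> ?V \<subseteq> A"
    using exists_component_superset[OF sub _ conn] by blast
  have "X \<inter> ball p R1 \<subseteq> ?V" using R1(2) by blast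
  then have "cone_over \<tau> (X \<inter> ball p R1) \<subseteq> A" using A(2) unfolding cone_over_def by blast
  then have "lower_density 4 (cone_over \<tau> (X \<inter> ball p R1)) 0 \<le> lower_density 4 A 0"
    by (rule lower_density_mono)
  then have "0 < lower_density 4 A 0"
    using lower_density_cone[OF p R1(1) \<tau>(1)] by (rule less_le_trans[rotated])
  moreover have "act w (of_real (\<tau> / 2)) p \<in> A" using mem A(2) by blast
  ultimately show ?thesis using that[of A "\<tau> / 2"] A(1) \<tau>(1) by simp
qed

text \<open>A point of \<open>E\<close> on the boundary \<open>z_norm = \<delta> * xy_norm\<close>
  would normalise to \<open>z = 1\<close> with \<open>xy_norm = 1 / \<delta>\<close>, hence lie in
  \<open>T\<close>; but \<open>E\<close> meets \<open>z = 0\<close> and so avoids \<open>T\<close>.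
  Connectedness keeps \<open>E\<close> first inside the conical neighbourhood and then in one of its
  two disjoint open halves.\<close>

lemma separated_by_wall:
  assumes O: "open O1" "open O2" "O1 \<inter> O2 = {}" and \<delta>: "0 < \<delta>"
    and near: "\<forall>a\<in>X. xy_norm a = 1 \<longrightarrow> z_norm a < \<delta> \<longrightarrow> a \<in> O1 \<union> O2"
    and Y: "wall Y T" "X \<inter> {a. a $ 3 = 1} \<inter> {a. xy_norm a = 1 / \<delta>} \<subseteq> T"
    and E: "connected E" "E \<subseteq> X" "E \<inter> Y = {}" and a0: "a0 \<in> E" "a0 $ 3 = 0" "a0 \<in> cone_nbhd \<delta> O1"
  shows "E \<subseteq> cone_nbhd \<delta> O1"
proof -
  note Yw = wallD[OF Y(1)]
  have ET: "E \<inter> T = {}" by (rule Yw(7)[rule_format, OF E a0(1,2)])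
  have zero: "0 \<notin> E" using Yw(3) E(3) by blast
  have off: "z_norm a \<noteq> \<delta> * xy_norm a" if a: "a \<in> E" for a
  proof
    assume eq: "z_norm a = \<delta> * xy_norm a"
    have "a $ 3 \<noteq> 0"
    proof
      assume z: "a $ 3 = 0"
      then have "xy_norm a = 0" using eq \<delta> by (simp add: z_norm_def)
      then have "a = 0" using xy_norm_eq_0[of a] z by (simp add: vec_eq_iff forall_3)
      then show False using a zero by simp
    qed
    then obtain l q where q: "l \<noteq> 0" "q \<in> X" "q $ 3 = 1" "a = act w l q"
      using normalize_z[of a] a E(2) by blast
    have "norm l * z_norm q = norm l * (\<delta> * xy_norm q)" using eq by (simp add: q(4) z_norm_act xy_norm_act)
    then have "z_norm q = \<delta> * xy_norm q" using q(1) by simp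
    moreover have "z_norm q = 1" using q(3) w_pos[of 3] by (simp add: z_norm_def)
    ultimately have "xy_norm q = 1 / \<delta>" using \<delta> by (simp add: field_simps)
    then have "q \<in> T" using q Y(2) by blast
    then have "a \<in> T" using Yw(6) q by blast
    then show False using a ET by blast
  qed
  let ?G = "{a. z_norm a < \<delta> * xy_norm a}" and ?G' = "{a. \<delta> * xy_norm a < z_norm a}"
  have "open ?G" "open ?G'"
    by (intro open_Collect_less continuous_on_const continuous_on_mult continuous_on_xy_norm continuous_on_z_norm)+
  moreover have "E \<subseteq> ?G \<union> ?G'" using off by force
  moreover have "?G \<inter> ?G' \<inter> E = {}" by auto
  moreover have "a0 \<in> ?G \<inter> E" using a0 by (simp add: cone_nbhd_def)
  ultimately have "?G' \<inter> E = {}" using connectedD[OF E(1), of ?G ?G'] by blast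
  then have EG: "E \<subseteq> ?G" using \<open>E \<subseteq> ?G \<union> ?G'\<close> by blast
  have cover: "E \<subseteq> cone_nbhd \<delta> O1 \<union> cone_nbhd \<delta> O2"
  proof
    fix a assume a: "a \<in> E"
    then have G: "z_norm a < \<delta> * xy_norm a" using EG by blast
    then have "0 < \<delta> * xy_norm a" using z_norm_nonneg[of a] by linarith
    then have n: "0 < xy_norm a" using \<delta> by (simp add: zero_less_mult_iff)
    let ?b = "act w (1 / of_real (xy_norm a)) a"
    have "xy_norm ?b = 1" using n by (simp add: xy_norm_act norm_divide)
    moreover have "z_norm ?b < \<delta>" using n G by (simp add: z_norm_act norm_divide field_simps)
    moreover have "?b \<in> X" using a E(2) act_mem by blast
    ultimately have "?b \<in> O1 \<union> O2" using near by blast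
    then show "a \<in> cone_nbhd \<delta> O1 \<union> cone_nbhd \<delta> O2" using n G by (auto simp: cone_nbhd_def)
  qed
  have disj: "cone_nbhd \<delta> O1 \<inter> cone_nbhd \<delta> O2 = {}" using O(3) by (auto simp: cone_nbhd_def)
  have "cone_nbhd \<delta> O2 \<inter> E = {}"
    using connectedD[OF E(1) open_cone_nbhd[OF O(1)] open_cone_nbhd[OF O(2)], of \<delta> \<delta>] cover disj a0 by blast
  then show ?thesis using cover by blast
qed

lemma separating_set_exists: "\<exists>Y. separating_set 4 X 0 Y"
proof -
  obtain O1 O2 \<delta> p q where O: "open O1" "open O2" "O1 \<inter> O2 = {}" and \<delta>: "0 < \<delta>"
    and near: "\<forall>a\<in>X. xy_norm a = 1 \<longrightarrow> z_norm a < \<delta> \<longrightarrow> a \<in> O1 \<union> O2"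
    and p: "p \<in> punctured_curve" "xy_norm p = 1" "p \<in> O1"
    and q: "q \<in> punctured_curve" "xy_norm q = 1" "q \<in> O2"
    by (rule separate_near_curve)
  \<comment> \<open>The boundary of the conical neighbourhood cut by \<open>z = 1\<close>; both
    weighted norms are bounded there, hence compactness.\<close>
  let ?K = "X \<inter> {a. a $ 3 = 1} \<inter> {a. xy_norm a = 1 / \<delta>}"
  have "compact ?K"
  proof -
    have "closed {a :: complex ^ 3. a $ 3 = 1}" "closed {a. xy_norm a = 1 / \<delta>}"
      by (intro closed_Collect_eq continuous_on_xy_norm continuous_intros)+
    then have "compact ((X \<inter> {a. xy_norm a \<le> 1 / \<delta> \<and> z_norm a \<le> 1}) \<inter> ({a. a $ 3 = 1} \<inter> {a. xy_norm a = 1 / \<delta>}))"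
      by (intro compact_Int_closed[OF compact_weighted_ball] closed_Int)
    moreover have "(X \<inter> {a. xy_norm a \<le> 1 / \<delta> \<and> z_norm a \<le> 1}) \<inter> ({a. a $ 3 = 1} \<inter> {a. xy_norm a = 1 / \<delta>}) = ?K"
      using w_pos[of 3] by (auto simp: z_norm_def)
    ultimately show ?thesis by simp
  qed
  then obtain Y T where Y: "wall Y T" "?K \<subseteq> T" using wall_covers_compact[of ?K] by blast
  note Yw = wallD[OF Y(1)]
  have "z_norm p = 0" "z_norm q = 0"
    using p(1) q(1) by (auto simp: z_norm_eq_0_iff punctured_curve_def)
  then have pq: "p \<in> cone_nbhd \<delta> O1" "q \<in> cone_nbhd \<delta> O2"
    using p q \<delta> by (auto simp: cone_nbhd_def)
  have comps: "\<exists>A\<in>components ((ball 0 \<epsilon> \<inter> X) - Y). \<exists>B\<in>components ((ball 0 \<epsilon> \<inter> X) - Y).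
      A \<noteq> B \<and> 0 < lower_density 4 A 0 \<and> 0 < lower_density 4 B 0" if \<epsilon>: "0 < \<epsilon>" for \<epsilon>
  proof -
    let ?D = "(ball 0 \<epsilon> \<inter> X) - Y"
    obtain A t where A: "A \<in> components ?D" "0 < t" "act w (of_real t) p \<in> A" "0 < lower_density 4 A 0"
      by (rule component_with_positive_density[OF Y(1) \<epsilon> p(1)])
    obtain B u where B: "B \<in> components ?D" "0 < u" "act w (of_real u) q \<in> B" "0 < lower_density 4 B 0"
      by (rule component_with_positive_density[OF Y(1) \<epsilon> q(1)])
    have comp: "connected C" "C \<subseteq> X" "C \<inter> Y = {}" if "C \<in> components ?D" for C
      using in_components_connected[OF that] in_components_subset[OF that] by auto
    have z: "act w (of_real t) p $ 3 = 0" "act w (of_real u) q $ 3 = 0"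
      using p(1) q(1) by (auto simp: punctured_curve_def)
    have "A \<subseteq> cone_nbhd \<delta> O1"
      by (rule separated_by_wall[OF O \<delta> near Y comp[OF A(1)] A(3) z(1) cone_nbhd_act[OF pq(1) A(2)]])
    moreover have "B \<subseteq> cone_nbhd \<delta> O2"
    proof (rule separated_by_wall[OF O(2,1) _ \<delta> _ Y comp[OF B(1)] B(3) z(2) cone_nbhd_act[OF pq(2) B(2)]])
      show "O2 \<inter> O1 = {}" using O(3) by blast
      show "\<forall>a\<in>X. xy_norm a = 1 \<longrightarrow> z_norm a < \<delta> \<longrightarrow> a \<in> O2 \<union> O1" using near by blast
    qed
    moreover have "cone_nbhd \<delta> O1 \<inter> cone_nbhd \<delta> O2 = {}" using O(3) by (auto simp: cone_nbhd_def)
    ultimately have "A \<noteq> B" using A(3) by blast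
    then show ?thesis using A B by blast
  qed
  obtain A where A: "A \<in> components ((ball 0 1 \<inter> X) - Y)" "0 < lower_density 4 A 0"
    using comps[of 1] by auto
  have "A \<subseteq> X" using in_components_subset[OF A(1)] by blast
  then have dens: "0 < lower_density 4 X 0"
    by (rule less_le_trans[OF A(2) lower_density_mono])
  have "hausdorff_dim X = ereal 4"
    using hausdorff_measure_null lower_density_pos_imp_measure_nonzero[OF dens]
    by (intro hausdorff_dim_eqI) auto
  have "separating_set 4 X 0 Y"
    unfolding separating_set_def
  proof (intro conjI allI impI)
    show "semialgebraic X" unfolding X_eq by (rule semialgebraic_zero_set)
    show "hausdorff_dim X = ereal (real 4)" using \<open>hausdorff_dim X = ereal 4\<close> by simp
    show "rectifiable_set (4 - 1) Y" using wall_rectifiable[OF Y(1)] by simp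
    show "has_density (4 - 1) Y 0 0" using wall_density[OF Y(1)] by simp
    fix d :: real assume d: "0 < d"
    have "0 < d / 2" "d / 2 < d" using d by auto
    then show "\<exists>\<epsilon>>0. \<epsilon> < d \<and> (\<exists>A\<in>components ((ball 0 \<epsilon> \<inter> X) - Y). \<exists>B\<in>components ((ball 0 \<epsilon> \<inter> X) - Y).
        A \<noteq> B \<and> lower_density 4 A 0 \<noteq> 0 \<and> lower_density 4 B 0 \<noteq> 0)"
      using comps[of "d / 2"] by (metis less_irrefl)
  qed (use dens zero_mem Yw in auto)
  then show ?thesis ..
qed

end

theorem theorem3p1:
  fixes w :: "3 \<Rightarrow> nat" and f :: "3 cpoly" and X :: "(complex ^ 3) set"
  assumes "\<forall>i. w i > 0" and "w 1 \<ge> w 2" and "w 2 > w 3"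
    and "f \<noteq> 0" and "weighted_homogeneous w f" and "X = zero_set f"
    and "0 isolated_in singular_locus X"
    and "\<not> connected ((X - {0}) \<inter> {a. a $ 3 = 0})"
  shows "\<exists>Y. separating_set 4 X 0 Y"
proof -
  interpret separated_surface w f X
    using assms by unfold_locales auto
  show ?thesis by (rule separating_set_exists)
qed

end
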